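(* Let $\mathbf{R}=\{R_m\}$ be a unital pro ring and $\mathbf{A}=\{A_m\}$ a two-sided ideal of $\mathbf{R}$. Suppose that $\mathbf{A}/\mathbf{A}^2=0$. Then the canonical map $$H_1(\mathrm{GL}_n(\mathbf{A}))\to H_1(\mathrm{GL}(\mathbf{A}))$$ is a pro epimorphism for $n\ge\operatorname{sr}(\mathbf{A})$ and a pro isomorphism for $n\ge\max(3,\operatorname{sr}(\mathbf{A})+1)$.
   Context: A ring means an associative, not necessarily unital, ring; $\mathbb{Z}\ltimes A$ is the unitalization of $A$. $\mathrm{GL}_n(A):=\ker(\mathrm{GL}_n(\mathbb{Z}\ltimes A)\to \mathrm{GL}_n(\mathbb{Z}))$, embedded in $\mathrm{GL}_{n+1}(A)$ by $\alpha\mapsto\left(\begin{smallmatrix}\alpha&0\\0&1\end{smallmatrix}\right)$, and $\mathrm{GL}(A)=\bigcup_n\mathrm{GL}_n(A)$. $H_1$ is integral group homology. A pro ring $\{A_m\}_{m\in J}$ is a pro (inverse) system of rings indexed by a filtered (directed) poset $J$, with structure maps $A_s\to A_m$ for $s\ge m$. It is unital if it is a pro system of unital rings. A two-sided ideal $\mathbf{A}$ of $\mathbf{R}=\{R_m\}_{m\in J}$ is a pro ring $\{A_m\}_{m\in J}$ with a level map $\mathbf{A}\to\mathbf{R}$ exhibiting each $A_m$ as a two-sided ideal of $R_m$. Constructions are applied levelwise; $A^2$ is the additive subgroup generated by products of two elements of $A$. A pro abelian group $\{X_m\}$ is zero if for each $m$ there is $s\ge m$ such that $X_s\to X_m$ is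 zero; so $\mathbf{A}/\mathbf{A}^2=0$ means that for each $m$ there is $s\ge m$ such that the image of $A_s$ in $A_m$ lies in $A_m^2$. A level map $\{f_m\}$ of pro abelian groups is a pro epimorphism if $\{\operatorname{coker}f_m\}$ is zero and a pro isomorphism if moreover $\{\ker f_m\}$ is zero. The stable range $\operatorname{sr}(A)$ of a ring $A$ is the minimum number $r\ge1$ such that for every $n\ge r$ Vaserstein's stable range condition holds: whenever $a_1,\dots,a_{n+1}\in \mathbb{Z}\ltimes A$ satisfy $a_1-1\in A$, $a_2,\dots,a_{n+1}\in A$ and generate the unit left ideal of $\mathbb{Z}\ltimes A$, there are $c_1,\dots,c_n\in A$ such that $a_1+c_1a_{n+1},\dots,a_n+c_na_{n+1}$ generate the unit left ideal ($\infty$ if there is no such $r$). $\operatorname{sr}(\mathbf{A}):=\max_m\operatorname{sr}(A_m)$ ($\infty$ if unbounded). *)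

theory Defs
  imports "HOL-Algebra.Algebra" "HOL-Library.Extended_Nat"
begin

section \<open>Non-unital rings and pro rings\<close>

text \<open>
  Non-unital rings are carried by the library's ring records; the unit field of the record
  is never constrained and never used.
\<close>

locale nonunital_ring = abelian_group A for A :: "'a ring" (structure) +
  assumes mult_closed: "\<lbrakk>x \<in> carrier A; y \<in> carrier A\<rbrakk> \<Longrightarrow> x \<otimes> y \<in> carrier A"
    and mult_assoc:
      "\<lbrakk>x \<in> carrier A; y \<in> carrier A; z \<in> carrier A\<rbrakk> \<Longrightarrow> (x \<otimes> y) \<otimes> z = x \<otimes> (y \<otimes> z)"
    and left_distrib:
      "\<lbrakk>x \<in> carrier A; y \<in> carrier A; z \<in> carrier A\<rbrakk> \<Longrightarrow> (x \<oplus> y) \<otimes> z = x \<otimes> z \<oplus> y \<otimes> z"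
    and right_distrib:
      "\<lbrakk>x \<in> carrier A; y \<in> carrier A; z \<in> carrier A\<rbrakk> \<Longrightarrow> z \<otimes> (x \<oplus> y) = z \<otimes> x \<oplus> z \<otimes> y"

definition nonunital_ring_hom :: "'a ring \<Rightarrow> 'b ring \<Rightarrow> ('a \<Rightarrow> 'b) set" where
  "nonunital_ring_hom A B = hom A B \<inter> hom (add_monoid A) (add_monoid B)"

text \<open>
  The directed index poset is the whole type \<open>'j\<close>.  For \<open>m \<le> s\<close>, the structure map
  \<open>A\<^sub>s \<rightarrow> A\<^sub>m\<close> is \<open>p s m\<close>.
\<close>

locale pro_ring =
  fixes A :: "'j::order \<Rightarrow> 'a ring" and p :: "'j \<Rightarrow> 'j \<Rightarrow> 'a \<Rightarrow> 'a"
  assumes directed: "\<exists>k::'j. i \<le> k \<and> j \<le> k"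
    and level: "nonunital_ring (A m)"
    and transition: "m \<le> s \<Longrightarrow> p s m \<in> nonunital_ring_hom (A s) (A m)"
    and transition_refl: "x \<in> carrier (A m) \<Longrightarrow> p m m x = x"
    and transition_trans:
      "\<lbrakk>m \<le> s; s \<le> t; x \<in> carrier (A t)\<rbrakk> \<Longrightarrow> p s m (p t s x) = p t m x"

locale unital_pro_ring = pro_ring R q
  for R :: "'j::order \<Rightarrow> 'r ring" and q +
  assumes unital_level: "ring (R m)"
    and unital_transition: "m \<le> s \<Longrightarrow> q s m \<in> ring_hom (R s) (R m)"

locale pro_ideal = A?: pro_ring A p + R?: unital_pro_ring R q
  for A :: "'j::order \<Rightarrow> 'a ring" and p and R :: "'j \<Rightarrow> 'r ring" and q +
  fixes \<iota> :: "'j \<Rightarrow> 'a \<Rightarrow> 'r"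
  assumes incl_hom: "\<iota> m \<in> nonunital_ring_hom (A m) (R m)"
    and incl_inj: "inj_on (\<iota> m) (carrier (A m))"
    and incl_ideal: "ideal (\<iota> m ` carrier (A m)) (R m)"
    and incl_level: "\<lbrakk>m \<le> s; x \<in> carrier (A s)\<rbrakk> \<Longrightarrow> \<iota> m (p s m x) = q s m (\<iota> s x)"

section \<open>Pro abelian groups\<close>

text \<open>A pro system consists of groups \<open>V m\<close> and structure maps \<open>t s m : V s \<rightarrow> V m\<close> for \<open>m \<le> s\<close>.\<close>

definition pro_zero ::
    "('j::order \<Rightarrow> 'g monoid) \<Rightarrow> ('j \<Rightarrow> 'j \<Rightarrow> 'g \<Rightarrow> 'g) \<Rightarrow> bool" where
  "pro_zero V t \<longleftrightarrow> (\<forall>m. \<exists>s\<ge>m. \<forall>x\<in>carrier (V s). t s m x = \<one>\<^bsub>V m\<^esub>)"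

text \<open>
  If \<open>f\<close> is a homomorphism from \<open>G\<close> to \<open>H\<close> taking the normal subgroup \<open>M\<close> into \<open>N\<close>, then
  \<open>quotient_map H N f\<close> is the induced map \<open>G Mod M \<rightarrow> H Mod N\<close>: the coset of \<open>x\<close> is sent
  to \<open>N f(M x)\<close>, which is the coset of \<open>f x\<close>.
\<close>

definition quotient_map :: "('b, 'm) monoid_scheme \<Rightarrow> 'b set \<Rightarrow> ('a \<Rightarrow> 'b) \<Rightarrow> 'a set \<Rightarrow> 'b set" where
  "quotient_map H N f C = N <#>\<^bsub>H\<^esub> (f ` C)"

definition pro_epimorphism ::
    "('j::order \<Rightarrow> 'g monoid) \<Rightarrow> ('j \<Rightarrow> 'j \<Rightarrow> 'g \<Rightarrow> 'g) \<Rightarrow>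
     ('j \<Rightarrow> 'h monoid) \<Rightarrow> ('j \<Rightarrow> 'j \<Rightarrow> 'h \<Rightarrow> 'h) \<Rightarrow> ('j \<Rightarrow> 'g \<Rightarrow> 'h) \<Rightarrow> bool" where
  "pro_epimorphism V t W u f \<longleftrightarrow>
     pro_zero (\<lambda>m. W m Mod (f m ` carrier (V m)))
              (\<lambda>s m. quotient_map (W m) (f m ` carrier (V m)) (u s m))"

definition pro_isomorphism ::
    "('j::order \<Rightarrow> 'g monoid) \<Rightarrow> ('j \<Rightarrow> 'j \<Rightarrow> 'g \<Rightarrow> 'g) \<Rightarrow>
     ('j \<Rightarrow> 'h monoid) \<Rightarrow> ('j \<Rightarrow> 'j \<Rightarrow> 'h \<Rightarrow> 'h) \<Rightarrow> ('j \<Rightarrow> 'g \<Rightarrow> 'h) \<Rightarrow> bool" where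
  "pro_isomorphism V t W u f \<longleftrightarrow>
     pro_epimorphism V t W u f \<and>
     pro_zero (\<lambda>m. (V m)\<lparr>carrier := kernel (V m) (W m) (f m)\<rparr>) t"

definition ring_square :: "'a ring \<Rightarrow> 'a set" where
  "ring_square A = generate (add_monoid A) {x \<otimes>\<^bsub>A\<^esub> y | x y. x \<in> carrier A \<and> y \<in> carrier A}"

section \<open>Unitalization and general linear groups\<close>

definition unitalization :: "'a ring \<Rightarrow> (int \<times> 'a) ring" where
  "unitalization A =
     \<lparr>carrier = UNIV \<times> carrier A,
      monoid.mult = (\<lambda>(k, a) (l, b). (k * l, (add_pow A k b \<oplus>\<^bsub>A\<^esub> add_pow A l a) \<oplus>\<^bsub>A\<^esub> a \<otimes>\<^bsub>A\<^esub> b)),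
      one = (1, \<zero>\<^bsub>A\<^esub>),
      ring.zero = (0, \<zero>\<^bsub>A\<^esub>),
      add = (\<lambda>(k, a) (l, b). (k + l, a \<oplus>\<^bsub>A\<^esub> b))\<rparr>"

text \<open>The copy of \<open>A\<close> inside its unitalization.\<close>

definition augmentation_ideal :: "'a ring \<Rightarrow> (int \<times> 'a) set" where
  "augmentation_ideal A = {0} \<times> carrier A"

text \<open>
  An \<open>n \<times> n\<close> matrix \<open>\<alpha>\<close> (indices \<open>0, \<dots>, n - 1\<close>) over a unital ring is represented by the
  infinite matrix \<open>diag(\<alpha>, 1, 1, \<dots>)\<close>.  Thus the embedding of \<open>GL\<^sub>n\<close> into \<open>GL\<^bsub>n+1\<^esub>\<close>,
  \<open>\<alpha> \<mapsto> diag(\<alpha>, 1)\<close>, is the literal inclusion, and the stable group is the literal union.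
  The sum in the product runs over the support of a row, which is finite for such matrices,
  so that the same formula computes products for all \<open>n\<close>.
\<close>

definition id_matrix :: "('r, 'm) ring_scheme \<Rightarrow> nat \<Rightarrow> nat \<Rightarrow> 'r" where
  "id_matrix S i j = (if i = j then \<one>\<^bsub>S\<^esub> else \<zero>\<^bsub>S\<^esub>)"

definition matrix_mult ::
    "('r, 'm) ring_scheme \<Rightarrow> (nat \<Rightarrow> nat \<Rightarrow> 'r) \<Rightarrow> (nat \<Rightarrow> nat \<Rightarrow> 'r) \<Rightarrow> nat \<Rightarrow> nat \<Rightarrow> 'r" where
  "matrix_mult S \<alpha> \<beta> i j = (\<Oplus>\<^bsub>S\<^esub>k\<in>{k. \<alpha> i k \<noteq> \<zero>\<^bsub>S\<^esub>}. \<alpha> i k \<otimes>\<^bsub>S\<^esub> \<beta> k j)"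

definition matrix_monoid :: "nat \<Rightarrow> ('r, 'm) ring_scheme \<Rightarrow> (nat \<Rightarrow> nat \<Rightarrow> 'r) monoid" where
  "matrix_monoid n S =
     \<lparr>carrier = {\<alpha>. (\<forall>i j. \<alpha> i j \<in> carrier S) \<and>
                    (\<forall>i j. \<not> (i < n \<and> j < n) \<longrightarrow> \<alpha> i j = id_matrix S i j)},
      monoid.mult = matrix_mult S,
      one = id_matrix S\<rparr>"

definition unital_GL :: "nat \<Rightarrow> ('r, 'm) ring_scheme \<Rightarrow> (nat \<Rightarrow> nat \<Rightarrow> 'r) monoid" where
  "unital_GL n S = units_of (matrix_monoid n S)"

definition matrix_map :: "('r \<Rightarrow> 's) \<Rightarrow> (nat \<Rightarrow> nat \<Rightarrow> 'r) \<Rightarrow> nat \<Rightarrow> nat \<Rightarrow> 's" where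
  "matrix_map h \<alpha> i j = h (\<alpha> i j)"

definition GL :: "nat \<Rightarrow> 'a ring \<Rightarrow> (nat \<Rightarrow> nat \<Rightarrow> int \<times> 'a) monoid" where
  "GL n A = (unital_GL n (unitalization A))
     \<lparr>carrier := kernel (unital_GL n (unitalization A)) (unital_GL n \<Z>) (matrix_map fst)\<rparr>"

definition GL_stable :: "'a ring \<Rightarrow> (nat \<Rightarrow> nat \<Rightarrow> int \<times> 'a) monoid" where
  "GL_stable A =
     \<lparr>carrier = (\<Union>n. carrier (GL n A)),
      monoid.mult = matrix_mult (unitalization A),
      one = id_matrix (unitalization A)\<rparr>"

text \<open>The effect on \<open>GL\<close> of a homomorphism \<open>f\<close> of non-unital rings.\<close>

definition GL_map ::
    "('a \<Rightarrow> 'b) \<Rightarrow> (nat \<Rightarrow> nat \<Rightarrow> int \<times> 'a) \<Rightarrow> nat \<Rightarrow> nat \<Rightarrow> int \<times> 'b" where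
  "GL_map f = matrix_map (map_prod id f)"

section \<open>Integral group homology\<close>

text \<open>
  The homology of a group with trivial integer coefficients is computed by the inhomogeneous
  bar complex, in which the list \<open>[g\<^sub>1, \<dots>, g\<^sub>n]\<close> is the basis element usually written
  \<open>[g\<^sub>1|\<dots>|g\<^sub>n]\<close> and
  \<open>d [g\<^sub>1|\<dots>|g\<^sub>n] = [g\<^sub>2|\<dots>|g\<^sub>n] +
     (\<Sum>i=1..n-1. (-1)^i [g\<^sub>1|\<dots>|g\<^sub>i g\<^bsub>i+1\<^esub>|\<dots>|g\<^sub>n]) + (-1)^n [g\<^sub>1|\<dots>|g\<^bsub>n-1\<^esub>]\<close>.
\<close>

definition bar_chains :: "nat \<Rightarrow> 'g monoid \<Rightarrow> ('g list \<Rightarrow>\<^sub>0 int) monoid" where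
  "bar_chains n G = free_Abelian_group {gs. length gs = n \<and> set gs \<subseteq> carrier G}"

definition bar_face_sum :: "'g monoid \<Rightarrow> 'g list \<Rightarrow> ('g list \<Rightarrow>\<^sub>0 int)" where
  "bar_face_sum G gs =
     (if gs = [] then 0
      else frag_of (tl gs)
         + (\<Sum>i = 1..<length gs. frag_cmul ((-1) ^ i)
              (frag_of (take (i - 1) gs @ [gs ! (i - 1) \<otimes>\<^bsub>G\<^esub> gs ! i] @ drop (i + 1) gs)))
         + frag_cmul ((-1) ^ length gs) (frag_of (butlast gs)))"

definition bar_differential :: "'g monoid \<Rightarrow> ('g list \<Rightarrow>\<^sub>0 int) \<Rightarrow> ('g list \<Rightarrow>\<^sub>0 int)" where
  "bar_differential G = frag_extend (bar_face_sum G)"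

definition bar_cycles :: "nat \<Rightarrow> 'g monoid \<Rightarrow> ('g list \<Rightarrow>\<^sub>0 int) monoid" where
  "bar_cycles n G =
     (bar_chains n G)\<lparr>carrier := {c \<in> carrier (bar_chains n G). bar_differential G c = 0}\<rparr>"

definition bar_boundaries :: "nat \<Rightarrow> 'g monoid \<Rightarrow> ('g list \<Rightarrow>\<^sub>0 int) set" where
  "bar_boundaries n G = bar_differential G ` carrier (bar_chains (Suc n) G)"

definition group_homology :: "nat \<Rightarrow> 'g monoid \<Rightarrow> ('g list \<Rightarrow>\<^sub>0 int) set monoid" where
  "group_homology n G = bar_cycles n G Mod bar_boundaries n G"

text \<open>The map on homology induced by a homomorphism \<open>f\<close> with codomain \<open>H\<close>.\<close>

definition group_homology_map ::
    "nat \<Rightarrow> 'h monoid \<Rightarrow> ('g \<Rightarrow> 'h) \<Rightarrow> ('g list \<Rightarrow>\<^sub>0 int) set \<Rightarrow> ('h list \<Rightarrow>\<^sub>0 int) set" where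
  "group_homology_map n H f =
     quotient_map (bar_cycles n H) (bar_boundaries n H) (frag_extend (\<lambda>gs. frag_of (map f gs)))"

section \<open>Stable range\<close>

locale left_ideal = additive_subgroup I R for I and R (structure) +
  assumes left_mult_closed: "\<lbrakk>a \<in> I; x \<in> carrier R\<rbrakk> \<Longrightarrow> x \<otimes> a \<in> I"

definition generated_left_ideal :: "('r, 'm) ring_scheme \<Rightarrow> 'r set \<Rightarrow> 'r set" where
  "generated_left_ideal R V = \<Inter>{I. left_ideal I R \<and> V \<subseteq> I}"

definition stable_range_condition :: "nat \<Rightarrow> 'a ring \<Rightarrow> bool" where
  "stable_range_condition n A \<longleftrightarrow>
     (let U = unitalization A; I = augmentation_ideal A in
      \<forall>a :: nat \<Rightarrow> int \<times> 'a.
        (\<forall>i\<in>{1..n + 1}. a i \<in> carrier U) \<and>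
        a 1 \<ominus>\<^bsub>U\<^esub> \<one>\<^bsub>U\<^esub> \<in> I \<and> (\<forall>i\<in>{2..n + 1}. a i \<in> I) \<and>
        generated_left_ideal U (a ` {1..n + 1}) = carrier U \<longrightarrow>
        (\<exists>c. (\<forall>i\<in>{1..n}. c i \<in> I) \<and>
             generated_left_ideal U ((\<lambda>i. a i \<oplus>\<^bsub>U\<^esub> c i \<otimes>\<^bsub>U\<^esub> a (n + 1)) ` {1..n}) = carrier U))"

text \<open>The infimum of the empty set is \<open>\<infinity>\<close>; the supremum below is \<open>\<infinity>\<close> in the unbounded case.\<close>

definition stable_range :: "'a ring \<Rightarrow> enat" where
  "stable_range A = Inf {enat r | r. 1 \<le> r \<and> (\<forall>n\<ge>r. stable_range_condition n A)}"

definition pro_stable_range :: "('j \<Rightarrow> 'a ring) \<Rightarrow> enat" where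
  "pro_stable_range A = (SUP m. stable_range (A m))"

end

theory Submission
  imports Defs
begin

text \<open>
  The first homology of a group is its abelianization (\<open>class_eq_one_iff\<close>), so the claim compares
  commutators in \<open>GL\<^sub>n(A)\<close> and in \<open>GL(A)\<close>.  The comparison goes through the relative elementary group
  \<open>E_rel\<close>, which is generated by the conjugates of elementary matrices \<open>e\<^sub>i\<^sub>j(a)\<close> with \<open>a\<close> in \<open>A\<close> under integral
  elementary matrices.  Three facts about a single ring \<open>A\<close> carry the proof.

    \<^item> Surjective stability: for \<open>k \<ge> sr(A)\<close>, an element of \<open>GL\<^bsub>k+1\<^esub>(A)\<close> is one of \<open>GL\<^sub>k(A)\<close> times relative
      elementary factors (\<open>GL_rel_decomposition\<close>).  One column is reduced by the stable range condition.

    \<^item> Commutators in \<open>GL(A)\<close> are stably relative elementary (\<open>commutator_E_rel\<close>).  One of the two matrices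
      is moved away from the other by integral permutations with signs.

    \<^item> Injective stability: for \<open>k \<ge> sr(A) + 1\<close> and \<open>k \<ge> 3\<close>, a relative elementary matrix of size \<open>k + 1\<close>
      that lies in \<open>GL\<^sub>k(A)\<close> is relative elementary of size \<open>k\<close> (\<open>E_rel_injective_stability\<close>).  The relative
      elementary group equals a big cell of products of three factors, in which the block in \<open>GL\<^sub>k(A)\<close> is
      unique up to relative elementary matrices.

  The hypothesis \<open>A/A\<^sup>2 = 0\<close> provides, for each \<open>m\<close>, an \<open>s \<ge> m\<close> such that \<open>A\<^sub>s \<rightarrow> A\<^sub>m\<close> has image in
  \<open>A\<^sub>m\<^sup>2\<close>.  Because \<open>e\<^sub>i\<^sub>j(x y)\<close> is the commutator of \<open>e\<^sub>i\<^sub>k(x)\<close> and \<open>e\<^sub>k\<^sub>j(y)\<close>, this map takes relative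
  elementary matrices of size at least \<open>3\<close> to products of commutators (\<open>E_rel_derived\<close>).  The three facts
  hold exactly, not only up to transition maps; so this one map kills the cokernel and the kernel, although
  the descent from \<open>GL(A)\<close> to \<open>GL\<^sub>n(A)\<close> takes arbitrarily many steps.

  Matrices are represented by the linear maps that they define on columns, over one unital ring that contains
  all unitalizations (\<open>uring\<close>).
\<close>

section \<open>Linear automorphisms of column vectors\<close>

abbreviation inv_map :: "('v \<Rightarrow> 'v) \<Rightarrow> 'v \<Rightarrow> 'v" where "inv_map \<equiv> inv_into UNIV"

definition basis :: "nat \<Rightarrow> nat \<Rightarrow> 'r::ring_1" where
  "basis j i = (if i = j then 1 else 0)"

text \<open>
  The sum runs over the support of \<open>r\<close>, so that row vectors need not carry an index set; it is
  meaningful for rows with finite support.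
\<close>

definition dot :: "(nat \<Rightarrow> 'r::ring_1) \<Rightarrow> (nat \<Rightarrow> 'r) \<Rightarrow> 'r" where
  "dot r x = (\<Sum>k | r k \<noteq> 0. r k * x k)"

definition vec_on :: "nat set \<Rightarrow> 'r::ring_1 set \<Rightarrow> (nat \<Rightarrow> 'r) set" where
  "vec_on I S = {c. (\<forall>k\<in>I. c k \<in> S) \<and> (\<forall>k. k \<notin> I \<longrightarrow> c k = 0)}"

definition linear_map :: "((nat \<Rightarrow> 'r::ring_1) \<Rightarrow> nat \<Rightarrow> 'r) \<Rightarrow> bool" where
  "linear_map T \<longleftrightarrow> (\<forall>x y. T (\<lambda>i. x i + y i) = (\<lambda>i. T x i + T y i)) \<and>
                   (\<forall>x c. T (\<lambda>i. x i * c) = (\<lambda>i. T x i * c))"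

text \<open>
  The matrix of \<open>T\<close> is the identity outside \<open>I \<times> I\<close>: the first half speaks of its rows, the second
  of its columns.
\<close>

definition supported :: "nat set \<Rightarrow> ((nat \<Rightarrow> 'r::ring_1) \<Rightarrow> nat \<Rightarrow> 'r) \<Rightarrow> bool" where
  "supported I T \<longleftrightarrow> (\<forall>x i. i \<notin> I \<longrightarrow> T x i = x i) \<and> (\<forall>x. (\<forall>i\<in>I. x i = 0) \<longrightarrow> T x = x)"

text \<open>
  The group \<open>GL\<^sub>I\<close> over the ring \<open>'r\<close>.  Elements act from the left on columns of arbitrary support,
  which are a right module; so products of matrices are compositions and identities between matrices
  are checked by evaluating both sides on a column.
\<close>

definition Aut :: "nat set \<Rightarrow> ((nat \<Rightarrow> 'r::ring_1) \<Rightarrow> nat \<Rightarrow> 'r) set" where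
  "Aut I = {T. linear_map T \<and> bij T \<and> supported I T}"

definition conjugate :: "('v \<Rightarrow> 'v) \<Rightarrow> ('v \<Rightarrow> 'v) \<Rightarrow> 'v \<Rightarrow> 'v" where
  "conjugate s a = s \<circ> a \<circ> inv_map s"

lemma conjugateI: "bij s \<Longrightarrow> s \<circ> a = b \<circ> s \<Longrightarrow> conjugate s a = b"
  unfolding conjugate_def by (metis bij_betw_def comp_assoc comp_id surj_iff)

lemma conjugate_comp: "bij s \<Longrightarrow> conjugate s (a \<circ> b) = conjugate s a \<circ> conjugate s b"
  unfolding conjugate_def by (auto simp: fun_eq_iff bij_is_inj)

lemma conjugate_conjugate:
  "bij s \<Longrightarrow> bij t \<Longrightarrow> conjugate s (conjugate t a) = conjugate (s \<circ> t) a"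
  unfolding conjugate_def by (simp add: o_inv_distrib comp_assoc)

lemma conjugate_id [simp]: "bij s \<Longrightarrow> conjugate s id = id"
  unfolding conjugate_def by (metis bij_is_surj surj_iff comp_id)

lemma conjugate_inv: "bij s \<Longrightarrow> bij a \<Longrightarrow> conjugate s (inv_map a) = inv_map (conjugate s a)"
  unfolding conjugate_def by (simp add: o_inv_distrib bij_imp_bij_inv bij_comp inv_inv_eq comp_assoc)

lemma conjugate_conjugate_inv: "bij s \<Longrightarrow> conjugate s (conjugate (inv_map s) a) = a"
  unfolding conjugate_def by (auto simp: fun_eq_iff bij_is_surj surj_f_inv_f inv_inv_eq)

lemma bij_conjugate: "bij s \<Longrightarrow> bij a \<Longrightarrow> bij (conjugate s a)"
  unfolding conjugate_def by (simp add: bij_comp bij_imp_bij_inv)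

lemma conjugate_swap: "bij s \<Longrightarrow> s \<circ> a = conjugate s a \<circ> s"
  unfolding conjugate_def by (auto simp: fun_eq_iff bij_is_inj)

lemma inv_comp_cancel: "bij s \<Longrightarrow> inv_map s (s x) = x" "bij s \<Longrightarrow> s (inv_map s x) = x"
  by (simp_all add: bij_is_inj bij_is_surj surj_f_inv_f)

lemma dot_eq_sum: "finite I \<Longrightarrow> (\<And>k. k \<notin> I \<Longrightarrow> r k = 0) \<Longrightarrow> dot r x = (\<Sum>k\<in>I. r k * x k)"
  unfolding dot_def by (rule sum.mono_neutral_left) auto

lemma dot_add_right: "dot r (\<lambda>i. x i + y i) = dot r x + dot r y"
  unfolding dot_def by (simp add: distrib_left sum.distrib)

lemma dot_scale_right: "dot r (\<lambda>i. x i * c) = dot r x * c"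
  unfolding dot_def by (simp add: sum_distrib_right mult.assoc)

lemma dot_scale_left:
  assumes "finite {k. r k \<noteq> 0}" shows "dot (\<lambda>i. c * r i) x = c * dot r x"
proof -
  have "dot (\<lambda>i. c * r i) x = (\<Sum>k | r k \<noteq> 0. c * r k * x k)"
    by (rule dot_eq_sum) (use assms in auto)
  then show ?thesis by (simp add: dot_def sum_distrib_left mult.assoc)
qed

lemma dot_add_left:
  assumes "finite {k. r k \<noteq> 0}" "finite {k. s k \<noteq> 0}"
  shows "dot (\<lambda>i. r i + s i) x = dot r x + dot s x"
proof -
  let ?K = "{k. r k \<noteq> 0} \<union> {k. s k \<noteq> 0}"
  have "dot (\<lambda>i. r i + s i) x = (\<Sum>k\<in>?K. (r k + s k) * x k)" "dot r x = (\<Sum>k\<in>?K. r k * x k)"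
       "dot s x = (\<Sum>k\<in>?K. s k * x k)"
    by (rule dot_eq_sum; use assms in auto)+
  then show ?thesis by (simp add: distrib_right sum.distrib)
qed

lemma dot_uminus_left: "dot (\<lambda>i. - r i) x = - dot r x"
  unfolding dot_def by (simp add: sum_negf)

lemma dot_single: "dot (\<lambda>i. if i = j then a else 0) x = a * x j"
  by (subst dot_eq_sum[of "{j}"]) auto

lemma dot_zero [simp]: "dot (\<lambda>i. 0) x = 0"
  by (simp add: dot_def)

lemma finite_support_vec_on: "c \<in> vec_on I S \<Longrightarrow> finite I \<Longrightarrow> finite {k. c k \<noteq> 0}"
  by (rule finite_subset[of _ I]) (auto simp: vec_on_def)

lemma dot_cong_support: "(\<And>k. r k \<noteq> 0 \<Longrightarrow> x k = y k) \<Longrightarrow> dot r x = dot r y"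
  unfolding dot_def by (rule sum.cong) auto

lemma dot_upd_outside: "r i = 0 \<Longrightarrow> dot r (x(i := c)) = dot r x"
  by (rule dot_cong_support) auto

lemma linear_mapD:
  assumes "linear_map T"
  shows "T (\<lambda>i. x i + y i) = (\<lambda>i. T x i + T y i)" "T (\<lambda>i. x i * c) = (\<lambda>i. T x i * c)"
  using assms by (auto simp: linear_map_def)

lemma linear_map_zero: "linear_map T \<Longrightarrow> T (\<lambda>i. 0) = (\<lambda>i. 0)"
  using linear_mapD(2)[of T "\<lambda>i. 0" 0] by (simp)

lemma linear_map_diff: "linear_map T \<Longrightarrow> T (\<lambda>i. x i - y i) = (\<lambda>i. T x i - T y i)"
  using linear_mapD(1)[of T x "\<lambda>i. y i * (-1)"] linear_mapD(2)[of T y "-1"] by simp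

lemma linear_map_sum:
  assumes "linear_map T" shows "T (\<lambda>i. \<Sum>l\<in>K. f l i) = (\<lambda>i. \<Sum>l\<in>K. T (f l) i)"
  by (induction K rule: infinite_finite_induct)
     (simp_all add: linear_map_zero[OF assms] linear_mapD[OF assms])

lemma linear_map_comp: "linear_map S \<Longrightarrow> linear_map T \<Longrightarrow> linear_map (S \<circ> T)"
  by (simp add: linear_map_def)

lemma linear_map_inv:
  assumes "linear_map T" "bij T" shows "linear_map (inv_map T)"
proof -
  have eq: "inv_map T y = x \<longleftrightarrow> y = T x" for x y
    using assms(2) inv_comp_cancel by metis
  show ?thesis unfolding linear_map_def eq
    by (simp add: linear_mapD[OF assms(1)] inv_comp_cancel assms(2))
qed

lemma supported_comp: "supported I S \<Longrightarrow> supported I T \<Longrightarrow> supported I (S \<circ> T)"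
  by (simp add: supported_def)

lemma supported_inv:
  fixes T :: "(nat \<Rightarrow> 'a::ring_1) \<Rightarrow> nat \<Rightarrow> 'a"
  assumes "supported I T" "bij T" shows "supported I (inv_map T)"
  unfolding supported_def
proof (intro conjI allI impI)
  fix x :: "nat \<Rightarrow> 'a" and i assume "i \<notin> I"
  then show "inv_map T x i = x i"
    using assms by (metis supported_def inv_comp_cancel(2))
next
  fix x :: "nat \<Rightarrow> 'a" assume "\<forall>i\<in>I. x i = 0"
  then have "T x = x" using assms by (simp add: supported_def)
  then show "inv_map T x = x" using assms by (metis inv_comp_cancel(1))
qed

lemma supported_mono: "supported I T \<Longrightarrow> I \<subseteq> K \<Longrightarrow> supported K T"
  unfolding supported_def by blast

lemma Aut_id [simp]: "id \<in> Aut I"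
  by (auto simp: Aut_def linear_map_def supported_def)

lemma Aut_comp [intro]: "S \<in> Aut I \<Longrightarrow> T \<in> Aut I \<Longrightarrow> S \<circ> T \<in> Aut I"
  by (auto simp: Aut_def linear_map_comp supported_comp bij_comp)

lemma Aut_inv [intro]: "T \<in> Aut I \<Longrightarrow> inv_map T \<in> Aut I"
  by (auto simp: Aut_def linear_map_inv supported_inv bij_imp_bij_inv)

lemma Aut_bij: "T \<in> Aut I \<Longrightarrow> bij T" and Aut_linear: "T \<in> Aut I \<Longrightarrow> linear_map T"
  by (auto simp: Aut_def)

lemma Aut_conjugate [intro]: "S \<in> Aut I \<Longrightarrow> T \<in> Aut I \<Longrightarrow> conjugate S T \<in> Aut I"
  unfolding conjugate_def by blast

lemma Aut_mono: "T \<in> Aut I \<Longrightarrow> I \<subseteq> K \<Longrightarrow> T \<in> Aut K"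
  using supported_mono by (auto simp: Aut_def)

lemma Aut_outside: "T \<in> Aut I \<Longrightarrow> i \<notin> I \<Longrightarrow> T x i = x i"
  by (auto simp: Aut_def supported_def)

lemma Aut_fixes: "T \<in> Aut I \<Longrightarrow> (\<And>i. i \<in> I \<Longrightarrow> x i = 0) \<Longrightarrow> T x = x"
  by (auto simp: Aut_def supported_def)

lemma Aut_basis: "T \<in> Aut I \<Longrightarrow> j \<notin> I \<Longrightarrow> T (basis j) = basis j"
  by (erule Aut_fixes) (auto simp: basis_def)

lemma Aut_upd:
  assumes T: "T \<in> Aut I" and j: "j \<notin> I"
  shows "T (x(j := c)) = (T x)(j := c)"
proof -
  have "x(j := c) = (\<lambda>i. x i + basis j i * (c - x j))"
    by (auto simp: basis_def)
  then have "T (x(j := c)) = (\<lambda>i. T x i + basis j i * (c - x j))"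
    by (simp add: linear_mapD[OF Aut_linear[OF T]] Aut_basis[OF T j])
  then show ?thesis using Aut_outside[OF T j, of x] by (auto simp: basis_def)
qed

lemma linear_map_upd:
  assumes "linear_map T" "T (basis j) = basis j"
  shows "T (x(j := x j + c)) = (T x)(j := T x j + c)"
proof -
  have "x(j := x j + c) = (\<lambda>i. x i + basis j i * c)"
    by (simp add: basis_def fun_eq_iff)
  then have "T (x(j := x j + c)) = T (\<lambda>i. x i + basis j i * c)"
    by (rule arg_cong)
  also have "\<dots> = (\<lambda>i. T x i + basis j i * c)"
    by (simp only: linear_mapD[OF assms(1)] assms(2))
  also have "\<dots> = (T x)(j := T x j + c)"
    by (simp add: basis_def fun_eq_iff)
  finally show ?thesis .
qed

lemma Aut_row_sum:
  assumes T: "T \<in> Aut I" and fin: "finite I" and k: "k \<in> I"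
  shows "T x k = (\<Sum>l\<in>I. T (basis l) k * x l)"
proof -
  let ?y = "\<lambda>i. if i \<in> I then 0 else x i"
  note lin = Aut_linear[OF T]
  have "x = (\<lambda>i. (\<Sum>l\<in>I. basis l i * x l) + ?y i)"
  proof
    fix i
    have "(\<Sum>l\<in>I. basis l i * x l) = (\<Sum>l\<in>I. if l = i then x l else 0)"
      by (rule sum.cong) (auto simp: basis_def)
    then show "x i = (\<Sum>l\<in>I. basis l i * x l) + ?y i" using fin by simp
  qed
  then have "T x = T (\<lambda>i. (\<Sum>l\<in>I. basis l i * x l) + ?y i)" by (rule arg_cong)
  also have "\<dots> = (\<lambda>i. (\<Sum>l\<in>I. T (basis l) i * x l) + T ?y i)"
    by (simp add: linear_mapD[OF lin] linear_map_sum[OF lin])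
  also have "T ?y = ?y" by (rule Aut_fixes[OF T]) auto
  finally show ?thesis using k by simp
qed

lemma Aut_row:
  assumes T: "T \<in> Aut I" and fin: "finite I"
  shows "T x k = dot (\<lambda>l. T (basis l) k) x"
proof (cases "k \<in> I")
  case True
  have "dot (\<lambda>l. T (basis l) k) x = (\<Sum>l\<in>I. T (basis l) k * x l)"
    by (rule dot_eq_sum[OF fin]) (use True in \<open>auto simp: Aut_basis[OF T] basis_def\<close>)
  then show ?thesis using Aut_row_sum[OF T fin True, of x] by simp
next
  case False
  then have "(\<lambda>l. T (basis l) k) = (\<lambda>l. if l = k then 1 else 0)"
    using Aut_outside[OF T False] by (auto simp: basis_def)
  then show ?thesis using False by (simp add: Aut_outside[OF T] dot_single)
qed

lemma Aut_row_support:
  assumes "T \<in> Aut I" "finite I" shows "finite {l. T (basis l) k \<noteq> 0}"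
proof (rule finite_subset)
  show "{l. T (basis l) k \<noteq> 0} \<subseteq> insert k I"
    using Aut_basis[OF assms(1)] by (auto simp: basis_def split: if_splits)
qed (use assms in simp)

lemma dot_Aut:
  assumes T: "T \<in> Aut I" and fin: "finite I" and r: "r \<in> vec_on I S"
  shows "dot r (T x) = dot (\<lambda>l. if l \<in> I then dot r (T (basis l)) else 0) x"
proof -
  have r0: "r k = 0" if "k \<notin> I" for k using r that by (auto simp: vec_on_def)
  have "dot r (T x) = (\<Sum>k\<in>I. r k * (\<Sum>l\<in>I. T (basis l) k * x l))"
    by (subst dot_eq_sum[OF fin r0])
       (auto intro!: sum.cong arg_cong[where f = "\<lambda>y. _ * y"] Aut_row_sum[OF T fin])
  also have "\<dots> = (\<Sum>k\<in>I. \<Sum>l\<in>I. r k * T (basis l) k * x l)"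
    by (simp add: sum_distrib_left mult.assoc)
  also have "\<dots> = (\<Sum>l\<in>I. \<Sum>k\<in>I. r k * T (basis l) k * x l)"
    by (rule sum.swap)
  also have "\<dots> = (\<Sum>l\<in>I. dot r (T (basis l)) * x l)"
    by (simp add: dot_eq_sum[OF fin r0] sum_distrib_right)
  also have "\<dots> = dot (\<lambda>l. if l \<in> I then dot r (T (basis l)) else 0) x"
    by (subst dot_eq_sum[OF fin]) auto
  finally show ?thesis .
qed

lemma Aut_eqI:
  assumes "S \<in> Aut I" "T \<in> Aut I" "finite I" "\<And>l. S (basis l) = T (basis l)"
  shows "S = T"
proof (intro ext)
  fix x k
  show "S x k = T x k"
    by (subst Aut_row[OF assms(1,3)], subst Aut_row[OF assms(2,3)]) (simp only: assms(4))
qed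

text \<open>
  The elementary matrix \<open>e\<^sub>i\<^sub>j(a)\<close>.
\<close>

definition tv :: "nat \<Rightarrow> nat \<Rightarrow> 'r::ring_1 \<Rightarrow> (nat \<Rightarrow> 'r) \<Rightarrow> nat \<Rightarrow> 'r" where
  "tv i j a x = x(i := x i + a * x j)"

text \<open>
  The matrix \<open>1 + c e\<^sub>j\<^sup>T\<close> with a column \<open>c\<close>; it is used when \<open>c j = 0\<close>, where it is the product of
  the commuting matrices \<open>e\<^sub>k\<^sub>j(c k)\<close>.
\<close>

definition tcol :: "nat \<Rightarrow> (nat \<Rightarrow> 'r::ring_1) \<Rightarrow> (nat \<Rightarrow> 'r) \<Rightarrow> nat \<Rightarrow> 'r" where
  "tcol j c x = (\<lambda>i. x i + c i * x j)"

text \<open>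
  The matrix \<open>1 + e\<^sub>i r\<close> with a row \<open>r\<close>; it is used when \<open>r i = 0\<close>.
\<close>

definition trow :: "nat \<Rightarrow> (nat \<Rightarrow> 'r::ring_1) \<Rightarrow> (nat \<Rightarrow> 'r) \<Rightarrow> nat \<Rightarrow> 'r" where
  "trow i r x = x(i := x i + dot r x)"

lemma tv_tv: "i \<noteq> j \<Longrightarrow> tv i j a \<circ> tv i j b = tv i j (a + b)"
  by (auto simp: tv_def fun_eq_iff algebra_simps)

lemma tv_zero [simp]: "tv i j 0 = id"
  by (auto simp: tv_def fun_eq_iff)

lemma tv_eq_tcol: "tv i j a = tcol j (\<lambda>k. if k = i then a else 0)"
  by (auto simp: tv_def tcol_def fun_eq_iff)

lemma tv_eq_trow: "tv i j a = trow i (\<lambda>k. if k = j then a else 0)"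
  by (auto simp: tv_def trow_def dot_single)

lemma tcol_tcol: "c j = 0 \<Longrightarrow> tcol j c \<circ> tcol j c' = tcol j (\<lambda>k. c k + c' k)" if "c' j = 0"
  using that by (auto simp: tcol_def fun_eq_iff algebra_simps)

lemma tcol_zero [simp]: "tcol j (\<lambda>k. 0) = id"
  by (auto simp: tcol_def fun_eq_iff)

lemma trow_zero [simp]: "trow j (\<lambda>k. 0) = id"
  by (auto simp: trow_def fun_eq_iff)

lemma trow_trow:
  assumes "r i = 0" "r' i = 0" "finite {k. r k \<noteq> 0}" "finite {k. r' k \<noteq> 0}"
  shows "trow i r \<circ> trow i r' = trow i (\<lambda>k. r k + r' k)"
  using assms by (auto simp: trow_def fun_eq_iff dot_add_left dot_upd_outside algebra_simps)

lemma bij_of_inverse: "f \<circ> g = id \<Longrightarrow> g \<circ> f = id \<Longrightarrow> bij f \<and> inv_map f = g"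
  by (metis bij_def inj_iff surj_iff inv_unique_comp o_bij)

lemma inv_tv: "i \<noteq> j \<Longrightarrow> inv_map (tv i j a) = tv i j (- a)"
  and bij_tv: "i \<noteq> j \<Longrightarrow> bij (tv i j a)"
  using bij_of_inverse[of "tv i j a" "tv i j (-a)"] by (simp_all add: tv_tv)

lemma inv_tcol: "c j = 0 \<Longrightarrow> inv_map (tcol j c) = tcol j (\<lambda>k. - c k)"
  and bij_tcol: "c j = 0 \<Longrightarrow> bij (tcol j c)"
  using bij_of_inverse[of "tcol j c" "tcol j (\<lambda>k. - c k)"] by (simp_all add: tcol_tcol)

lemma inv_trow: "r i = 0 \<Longrightarrow> finite {k. r k \<noteq> 0} \<Longrightarrow> inv_map (trow i r) = trow i (\<lambda>k. - r k)"
  and bij_trow: "r i = 0 \<Longrightarrow> finite {k. r k \<noteq> 0} \<Longrightarrow> bij (trow i r)"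
  using bij_of_inverse[of "trow i r" "trow i (\<lambda>k. - r k)"] by (simp_all add: trow_trow)

lemma tv_Aut: "i \<in> I \<Longrightarrow> j \<in> I \<Longrightarrow> i \<noteq> j \<Longrightarrow> tv i j a \<in> Aut I"
  by (auto simp: Aut_def bij_tv linear_map_def supported_def tv_def fun_eq_iff algebra_simps)

text \<open>
  Conjugation turns \<open>1 + c e\<^sub>j\<^sup>T\<close> into \<open>1 + (g c) (e\<^sub>j\<^sup>T g\<^sup>-\<^sup>1)\<close>, and row \<open>j\<close> of \<open>g\<close> is trivial here.
\<close>

lemma tcol_move:
  assumes "linear_map g" "\<And>x. g x j = x j"
  shows "g \<circ> tcol j c = tcol j (g c) \<circ> g"
  using assms(2) by (auto simp: tcol_def fun_eq_iff linear_mapD[OF assms(1)])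

lemma trow_move:
  assumes "linear_map g" "g (basis i) = basis i" "\<And>x. dot r (g x) = dot r' x"
  shows "trow i r \<circ> g = g \<circ> trow i r'"
  using assms(3) by (auto simp: trow_def fun_eq_iff linear_map_upd[OF assms(1,2)])

lemma tv_commutator:
  assumes "distinct [i, j, k]"
  shows "tv i k a \<circ> tv k j b \<circ> inv_map (tv i k a) \<circ> inv_map (tv k j b) = tv i j (a * b)"
  using assms by (auto simp: inv_tv tv_def fun_eq_iff algebra_simps)

section \<open>Integral and relative elementary groups\<close>

text \<open>
  The elementary group over the integers.  It acts over every ring, and it only serves to conjugate
  the elementary matrices with entries in an ideal.
\<close>

inductive_set E_int :: "nat set \<Rightarrow> ((nat \<Rightarrow> 'r::ring_1) \<Rightarrow> nat \<Rightarrow> 'r) set" for I where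
  E_int_id: "id \<in> E_int I"
| E_int_step: "\<lbrakk>i \<in> I; j \<in> I; i \<noteq> j; s \<in> {1, -1}; \<sigma> \<in> E_int I\<rbrakk> \<Longrightarrow> tv i j s \<circ> \<sigma> \<in> E_int I"

lemma tv_E_int: "\<lbrakk>i \<in> I; j \<in> I; i \<noteq> j; s \<in> {1, -1}\<rbrakk> \<Longrightarrow> tv i j s \<in> E_int I"
  using E_int_step[OF _ _ _ _ E_int_id] by fastforce

lemma E_int_comp: "\<sigma> \<in> E_int I \<Longrightarrow> \<tau> \<in> E_int I \<Longrightarrow> \<sigma> \<circ> \<tau> \<in> E_int I"
  by (erule E_int.induct) (auto simp del: o_apply id_apply simp: comp_assoc intro: E_int_id E_int_step)

lemma E_int_Aut: "\<sigma> \<in> E_int I \<Longrightarrow> \<sigma> \<in> Aut I"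
  by (erule E_int.induct) (auto simp del: o_apply id_apply intro: tv_Aut)

lemma E_int_bij: "\<sigma> \<in> E_int I \<Longrightarrow> bij \<sigma>"
  using E_int_Aut Aut_bij by blast

lemma E_int_inv: "\<sigma> \<in> E_int I \<Longrightarrow> inv_map \<sigma> \<in> E_int I"
proof (induction \<sigma> rule: E_int.induct)
  case E_int_id
  show "inv_map id \<in> E_int I" unfolding inv_id by (rule E_int.E_int_id)
next
  case (E_int_step i j s \<sigma>)
  then have "inv_map (tv i j s \<circ> \<sigma>) = inv_map \<sigma> \<circ> tv i j (- s)"
    by (simp add: o_inv_distrib bij_tv E_int_bij inv_tv)
  moreover have "tv i j (- s) \<in> E_int I" using E_int_step by (intro tv_E_int) auto
  ultimately show "inv_map (tv i j s \<circ> \<sigma>) \<in> E_int I" using E_int_step by (simp add: E_int_comp)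
qed

lemma E_int_mono: "\<sigma> \<in> E_int I \<Longrightarrow> I \<subseteq> K \<Longrightarrow> \<sigma> \<in> E_int K"
  by (erule E_int.induct) (auto simp del: o_apply id_apply intro: E_int_id E_int_step)

text \<open>
  If index \<open>m\<close> is not used by \<open>h\<close>, the commutator of \<open>h\<close> with \<open>e\<^sub>m\<^sub>j(s)\<close> lives in row \<open>m\<close>.  For \<open>h\<close>
  congruent to \<open>1\<close> modulo an ideal its entries lie in the ideal, whatever \<open>s\<close> is.
\<close>

lemma conjugate_tv_row:
  assumes h: "h \<in> Aut K" and fin: "finite K" and m: "m \<notin> K" "j \<noteq> m"
  shows "conjugate (tv m j s) h = h \<circ> trow m (\<lambda>l. s * (h (basis l) j - basis l j))"
proof (rule conjugateI)
  show "bij (tv m j s)" using m by (simp add: bij_tv)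
  define r where "r = (\<lambda>l. s * (h (basis l) j - basis l j))"
  have f: "finite {l. h (basis l) j \<noteq> 0}" "finite {l. - basis l j \<noteq> (0::'a)}"
    using Aut_row_support[OF h fin] by (auto simp: basis_def)
  have d: "dot r x = s * (h x j - x j)" for x
  proof -
    have "dot (\<lambda>l. h (basis l) j + - basis l j) x = h x j - x j"
      using dot_add_left[OF f, of x] Aut_row[OF h fin, of x j] Aut_row[OF Aut_id[of K] fin, of x j]
      by (simp add: dot_uminus_left)
    moreover have "finite {l. h (basis l) j + - basis l j \<noteq> 0}"
      by (rule finite_subset[OF _ finite_UnI[OF f]]) auto
    ultimately show ?thesis using dot_scale_left[of "\<lambda>l. h (basis l) j + - basis l j" s x]
      by (simp add: r_def)
  qed
  have rm: "r m = 0" using m Aut_basis[OF h m(1)] by (simp add: basis_def r_def)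
  show "tv m j s \<circ> h = h \<circ> trow m (\<lambda>l. s * (h (basis l) j - basis l j)) \<circ> tv m j s"
    unfolding r_def[symmetric]
    by (rule ext) (simp add: tv_def trow_def Aut_upd[OF h m(1)] dot_upd_outside[of r m, OF rm] d
        Aut_outside[OF h m(1)] algebra_simps)
qed

lemma conjugate_tv_col:
  assumes h: "h \<in> Aut K" and m: "m \<notin> K" "i \<noteq> m"
  shows "conjugate (tv i m s) h = tcol m (\<lambda>k. (basis i k - h (basis i) k) * s) \<circ> h"
proof (rule conjugateI)
  show "bij (tv i m s)" using m by (simp add: bij_tv)
  have e: "tv i m s x = (\<lambda>k. x k + basis i k * (s * x m))" for x
    by (auto simp: tv_def basis_def)
  have hh: "h (tv i m s x) = (\<lambda>k. h x k + h (basis i) k * (s * x m))" for x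
    unfolding e by (simp only: linear_mapD[OF Aut_linear[OF h]])
  show "tv i m s \<circ> h = tcol m (\<lambda>k. (basis i k - h (basis i) k) * s) \<circ> h \<circ> tv i m s"
    apply (rule ext)
    apply (simp add: tcol_def hh Aut_outside[OF h m(1)])
    using m apply (simp add: e Aut_outside[OF h m(1)] basis_def fun_eq_iff algebra_simps)
    done
qed

text \<open>
  The signed transposition; the sign keeps it in the elementary group.
\<close>

definition swap :: "nat \<Rightarrow> nat \<Rightarrow> (nat \<Rightarrow> 'r::ring_1) \<Rightarrow> nat \<Rightarrow> 'r" where
  "swap p q x = x(p := x q, q := - x p)"

lemma swap_eq: "p \<noteq> q \<Longrightarrow> swap p q = tv p q 1 \<circ> (tv q p (-1) \<circ> tv p q 1)"
  by (auto simp: swap_def tv_def fun_eq_iff)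

lemma swap_E_int: "p \<in> I \<Longrightarrow> q \<in> I \<Longrightarrow> p \<noteq> q \<Longrightarrow> swap p q \<in> E_int I"
  by (simp add: swap_eq E_int_comp tv_E_int)

lemma bij_swap: "p \<noteq> q \<Longrightarrow> bij (swap p q)"
  using swap_E_int[of p UNIV q] E_int_bij by blast

lemma inv_swap: "p \<noteq> q \<Longrightarrow> inv_map (swap p q) x = x(p := - x q, q := x p)"
  by (rule inv_f_eq) (auto simp: bij_swap bij_is_inj swap_def)

lemma Aut_conjugate_swap:
  assumes h: "h \<in> Aut I" and pq: "p \<noteq> q" "q \<notin> I"
  shows "conjugate (swap p q) h \<in> Aut (insert q (I - {p}))"
proof -
  have "h \<in> Aut (insert p (insert q I))" by (rule Aut_mono[OF h]) auto
  moreover have "swap p q \<in> E_int (insert p (insert q I))" using pq by (intro swap_E_int) auto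
  ultimately have big: "conjugate (swap p q) h \<in> Aut (insert p (insert q I))"
    using E_int_Aut by (intro Aut_conjugate)
  have hq: "h y q = y q" for y using h pq by (simp add: Aut_outside)
  have "supported (insert q (I - {p})) (conjugate (swap p q) h)"
    unfolding supported_def
  proof (intro conjI allI impI)
    fix x :: "nat \<Rightarrow> 'a" and i assume i: "i \<notin> insert q (I - {p})"
    show "conjugate (swap p q) h x i = x i"
    proof (cases "i = p")
      case True
      then show ?thesis using pq by (simp add: conjugate_def inv_swap hq swap_def)
    next
      case False
      then show ?thesis using i Aut_outside[OF h, of i]
        by (simp add: conjugate_def inv_swap[OF pq(1)] swap_def)
    qed
  next
    fix x :: "nat \<Rightarrow> 'a" assume x: "\<forall>i\<in>insert q (I - {p}). x i = 0"
    let ?y = "inv_map (swap p q) x"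
    have "h ?y = ?y"
      by (rule Aut_fixes[OF h]) (use x pq in \<open>auto simp: inv_swap\<close>)
    then show "conjugate (swap p q) h x = x"
      using pq by (simp add: conjugate_def inv_comp_cancel bij_swap)
  qed
  then show ?thesis using big by (simp add: Aut_def)
qed

lemma conjugate_swap_tv:
  assumes "p \<noteq> q" "i \<noteq> j" "i \<noteq> q" "j \<noteq> q"
  shows "conjugate (swap p q) (tv i j a) =
           (if i = p then tv q j (- a) else if j = p then tv i q (- a) else tv i j a)"
  by (rule conjugateI) (use assms in \<open>auto simp: bij_swap swap_def tv_def fun_eq_iff\<close>)

lemma E_int_conjugate_swap:
  assumes "\<sigma> \<in> E_int I" "p \<noteq> q" "q \<notin> I"
  shows "conjugate (swap p q) \<sigma> \<in> E_int (insert q (I - {p}))"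
  using assms(1)
proof (induction \<sigma> rule: E_int.induct)
  case E_int_id
  show "conjugate (swap p q) id \<in> E_int (insert q (I - {p}))" 
    unfolding conjugate_id[OF bij_swap[OF assms(2)]] by (rule E_int.E_int_id)
next
  case (E_int_step i j s \<sigma>)
  have "conjugate (swap p q) (tv i j s) \<in> E_int (insert q (I - {p}))"
    using E_int_step assms by (subst conjugate_swap_tv) (auto intro!: tv_E_int)
  then show "conjugate (swap p q) (tv i j s \<circ> \<sigma>) \<in> E_int (insert q (I - {p}))"
    using E_int_step assms by (simp add: conjugate_comp bij_swap E_int_comp)
qed

text \<open>
  Swapping one index after the other with unused ones moves the support of a matrix off a given finite
  set.
\<close>

lemma E_int_separate:
  assumes "finite I" "finite D"
  shows "\<exists>K I' \<sigma>. finite K \<and> \<sigma> \<in> E_int K \<and> finite I' \<and> I' \<inter> D = {} \<and>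
           (\<forall>h :: (nat \<Rightarrow> 'r::ring_1) \<Rightarrow> nat \<Rightarrow> 'r. h \<in> Aut I \<longrightarrow> conjugate \<sigma> h \<in> Aut I')"
  using assms(1)
proof (induction "card (I \<inter> D)" arbitrary: I)
  case 0
  then have "I \<inter> D = {}" by simp
  show ?case
    by (rule exI[of _ "{}"], rule exI[of _ I], rule exI[of _ id])
       (use \<open>I \<inter> D = {}\<close> 0 in \<open>intro conjI E_int_id; simp add: conjugate_def\<close>)
next
  case (Suc n)
  then obtain p where p: "p \<in> I" "p \<in> D"
    by (metis IntE card.empty equals0I nat.distinct(1))
  obtain q where q: "q \<notin> I \<union> D"
    using ex_new_if_finite[of "I \<union> D"] Suc.prems assms(2) by auto
  let ?I = "insert q (I - {p})"
  have "?I \<inter> D = (I \<inter> D) - {p}" using q p by auto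
  then have "card (?I \<inter> D) = n" using Suc p by simp
  then obtain K I' and \<sigma> :: "(nat \<Rightarrow> 'r) \<Rightarrow> nat \<Rightarrow> 'r" where
    K: "finite K" "\<sigma> \<in> E_int K" "finite I' \<and> I' \<inter> D = {}" "\<forall>h. h \<in> Aut ?I \<longrightarrow> conjugate \<sigma> h \<in> Aut I'"
    using Suc.hyps(1)[of ?I] Suc.prems by auto
  have pq: "p \<noteq> q" using p q by auto
  let ?K = "insert p (insert q K)"
  have "\<sigma> \<circ> swap p q \<in> E_int ?K"
    by (intro E_int_comp swap_E_int E_int_mono[OF K(2)]) (use pq in auto)
  moreover have "conjugate (\<sigma> \<circ> swap p q) h \<in> Aut I'" if "h \<in> Aut I" for h
    unfolding conjugate_conjugate[OF E_int_bij[OF K(2)] bij_swap[OF pq], symmetric]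
    using K(4) Aut_conjugate_swap[OF that pq] q by blast
  ultimately show ?case using K(1,3)
    by (intro exI[of _ ?K] exI[of _ I'] exI[of _ "\<sigma> \<circ> swap p q"]) auto
qed

lemma Aut_disjoint_commute:
  assumes g: "g \<in> Aut I" and h: "h \<in> Aut K" and fin: "finite I" "finite K" and d: "I \<inter> K = {}"
  shows "g \<circ> h = h \<circ> g"
proof (rule Aut_eqI)
  show "g \<circ> h \<in> Aut (I \<union> K)" "h \<circ> g \<in> Aut (I \<union> K)"
    using Aut_mono[OF g] Aut_mono[OF h] by (auto intro: Aut_comp)
  show "finite (I \<union> K)" using fin by simp
  have *: "g (h (basis l)) = h (g (basis l))" 
    if g: "g \<in> Aut I" and h: "h \<in> Aut K" and d: "I \<inter> K = {}" and l: "l \<notin> I"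
    for g h :: "(nat \<Rightarrow> 'a) \<Rightarrow> nat \<Rightarrow> 'a" and I K l
  proof -
    have "h (basis l) i = 0" if "i \<in> I" for i
      using Aut_outside[OF h, of i "basis l"] that d l by (auto simp: basis_def disjoint_iff)
    then have "g (h (basis l)) = h (basis l)" using Aut_fixes[OF g] by blast
    then show ?thesis using Aut_basis[OF g l] by simp
  qed
  show "(g \<circ> h) (basis l) = (h \<circ> g) (basis l)" for l
    using *[OF g h d, of l] *[OF h g, of l] d by (cases "l \<in> I") (auto simp: disjoint_iff Int_commute)
qed

locale two_sided_ideal =
  fixes J :: "'r::ring_1 set"
  assumes zero_mem: "0 \<in> J"
    and add_mem: "a \<in> J \<Longrightarrow> b \<in> J \<Longrightarrow> a + b \<in> J"
    and mult_left_mem: "a \<in> J \<Longrightarrow> x * a \<in> J"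
    and mult_right_mem: "a \<in> J \<Longrightarrow> a * x \<in> J"
begin

lemma minus_mem: "a \<in> J \<Longrightarrow> - a \<in> J"
  using mult_left_mem[of a "-1"] by simp

lemma diff_mem: "a \<in> J \<Longrightarrow> b \<in> J \<Longrightarrow> a - b \<in> J"
  using add_mem[of a "-b"] minus_mem by simp

lemma minus_mem_iff: "- a \<in> J \<longleftrightarrow> a \<in> J"
  using minus_mem by fastforce

lemma diff_commute_mem: "a - b \<in> J \<longleftrightarrow> b - a \<in> J"
  using minus_mem_iff[of "a - b"] by simp

lemma cong_mem: "a - b \<in> J \<Longrightarrow> b \<in> J \<Longrightarrow> a \<in> J"
  using add_mem[of "a - b" b] by simp

lemma sum_mem: "(\<And>i. i \<in> K \<Longrightarrow> f i \<in> J) \<Longrightarrow> sum f K \<in> J"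
  by (induction K rule: infinite_finite_induct) (auto simp: zero_mem add_mem)

lemma vec_on_mem: "c \<in> vec_on I J \<Longrightarrow> c k \<in> J"
  by (cases "k \<in> I") (auto simp: vec_on_def zero_mem)

lemma dot_mem: "c \<in> vec_on I J \<Longrightarrow> dot c x \<in> J"
  unfolding dot_def by (intro sum_mem mult_right_mem vec_on_mem)

lemma vec_on_minus: "c \<in> vec_on I J \<Longrightarrow> (\<lambda>k. - c k) \<in> vec_on I J"
  by (auto simp: vec_on_def minus_mem)

lemma vec_on_add: "c \<in> vec_on I J \<Longrightarrow> d \<in> vec_on I J \<Longrightarrow> (\<lambda>k. c k + d k) \<in> vec_on I J"
  by (auto simp: vec_on_def add_mem)

lemma vec_on_mono: "c \<in> vec_on I J \<Longrightarrow> I \<subseteq> K \<Longrightarrow> c \<in> vec_on K J"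
proof -
  assume c: "c \<in> vec_on I J" and "I \<subseteq> K"
  then have "c k = 0" if "k \<notin> K" for k using that by (auto simp: vec_on_def)
  then show ?thesis using vec_on_mem[OF c] by (simp add: vec_on_def)
qed

text \<open>
  The congruence subgroup of \<open>GL\<^sub>I\<close>; for the ideal \<open>A\<close> of the unitalization of \<open>A\<close> and
  \<open>I = {..<n}\<close> it is \<open>GL\<^sub>n(A)\<close>.
\<close>

definition GL_rel :: "nat set \<Rightarrow> ((nat \<Rightarrow> 'r) \<Rightarrow> nat \<Rightarrow> 'r) set" where
  "GL_rel I = {T \<in> Aut I. \<forall>x i. T x i - x i \<in> J}"

lemma GL_rel_Aut: "T \<in> GL_rel I \<Longrightarrow> T \<in> Aut I" and
  GL_rel_cong: "T \<in> GL_rel I \<Longrightarrow> T x i - x i \<in> J"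
  by (auto simp: GL_rel_def)

lemma GL_rel_bij: "T \<in> GL_rel I \<Longrightarrow> bij T"
  using GL_rel_Aut Aut_bij by blast

lemma GL_rel_id: "id \<in> GL_rel I"
  by (simp add: GL_rel_def zero_mem)

lemma GL_rel_comp: "S \<in> GL_rel I \<Longrightarrow> T \<in> GL_rel I \<Longrightarrow> S \<circ> T \<in> GL_rel I"
proof -
  assume a: "S \<in> GL_rel I" "T \<in> GL_rel I"
  have "S (T x) i - x i = (S (T x) i - T x i) + (T x i - x i)" for x i by simp
  then have "S (T x) i - x i \<in> J" for x i using a GL_rel_cong add_mem by metis
  then show ?thesis using a by (auto simp: GL_rel_def)
qed

lemma GL_rel_inv: "T \<in> GL_rel I \<Longrightarrow> inv_map T \<in> GL_rel I"
proof -
  assume T: "T \<in> GL_rel I"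
  have "inv_map T x i - x i \<in> J" for x i
    using GL_rel_cong[OF T, of "inv_map T x" i] diff_commute_mem
    by (simp add: inv_comp_cancel(2)[OF GL_rel_bij[OF T]])
  then show ?thesis using T by (auto simp: GL_rel_def)
qed

lemma GL_rel_mono: "T \<in> GL_rel I \<Longrightarrow> I \<subseteq> K \<Longrightarrow> T \<in> GL_rel K"
  using Aut_mono by (auto simp: GL_rel_def)

lemma GL_rel_mem: "T \<in> GL_rel I \<Longrightarrow> x i \<in> J \<Longrightarrow> T x i \<in> J"
  using cong_mem GL_rel_cong by blast

lemma Aut_mem:
  assumes T: "T \<in> Aut I" "finite I" and x: "\<And>i. x i \<in> J"
  shows "T x k \<in> J"
proof (cases "k \<in> I")
  case True
  show ?thesis unfolding Aut_row_sum[OF T True, of x] by (intro sum_mem mult_left_mem x)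
qed (simp add: Aut_outside[OF T(1)] x)

lemma GL_rel_conjugate:
  assumes S: "S \<in> Aut I" and T: "T \<in> GL_rel I" and fin: "finite I"
  shows "conjugate S T \<in> GL_rel I"
proof -
  have "conjugate S T x i - x i \<in> J" for x i
  proof -
    let ?y = "inv_map S x"
    have "conjugate S T x = (\<lambda>i. S (T ?y) i)" by (simp add: conjugate_def)
    moreover have "x = (\<lambda>i. S ?y i)" by (simp add: inv_comp_cancel Aut_bij[OF S])
    ultimately have "conjugate S T x i - x i = S (\<lambda>i. T ?y i - ?y i) i"
      by (simp add: linear_map_diff[OF Aut_linear[OF S]])
    then show ?thesis using Aut_mem[OF S fin] GL_rel_cong[OF T] by simp
  qed
  then show ?thesis using S T by (auto simp: GL_rel_def)
qed

lemma tv_GL_rel: "i \<in> I \<Longrightarrow> j \<in> I \<Longrightarrow> i \<noteq> j \<Longrightarrow> a \<in> J \<Longrightarrow> tv i j a \<in> GL_rel I"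
  by (simp add: GL_rel_def tv_Aut) (simp add: tv_def mult_right_mem zero_mem)

text \<open>
  The relative elementary group.  Conjugates under integral elementary matrices suffice to make it
  large enough for the stability theorems, and are harmless in commutators because conjugation is a
  homomorphism.
\<close>

inductive_set E_rel :: "nat set \<Rightarrow> ((nat \<Rightarrow> 'r) \<Rightarrow> nat \<Rightarrow> 'r) set" for I where
  E_rel_id: "id \<in> E_rel I"
| E_rel_step: "\<lbrakk>\<sigma> \<in> E_int I; i \<in> I; j \<in> I; i \<noteq> j; a \<in> J; f \<in> E_rel I\<rbrakk>
    \<Longrightarrow> conjugate \<sigma> (tv i j a) \<circ> f \<in> E_rel I"

lemma conjugate_tv_E_rel:
  "\<lbrakk>\<sigma> \<in> E_int I; i \<in> I; j \<in> I; i \<noteq> j; a \<in> J\<rbrakk> \<Longrightarrow> conjugate \<sigma> (tv i j a) \<in> E_rel I"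
  using E_rel_step[OF _ _ _ _ _ E_rel_id] by fastforce

lemma tv_E_rel: "\<lbrakk>i \<in> I; j \<in> I; i \<noteq> j; a \<in> J\<rbrakk> \<Longrightarrow> tv i j a \<in> E_rel I"
  using conjugate_tv_E_rel[OF E_int_id] by (fastforce simp: conjugate_def inv_id)

lemma E_rel_comp: "f \<in> E_rel I \<Longrightarrow> g \<in> E_rel I \<Longrightarrow> f \<circ> g \<in> E_rel I"
  by (erule E_rel.induct) (auto simp del: o_apply id_apply simp: comp_assoc intro: E_rel_id E_rel_step)

lemma E_rel_GL_rel: "f \<in> E_rel I \<Longrightarrow> finite I \<Longrightarrow> f \<in> GL_rel I"
  by (erule E_rel.induct)
     (auto simp del: o_apply id_apply intro!: GL_rel_id GL_rel_comp GL_rel_conjugate E_int_Aut tv_GL_rel)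

lemma E_rel_bij: "f \<in> E_rel I \<Longrightarrow> bij f"
  by (erule E_rel.induct) (simp_all del: o_apply id_apply add: bij_comp bij_conjugate E_int_bij bij_tv)

lemma E_rel_inv: "f \<in> E_rel I \<Longrightarrow> inv_map f \<in> E_rel I"
proof (induction f rule: E_rel.induct)
  case E_rel_id
  show "inv_map id \<in> E_rel I" unfolding inv_id by (rule E_rel.E_rel_id)
next
  case (E_rel_step \<sigma> i j a f)
  then have "inv_map (conjugate \<sigma> (tv i j a) \<circ> f) = inv_map f \<circ> conjugate \<sigma> (tv i j (- a))"
    by (simp add: o_inv_distrib bij_tv E_int_bij inv_tv E_rel_bij bij_conjugate flip: conjugate_inv)
  then show "inv_map (conjugate \<sigma> (tv i j a) \<circ> f) \<in> E_rel I"
    using E_rel_step by (simp add: E_rel_comp conjugate_tv_E_rel minus_mem)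
qed

lemma E_rel_conjugate: "f \<in> E_rel I \<Longrightarrow> \<sigma> \<in> E_int I \<Longrightarrow> conjugate \<sigma> f \<in> E_rel I"
  by (erule E_rel.induct)
     (simp_all del: o_apply id_apply add: E_int_bij E_rel_id conjugate_comp conjugate_conjugate E_rel_step E_int_comp)

lemma E_rel_mono: "f \<in> E_rel I \<Longrightarrow> I \<subseteq> K \<Longrightarrow> f \<in> E_rel K"
  by (erule E_rel.induct) (auto simp del: o_apply id_apply intro: E_rel_id E_rel_step E_int_mono)

lemma E_rel_conjugate_swap:
  assumes "f \<in> E_rel I" "p \<noteq> q" "q \<notin> I"
  shows "conjugate (swap p q) f \<in> E_rel (insert q (I - {p}))"
  using assms(1)
proof (induction f rule: E_rel.induct)
  case E_rel_id
  show "conjugate (swap p q) id \<in> E_rel (insert q (I - {p}))" 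
    unfolding conjugate_id[OF bij_swap[OF assms(2)]] by (rule E_rel.E_rel_id)
next
  case (E_rel_step \<sigma> i j a f)
  let ?w = "swap p q"
  have "conjugate ?w (conjugate \<sigma> (tv i j a)) = conjugate (conjugate ?w \<sigma>) (conjugate ?w (tv i j a))"
    using assms E_int_bij[OF E_rel_step(1)]
    by (auto simp: conjugate_def fun_eq_iff o_inv_distrib bij_swap bij_comp bij_imp_bij_inv inv_inv_eq
        inv_comp_cancel)
  moreover have "\<exists>i'\<in>insert q (I - {p}). \<exists>j'\<in>insert q (I - {p}). \<exists>a'\<in>J. i' \<noteq> j' \<and>
      conjugate ?w (tv i j a) = tv i' j' a'"
  proof -
    let ?i = "if i = p then q else i" and ?j = "if j = p then q else j"
    let ?a = "if i = p \<or> j = p then - a else a"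
    have "conjugate ?w (tv i j a) = tv ?i ?j ?a"
      using E_rel_step assms by (subst conjugate_swap_tv) auto
    moreover have "?i \<in> insert q (I - {p})" "?j \<in> insert q (I - {p})" "?a \<in> J" "?i \<noteq> ?j"
      using E_rel_step assms minus_mem by auto
    ultimately show ?thesis by blast
  qed
  ultimately have "conjugate ?w (conjugate \<sigma> (tv i j a)) \<in> E_rel (insert q (I - {p}))"
    using conjugate_tv_E_rel E_int_conjugate_swap[OF E_rel_step(1) assms(2,3)] by metis
  then show "conjugate (swap p q) (conjugate \<sigma> (tv i j a) \<circ> f) \<in> E_rel (insert q (I - {p}))"
    using E_rel_step assms by (simp add: conjugate_comp bij_swap E_rel_comp)
qed

lemma tcol_E_rel:
  assumes c: "c \<in> vec_on (I - {j}) J" and j: "j \<in> I" and fin: "finite I"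
  shows "tcol j c \<in> E_rel I"
proof -
  have "tcol j c \<in> E_rel I" if "finite K" "K \<subseteq> I - {j}" "c \<in> vec_on K J" for K
    using that
  proof (induction K arbitrary: c)
    case empty
    then have "c = (\<lambda>k. 0)" by (auto simp: vec_on_def)
    then show ?case using E_rel_id by (simp only: tcol_zero)
  next
    case (insert k K)
    have "j \<notin> insert k K" using insert.prems(1) by auto
    then have "c j = 0" using insert.prems(2) by (simp add: vec_on_def)
    then have eq: "tcol j c = tv k j (c k) \<circ> tcol j (c(k := 0))"
      unfolding tv_eq_tcol using insert by (subst tcol_tcol) (auto simp: vec_on_def intro!: arg_cong[where f = "tcol j"])
    have "c(k := 0) \<in> vec_on K J" using insert by (auto simp: vec_on_def)
    then have "tcol j (c(k := 0)) \<in> E_rel I" using insert by blast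
    moreover have "tv k j (c k) \<in> E_rel I"
      by (rule tv_E_rel) (use insert j in \<open>auto simp: vec_on_def\<close>)
    ultimately show ?case unfolding eq by (intro E_rel_comp)
  qed
  from this[of "I - {j}"] show ?thesis using c fin by simp
qed

lemma trow_E_rel:
  assumes r: "r \<in> vec_on (I - {i}) J" and i: "i \<in> I" and fin: "finite I"
  shows "trow i r \<in> E_rel I"
proof -
  have "trow i r \<in> E_rel I" if "finite K" "K \<subseteq> I - {i}" "r \<in> vec_on K J" for K
    using that
  proof (induction K arbitrary: r)
    case empty
    then have "r = (\<lambda>k. 0)" by (auto simp: vec_on_def)
    then show ?case using E_rel_id by (simp only: trow_zero)
  next
    case (insert k K)
    have r': "r(k := 0) \<in> vec_on K J" using insert by (auto simp: vec_on_def)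
    have "i \<notin> insert k K" using insert.prems(1) by auto
    then have "r i = 0" using insert.prems(2) by (simp add: vec_on_def)
    then have eq: "trow i r = tv i k (r k) \<circ> trow i (r(k := 0))"
      unfolding tv_eq_trow using insert finite_support_vec_on[OF r' insert(1)]
      by (subst trow_trow) (auto simp: vec_on_def intro!: arg_cong[where f = "trow i"])
    have "tv i k (r k) \<in> E_rel I"
      by (rule tv_E_rel) (use insert i in \<open>auto simp: vec_on_def\<close>)
    moreover have "trow i (r(k := 0)) \<in> E_rel I" using insert r' by blast
    ultimately show ?case unfolding eq by (intro E_rel_comp)
  qed
  from this[of "I - {i}"] show ?thesis using r fin by simp
qed

lemma trow_conj_left:
  assumes b: "b \<in> Aut K" and fin: "finite K" and m: "m \<notin> K" and r: "r \<in> vec_on K J"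
  shows "\<exists>r'\<in>vec_on K J. b \<circ> trow m r = trow m r' \<circ> b"
proof -
  let ?r = "\<lambda>l. if l \<in> K then dot r (inv_map b (basis l)) else 0"
  have "dot ?r (b x) = dot r x" for x
    using dot_Aut[OF Aut_inv[OF b] fin r, of "b x"] by (simp add: inv_comp_cancel Aut_bij[OF b])
  then have "trow m ?r \<circ> b = b \<circ> trow m r"
    by (rule trow_move[OF Aut_linear[OF b] Aut_basis[OF b m]])
  moreover have "?r \<in> vec_on K J" using dot_mem[OF r] by (auto simp: vec_on_def)
  ultimately show ?thesis by metis
qed

text \<open>
  The matrices \<open>\<sigma>\<close> with this property form a group, because \<open>E_rel I\<close> is stable under conjugation by
  \<open>E_int I\<close>.  It contains \<open>e\<^sub>i\<^sub>m(\<plusminus>1)\<close> and \<open>e\<^sub>m\<^sub>j(\<plusminus>1)\<close>, whose commutators with \<open>h\<close> are products of elementary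
  matrices in column or row \<open>m\<close>, and these generate \<open>E_int I\<close>.
\<close>

lemma E_int_commutator:
  assumes h: "h \<in> GL_rel (I - {m})" and m: "m \<in> I" and fin: "finite I" and \<sigma>: "\<sigma> \<in> E_int I"
  shows "\<exists>f\<in>E_rel I. conjugate \<sigma> h = f \<circ> h"
proof -
  define P where "P \<sigma> \<longleftrightarrow> \<sigma> \<in> E_int I \<and> (\<exists>f\<in>E_rel I. conjugate \<sigma> h = f \<circ> h)" for \<sigma>
  note hA = GL_rel_Aut[OF h]
  have fin': "finite (I - {m})" using fin by simp
  have comp: "P (\<sigma> \<circ> \<tau>)" if P: "P \<sigma>" "P \<tau>" for \<sigma> \<tau>
  proof -
    obtain f g where f: "f \<in> E_rel I" "conjugate \<sigma> h = f \<circ> h" and g: "g \<in> E_rel I" "conjugate \<tau> h = g \<circ> h"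
      and s: "\<sigma> \<in> E_int I" "\<tau> \<in> E_int I"
      using P unfolding P_def by blast
    have "conjugate (\<sigma> \<circ> \<tau>) h = (conjugate \<sigma> g \<circ> f) \<circ> h"
      using s by (simp add: conjugate_conjugate[symmetric] E_int_bij g(2) conjugate_comp f(2) comp_assoc)
    then show ?thesis unfolding P_def using s f g by (auto intro: E_int_comp E_rel_comp E_rel_conjugate)
  qed
  have col: "P (tv i m s)" if i: "i \<in> I" "i \<noteq> m" and s: "s \<in> {1, -1}" for i s
  proof -
    have "(\<lambda>k. (basis i k - h (basis i) k) * s) \<in> vec_on (I - {m}) J"
      using GL_rel_cong[OF h, of "basis i"] Aut_outside[OF hA]
      by (auto simp: vec_on_def diff_commute_mem intro!: mult_right_mem)
    then have "tcol m (\<lambda>k. (basis i k - h (basis i) k) * s) \<in> E_rel I"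
      using m fin by (rule tcol_E_rel)
    then show ?thesis using conjugate_tv_col[OF hA _ i(2), of s] i s m by (auto simp: P_def intro: tv_E_int)
  qed
  have row: "P (tv m j s)" if j: "j \<in> I" "j \<noteq> m" and s: "s \<in> {1, -1}" for j s
  proof -
    have "(\<lambda>l. s * (h (basis l) j - basis l j)) \<in> vec_on (I - {m}) J"
      using GL_rel_cong[OF h] Aut_basis[OF hA] by (auto simp: vec_on_def intro!: mult_left_mem)
    then obtain r where "r \<in> vec_on (I - {m}) J" "conjugate (tv m j s) h = trow m r \<circ> h"
      using conjugate_tv_row[OF hA fin' _ j(2), of s] trow_conj_left[OF hA fin', of m] by auto
    then show ?thesis using trow_E_rel[OF _ m fin] j s m by (auto simp: P_def intro: tv_E_int)
  qed
  have gen: "P (tv i j s)" if ij: "i \<in> I" "j \<in> I" "i \<noteq> j" and s: "s \<in> {1, -1}" for i j s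
  proof -
    consider "i = m" | "j = m" | "i \<noteq> m" "j \<noteq> m" by blast
    then show ?thesis
    proof cases
      case 3
      then have "tv i j s = tv i m s \<circ> (tv m j 1 \<circ> (tv i m (- s) \<circ> tv m j (- 1)))"
        using tv_commutator[of i j m s 1] ij by (simp add: inv_tv comp_assoc)
      moreover have "P (tv i m s)" "P (tv i m (- s))" "P (tv m j 1)" "P (tv m j (-1))"
        using 3 col row ij s by auto
      ultimately show ?thesis using comp by metis
    qed (use ij s col row in auto)
  qed
  have "P \<sigma>" using \<sigma>
  proof (induction \<sigma> rule: E_int.induct)
    case E_int_id
    show "P id" unfolding P_def
      by (intro conjI bexI[of _ id] E_int.E_int_id E_rel_id) (auto simp: conjugate_def)
  qed (use comp gen in blast)
  then show ?thesis by (simp add: P_def)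
qed

text \<open>
  Conjugate \<open>h\<close> by an integral elementary matrix \<open>\<sigma>\<close> to make its support disjoint from that of \<open>g\<close>; then
  \<open>g\<close> commutes with \<open>conjugate \<sigma> h = f \<circ> h\<close>, where \<open>f\<close> is relatively elementary, and the commutator of
  \<open>g\<close> and \<open>h\<close> is \<open>g f\<^sup>-\<^sup>1 g\<^sup>-\<^sup>1 f\<close>.  Normality is not available at this point.  Instead, comparing
  the conjugates of \<open>g\<close>, of \<open>h\<close> and of \<open>g \<circ> h\<close> by \<open>\<sigma>\<close> shows that \<open>g f g\<^sup>-\<^sup>1\<close> is relatively elementary.
\<close>

lemma commutator_E_rel:
  assumes g: "g \<in> GL_rel I" and h: "h \<in> GL_rel I" and fin: "finite I"
  shows "\<exists>K. finite K \<and> g \<circ> h \<circ> inv_map g \<circ> inv_map h \<in> E_rel K"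
proof -
  obtain K I' and \<sigma> :: "(nat \<Rightarrow> 'r) \<Rightarrow> nat \<Rightarrow> 'r" where K: "finite K" "\<sigma> \<in> E_int K" "finite I' \<and> I' \<inter> I = {}"
    "\<forall>h::(nat \<Rightarrow> 'r) \<Rightarrow> nat \<Rightarrow> 'r. h \<in> Aut I \<longrightarrow> conjugate \<sigma> h \<in> Aut I'"
    using E_int_separate[OF fin fin] by metis
  obtain m where m: "m \<notin> K \<union> I" using ex_new_if_finite[of "K \<union> I"] K fin by auto
  let ?M = "insert m (K \<union> I)"
  have M: "finite ?M" "m \<in> ?M" "\<sigma> \<in> E_int ?M" using K fin E_int_mono[of \<sigma> K ?M] by auto
  note bs = E_int_bij[OF K(2)]
  have ex: "\<exists>f\<in>E_rel ?M. conjugate \<sigma> t = f \<circ> t" if "t \<in> GL_rel I" for t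
    using E_int_commutator[OF _ M(2,1,3)] GL_rel_mono[OF that, of "?M - {m}"] m by auto
  obtain f1 where f1: "f1 \<in> E_rel ?M" "conjugate \<sigma> g = f1 \<circ> g" using ex[OF g] by auto
  obtain f where f: "f \<in> E_rel ?M" "conjugate \<sigma> h = f \<circ> h" using ex[OF h] by auto
  obtain f2 where f2: "f2 \<in> E_rel ?M" "conjugate \<sigma> (g \<circ> h) = f2 \<circ> (g \<circ> h)"
    using ex[OF GL_rel_comp[OF g h]] by auto
  note bg = GL_rel_bij[OF g] and bh = GL_rel_bij[OF h] and bf = E_rel_bij[OF f(1)]
  have e1: "f1 \<circ> (g \<circ> f \<circ> inv_map g) = f2"
  proof
    fix x
    have "f1 (g (f (h y))) = f2 (g (h y))" for y
      using f2(2) by (simp add: conjugate_comp bs f1(2) f(2) fun_eq_iff)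
    from this[of "inv_map h (inv_map g x)"] show "(f1 \<circ> (g \<circ> f \<circ> inv_map g)) x = f2 x"
      by (simp add: inv_comp_cancel bg bh)
  qed
  have gfg: "g \<circ> f \<circ> inv_map g \<in> E_rel ?M"
  proof -
    have "g \<circ> f \<circ> inv_map g = inv_map f1 \<circ> f2"
      unfolding e1[symmetric] by (simp add: fun_eq_iff inv_comp_cancel E_rel_bij[OF f1(1)])
    then show ?thesis using f1 f2 by (simp add: E_rel_comp E_rel_inv)
  qed
  have "g \<circ> conjugate \<sigma> h = conjugate \<sigma> h \<circ> g"
  proof (rule Aut_disjoint_commute[OF GL_rel_Aut[OF g]])
    show "conjugate \<sigma> h \<in> Aut I'" using K(4) GL_rel_Aut[OF h] by blast
  qed (use K fin in auto)
  then have c: "g (f (h y)) = f (h (g y))" for y by (simp add: f(2) fun_eq_iff)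
  have "g \<circ> h \<circ> inv_map g \<circ> inv_map h = inv_map (g \<circ> f \<circ> inv_map g) \<circ> f"
  proof
    fix x
    let ?z = "inv_map g (inv_map h x)"
    have "(g \<circ> f \<circ> inv_map g) (g (h ?z)) = f x"
      using c[of ?z] by (simp add: inv_comp_cancel bg bh)
    then have "inv_map (g \<circ> f \<circ> inv_map g) (f x) = g (h ?z)"
      using E_rel_bij[OF gfg] by (metis inv_comp_cancel(1))
    then show "(g \<circ> h \<circ> inv_map g \<circ> inv_map h) x = (inv_map (g \<circ> f \<circ> inv_map g) \<circ> f) x" by simp
  qed
  then show ?thesis using gfg f M(1) E_rel_comp E_rel_inv by metis
qed

end

section \<open>Stable range and reduction of columns\<close>

lemma basis_same [simp]: "basis j j = 1" and basis_other: "i \<noteq> j \<Longrightarrow> basis j i = 0"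
  by (auto simp: basis_def)

lemma dot_basis: assumes "finite {k. r k \<noteq> 0}" shows "dot r (basis l) = r l"
proof -
  have "dot r (basis l) = (\<Sum>k\<in>insert l {k. r k \<noteq> 0}. r k * basis l k)"
    by (rule dot_eq_sum) (use assms in auto)
  also have "\<dots> = (\<Sum>k\<in>{l}. r k * basis l k)"
    by (rule sum.mono_neutral_right) (use assms in \<open>auto simp: basis_def\<close>)
  finally show ?thesis by simp
qed

lemma basis_vec_on: "m \<in> I \<Longrightarrow> basis m \<in> vec_on I UNIV"
  by (auto simp: vec_on_def basis_def)

definition unimodular :: "nat set \<Rightarrow> (nat \<Rightarrow> 'r::ring_1) \<Rightarrow> bool" where
  "unimodular I c \<longleftrightarrow> (\<exists>d. (\<Sum>i\<in>I. d i * c i) = 1)"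

text \<open>
  The equation \<open>g\<^sup>-\<^sup>1 (g x) = x\<close> in coordinate \<open>i\<close>.
\<close>

lemma unimodular_column:
  assumes g: "g \<in> Aut I" and fin: "finite I" and i: "i \<in> I" and x: "x i = 1"
  shows "(\<Sum>l\<in>I. inv_map g (basis l) i * g x l) = 1"
  using Aut_row_sum[OF Aut_inv[OF g] fin i, of "g x"] x by (simp add: inv_comp_cancel Aut_bij[OF g])

context two_sided_ideal
begin

text \<open>
  Vaserstein's condition with the entry that is congruent to \<open>1\<close> at an arbitrary place of an arbitrary
  index set of \<open>n\<close> elements.
\<close>

definition stable_range_at :: "nat \<Rightarrow> bool" where
  "stable_range_at n \<longleftrightarrow> (\<forall>I i\<^sub>0 c b. finite I \<and> card I = n \<and> i\<^sub>0 \<in> I \<and> c i\<^sub>0 - 1 \<in> J \<and>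
     (\<forall>i\<in>I - {i\<^sub>0}. c i \<in> J) \<and> b \<in> J \<and> (\<exists>d e. (\<Sum>i\<in>I. d i * c i) + e * b = 1) \<longrightarrow>
     (\<exists>t. (\<forall>i. t i \<in> J) \<and> unimodular I (\<lambda>i. c i + t i * b)))"

text \<open>
  The condition for an entry of the ideal implies one for arbitrary additional entries \<open>b\<^sub>1\<close>, \<open>b\<^sub>2\<close> of the
  ring: multiplying \<open>e\<^sub>1 b\<^sub>1 + e\<^sub>2 b\<^sub>2\<close> by \<open>1 - c i\<^sub>0\<close> moves it into the ideal and keeps the column
  unimodular, since \<open>1 - c i\<^sub>0\<close> acts as \<open>1\<close> modulo the left ideal generated by the entries of \<open>c\<close>.
\<close>

lemma stable_range_extend:
  assumes sr: "stable_range_at (card I)" and I: "finite I" "i\<^sub>0 \<in> I"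
    and c: "c i\<^sub>0 - 1 \<in> J" "\<And>i. i \<in> I \<Longrightarrow> i \<noteq> i\<^sub>0 \<Longrightarrow> c i \<in> J"
    and eq: "(\<Sum>i\<in>I. d i * c i) + e\<^sub>1 * b\<^sub>1 + e\<^sub>2 * b\<^sub>2 = 1"
  shows "\<exists>t\<^sub>1 t\<^sub>2. (\<forall>i. t\<^sub>1 i \<in> J) \<and> (\<forall>i. t\<^sub>2 i \<in> J) \<and>
           unimodular I (\<lambda>i. c i + t\<^sub>1 i * b\<^sub>1 + t\<^sub>2 i * b\<^sub>2)"
proof -
  let ?a = "1 - c i\<^sub>0"
  let ?y = "?a * (e\<^sub>1 * b\<^sub>1 + e\<^sub>2 * b\<^sub>2)"
  let ?d = "\<lambda>i. ?a * d i + (if i = i\<^sub>0 then 1 else 0)"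
  have a: "?a \<in> J" using c(1) diff_commute_mem by blast
  have "(\<Sum>i\<in>I. ?d i * c i) = ?a * (\<Sum>i\<in>I. d i * c i) + (\<Sum>i\<in>I. if i = i\<^sub>0 then c i else 0)"
    by (simp add: sum_distrib_left mult.assoc distrib_right sum.distrib[symmetric] cong: sum.cong)
       (rule sum.cong; simp)
  also have "(\<Sum>i\<in>I. if i = i\<^sub>0 then c i else 0) = c i\<^sub>0"
    using I by simp
  finally have "(\<Sum>i\<in>I. ?d i * c i) + 1 * ?y
      = ?a * ((\<Sum>i\<in>I. d i * c i) + e\<^sub>1 * b\<^sub>1 + e\<^sub>2 * b\<^sub>2) + c i\<^sub>0"
    by (simp only: distrib_left mult_1_left add_ac)
  also have "\<dots> = 1" by (simp only: eq) simp
  finally have "(\<Sum>i\<in>I. ?d i * c i) + 1 * ?y = 1" .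
  then have "\<exists>d e. (\<Sum>i\<in>I. d i * c i) + e * ?y = 1"
    by (intro exI[of _ ?d] exI[of _ 1])
  moreover have "?y \<in> J" using a by (rule mult_right_mem)
  ultimately have "finite I \<and> card I = card I \<and> i\<^sub>0 \<in> I \<and> c i\<^sub>0 - 1 \<in> J \<and>
      (\<forall>i\<in>I - {i\<^sub>0}. c i \<in> J) \<and> ?y \<in> J \<and> (\<exists>d e. (\<Sum>i\<in>I. d i * c i) + e * ?y = 1)"
    using I c by blast
  from sr[unfolded stable_range_at_def, rule_format, OF this]
  obtain t where t: "\<And>i. t i \<in> J" "unimodular I (\<lambda>i. c i + t i * ?y)" by blast
  show ?thesis
  proof (intro exI conjI allI)
    show "unimodular I (\<lambda>i. c i + t i * (?a * e\<^sub>1) * b\<^sub>1 + t i * (?a * e\<^sub>2) * b\<^sub>2)"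
      using t(2) by (simp only: distrib_left mult.assoc add.assoc)
  qed (rule mult_right_mem[OF t(1)])+
qed

text \<open>
  By the stable range condition the entries other than \<open>Y k\<close> may be assumed unimodular.  Then \<open>Y k\<close>
  can be changed to \<open>1 - Y i\<^sub>0\<close> by adding multiples with coefficients in the ideal.  Adding entry \<open>k\<close>
  to entry \<open>i\<^sub>0\<close> makes the latter \<open>1\<close>.  That step has coefficient \<open>1\<close>; it is undone at the end, which
  leaves a conjugate of a relative column operation.
\<close>

lemma column_reduction:
  assumes sr: "stable_range_at (card I - 1)" and I: "finite I" "i\<^sub>0 \<in> I" "k \<in> I" "k \<noteq> i\<^sub>0"
    and Y: "Y i\<^sub>0 - 1 \<in> J" "\<And>i. i \<in> I \<Longrightarrow> i \<noteq> i\<^sub>0 \<Longrightarrow> Y i \<in> J" and uni: "unimodular I Y"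
  shows "\<exists>f\<in>E_rel I. \<forall>i\<in>I. f Y i = basis i\<^sub>0 i"
proof -
  let ?K = "I - {k}"
  obtain d where "(\<Sum>i\<in>I. d i * Y i) = 1" using uni by (auto simp: unimodular_def)
  then have "(\<Sum>i\<in>?K. d i * Y i) + d k * Y k + 0 * 0 = 1"
    using I by (simp add: sum.remove[of I k] add.commute)
  moreover have "stable_range_at (card ?K)" using sr I by simp
  ultimately obtain t t2 where t: "\<And>i. t i \<in> J" "unimodular ?K (\<lambda>i. Y i + t i * Y k + t2 i * 0)"
    using stable_range_extend[of ?K i\<^sub>0 Y d "d k" "Y k" 0 0] I Y by auto
  define t' where "t' i = (if i \<in> ?K then t i else 0)" for i
  have t': "t' \<in> vec_on ?K J" using t by (auto simp: t'_def vec_on_def)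
  define Y1 where "Y1 = tcol k t' Y"
  have Y1: "Y1 i = Y i + t' i * Y k" for i by (simp add: Y1_def tcol_def)
  have Yk: "Y k \<in> J" using Y I by auto
  have Y1J: "Y1 i\<^sub>0 - 1 \<in> J" "\<And>i. i \<in> I \<Longrightarrow> i \<noteq> i\<^sub>0 \<Longrightarrow> Y1 i \<in> J"
  proof -
    have "(Y i\<^sub>0 - 1) + t' i\<^sub>0 * Y k \<in> J" using Y(1) Yk add_mem mult_left_mem by blast
    then show "Y1 i\<^sub>0 - 1 \<in> J" by (simp add: Y1 algebra_simps)
    show "Y1 i \<in> J" if "i \<in> I" "i \<noteq> i\<^sub>0" for i
      unfolding Y1 using that Y(2) Yk add_mem mult_left_mem by simp
  qed
  obtain d where d: "(\<Sum>i\<in>?K. d i * Y1 i) = 1"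
    using t(2) unfolding unimodular_def Y1 t'_def by auto
  define z where "z = 1 - Y1 i\<^sub>0 - Y1 k"
  have z: "z \<in> J" unfolding z_def using Y1J I diff_mem diff_commute_mem by blast
  define a where "a i = (if i \<in> ?K then z * d i else 0)" for i
  have aJ: "a \<in> vec_on ?K J" using z mult_right_mem by (auto simp: a_def vec_on_def)
  have "dot a Y1 = (\<Sum>i\<in>?K. a i * Y1 i)"
    by (rule dot_eq_sum) (use I in \<open>auto simp: a_def\<close>)
  also have "\<dots> = z * (\<Sum>i\<in>?K. d i * Y1 i)"
    by (simp add: a_def sum_distrib_left mult.assoc)
  finally have dota: "dot a Y1 = z" using d by simp
  define Y2 where "Y2 = trow k a Y1"
  have Y2: "Y2 = Y1(k := 1 - Y1 i\<^sub>0)" by (simp add: Y2_def trow_def dota z_def)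
  define s where "s = tv i\<^sub>0 k (1::'r)"
  have s: "s \<in> E_int I" unfolding s_def using I by (intro tv_E_int) auto
  define Y3 where "Y3 = s Y2"
  have Y3: "Y3 = Y2(i\<^sub>0 := 1)" using I by (simp add: Y3_def s_def tv_def Y2)
  define c where "c i = (if i \<in> I - {i\<^sub>0} then - Y3 i else 0)" for i
  have c: "c \<in> vec_on (I - {i\<^sub>0}) J"
    using Y1J diff_commute_mem[of 1] by (auto simp: c_def vec_on_def Y3 Y2 minus_mem_iff)
  define f where "f = conjugate (inv_map s) (tcol i\<^sub>0 c) \<circ> (trow k a \<circ> tcol k t')"
  have "f \<in> E_rel I"
    unfolding f_def using I c aJ t' s
    by (intro E_rel_comp E_rel_conjugate E_int_inv tcol_E_rel trow_E_rel)
  moreover have "f Y i = basis i\<^sub>0 i" if i: "i \<in> I" for i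
  proof -
    have "f Y = inv_map s (tcol i\<^sub>0 c (s (trow k a (tcol k t' Y))))"
      by (simp add: f_def conjugate_def inv_inv_eq E_int_bij[OF s])
    also have "\<dots> = inv_map s (tcol i\<^sub>0 c Y3)"
      unfolding Y3_def Y2_def Y1_def ..
    also have "\<dots> = tv i\<^sub>0 k (- 1) (tcol i\<^sub>0 c Y3)"
      unfolding s_def using I by (simp add: inv_tv)
    finally show ?thesis using i I by (auto simp: tv_def tcol_def c_def Y3 basis_def)
  qed
  ultimately show ?thesis by blast
qed

text \<open>
  Subtracting multiples of column \<open>q\<close>, which is that of the identity, clears row \<open>q\<close>.
\<close>

lemma fixed_column_decomposition:
  assumes g: "g \<in> GL_rel I" and I: "finite I" "q \<in> I" and fixq: "g (basis q) = basis q"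
  shows "\<exists>b\<in>GL_rel (I - {q}). \<exists>r\<in>vec_on (I - {q}) J. g = b \<circ> trow q r"
proof -
  note gA = GL_rel_Aut[OF g]
  define r where "r l = g (basis l) q - basis l q" for l
  have r: "r \<in> vec_on (I - {q}) J"
    using GL_rel_cong[OF g] Aut_basis[OF gA] fixq by (auto simp: r_def vec_on_def)
  have rq: "r q = 0" using fixq by (simp add: r_def)
  have rfin: "finite {k. r k \<noteq> 0}" using finite_support_vec_on[OF r] I by simp
  have dotr: "dot r x = g x q - x q" for x
  proof -
    have f: "finite {l. g (basis l) q \<noteq> 0}" "finite {l. - basis l q \<noteq> (0::'r)}"
      using Aut_row_support[OF gA I(1)] by (auto simp: basis_def)
    have "dot (\<lambda>l. g (basis l) q + - basis l q) x = g x q - x q"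
      using dot_add_left[OF f, of x] Aut_row[OF gA I(1), of x q] Aut_row[OF Aut_id[of I] I(1), of x q]
      by (simp add: dot_uminus_left)
    moreover have "r = (\<lambda>l. g (basis l) q - basis l q)" by (rule ext) (simp add: r_def)
    ultimately show ?thesis by simp
  qed
  define b where "b = g \<circ> trow q (\<lambda>k. - r k)"
  have bx: "b x = (g x)(q := x q)" for x
  proof -
    have "b x = g (x(q := x q + - dot r x))"
      by (simp only: b_def trow_def o_apply dot_uminus_left)
    also have "\<dots> = (g x)(q := g x q + - dot r x)"
      by (rule linear_map_upd[OF Aut_linear[OF gA] fixq])
    finally show ?thesis by (simp add: dotr)
  qed
  have "trow q (\<lambda>k. - r k) \<in> GL_rel I"
    using E_rel_GL_rel[OF trow_E_rel[OF vec_on_minus[OF r] I(2,1)] I(1)] .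
  then have bG: "b \<in> GL_rel I" unfolding b_def using g by (intro GL_rel_comp)
  have "supported (I - {q}) b"
    unfolding supported_def
  proof (intro conjI allI impI)
    fix x i assume "i \<notin> I - {q}" then show "b x i = x i"
      using Aut_outside[OF gA, of i x] by (auto simp: bx)
  next
    fix x :: "nat \<Rightarrow> 'r" assume x: "\<forall>i\<in>I - {q}. x i = 0"
    define y where "y = x(q := 0)"
    have "g y = y" by (rule Aut_fixes[OF gA]) (use x in \<open>auto simp: y_def\<close>)
    moreover have "x = y(q := y q + x q)" by (simp add: y_def)
    ultimately have "g x = x"
      using linear_map_upd[OF Aut_linear[OF gA] fixq, of y "x q"] by simp
    then show "b x = x" by (simp add: bx)
  qed
  then have "b \<in> GL_rel (I - {q})" using bG by (simp add: GL_rel_def Aut_def)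
  moreover have "g = b \<circ> trow q r"
    unfolding b_def comp_assoc
    using inv_trow[of r q] rq rfin trow_trow[of "\<lambda>k. - r k" q r] by simp
  ultimately show ?thesis using r by blast
qed

text \<open>
  Surjective stability: reduce column \<open>q\<close> to that of the identity, then clear row \<open>q\<close>.
\<close>

lemma GL_rel_decomposition:
  assumes sr: "stable_range_at (card I - 1)" and I: "finite I" "q \<in> I" "2 \<le> card I"
    and g: "g \<in> GL_rel I"
  shows "\<exists>f\<in>E_rel I. \<exists>b\<in>GL_rel (I - {q}). \<exists>f'\<in>E_rel I. g = f \<circ> b \<circ> f'"
proof -
  note gA = GL_rel_Aut[OF g]
  obtain k where k: "k \<in> I" "k \<noteq> q"
    using I by (metis card_le_Suc0_iff_eq not_less_eq_eq numeral_2_eq_2)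
  let ?Y = "g (basis q)"
  have "unimodular I ?Y"
    using unimodular_column[OF gA I(1,2), of "basis q"] by (auto simp: unimodular_def)
  moreover have "?Y q - 1 \<in> J" using GL_rel_cong[OF g, of "basis q" q] by simp
  moreover have "?Y i \<in> J" if "i \<noteq> q" for i
    using GL_rel_cong[OF g, of "basis q" i] that by (simp add: basis_other)
  ultimately obtain f where f: "f \<in> E_rel I" "\<forall>i\<in>I. f ?Y i = basis q i"
    using column_reduction[OF sr I(1,2) k, of ?Y] by blast
  note fG = E_rel_GL_rel[OF f(1) I(1)]
  have "f ?Y i = basis q i" if "i \<notin> I" for i
    using Aut_outside[OF GL_rel_Aut[OF fG] that] Aut_outside[OF gA that] by simp
  then have "(f \<circ> g) (basis q) = basis q" using f(2) by fastforce
  then obtain b r where b: "b \<in> GL_rel (I - {q})" "r \<in> vec_on (I - {q}) J" "f \<circ> g = b \<circ> trow q r"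
    using fixed_column_decomposition[OF GL_rel_comp[OF fG g] I(1,2)] by blast
  have "g = inv_map f \<circ> (f \<circ> g)"
    by (simp add: fun_eq_iff inv_comp_cancel[OF E_rel_bij[OF f(1)]])
  then have "g = inv_map f \<circ> b \<circ> trow q r" by (simp only: b(3) comp_assoc)
  then show ?thesis using E_rel_inv[OF f(1)] b(1) trow_E_rel[OF b(2) I(2,1)] by blast
qed

end

section \<open>The big cell and injective stability\<close>

lemma sum_remove2:
  assumes "finite I" "p \<in> I" "q \<in> I" "p \<noteq> q"
  shows "sum F I = F p + (F q + sum F (I - {p, q}))"
proof -
  have "I - {p} - {q} = I - {p, q}" by auto
  then show ?thesis
    using sum.remove[of I p F] sum.remove[of "I - {p}" q F] assms by simp
qed

text \<open>
  Over indices \<open>I\<close> with two special ones \<open>p\<close> and \<open>q\<close>, the aim is that a relative elementary matrix not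
  using index \<open>q\<close> is relative elementary over \<open>I - {q}\<close>.  In the manner of Dennis and Vaserstein, the
  relative elementary group is written as a product
  \<open>parabolic \<cdot> e\<^sub>p\<^sub>q(J) \<cdot> coparabolic\<close>: the first factor has trivial row \<open>p\<close> and an elementary block over
  \<open>I - {p}\<close>, the last one has trivial column \<open>q\<close> and an elementary block over \<open>I - {q}\<close>.  A third index
  \<open>m\<close> is needed to generate.
\<close>

locale cell = two_sided_ideal J for J :: "'r::ring_1 set" +
  fixes I :: "nat set" and p q m :: nat
  assumes fin: "finite I" and pI: "p \<in> I" and qI: "q \<in> I" and mI: "m \<in> I"
    and pq: "p \<noteq> q" and mp: "m \<noteq> p" and mq: "m \<noteq> q"
    and sr: "stable_range_at (card I - 2)"
begin

lemma finp: "finite (I - {p})" and finq: "finite (I - {q})"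
  using fin by auto

definition parabolic :: "((nat \<Rightarrow> 'r) \<Rightarrow> nat \<Rightarrow> 'r) set" where
  "parabolic = {tcol p v \<circ> f | v f. v \<in> vec_on (I - {p}) J \<and> f \<in> E_rel (I - {p})}"

definition coparabolic :: "((nat \<Rightarrow> 'r) \<Rightarrow> nat \<Rightarrow> 'r) set" where
  "coparabolic = {f \<circ> trow q r | f r. f \<in> E_rel (I - {q}) \<and> r \<in> vec_on (I - {q}) J}"

lemma paraI: "v \<in> vec_on (I - {p}) J \<Longrightarrow> f \<in> E_rel (I - {p}) \<Longrightarrow> tcol p v \<circ> f \<in> parabolic"
  by (auto simp: parabolic_def)

lemma coparabolicI: "f \<in> E_rel (I - {q}) \<Longrightarrow> r \<in> vec_on (I - {q}) J \<Longrightarrow> f \<circ> trow q r \<in> coparabolic"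
  by (auto simp: coparabolic_def)

lemma zero_vec_on: "(\<lambda>k. 0) \<in> vec_on K J"
  by (simp add: vec_on_def zero_mem)

lemma E_rel_parabolic: "f \<in> E_rel (I - {p}) \<Longrightarrow> f \<in> parabolic"
  using paraI[OF zero_vec_on, of f] by (simp only: tcol_zero id_o)

lemma tcol_parabolic: "v \<in> vec_on (I - {p}) J \<Longrightarrow> tcol p v \<in> parabolic"
  using paraI[OF _ E_rel_id, of v] by (simp only: o_id)

lemma E_rel_coparabolic: "f \<in> E_rel (I - {q}) \<Longrightarrow> f \<in> coparabolic"
  using coparabolicI[OF _ zero_vec_on, of f] by (simp only: trow_zero o_id)

lemma trow_coparabolic: "r \<in> vec_on (I - {q}) J \<Longrightarrow> trow q r \<in> coparabolic"
  using coparabolicI[OF E_rel_id, of r] by (simp only: id_o)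

lemma tcol_p_comp:
  "v \<in> vec_on (I - {p}) J \<Longrightarrow> w \<in> vec_on (I - {p}) J \<Longrightarrow>
     tcol p v \<circ> tcol p w = tcol p (\<lambda>k. v k + w k)"
  by (rule tcol_tcol) (auto simp: vec_on_def)

lemma trow_q_comp:
  assumes "r \<in> vec_on (I - {q}) J" "s \<in> vec_on (I - {q}) J"
  shows "trow q r \<circ> trow q s = trow q (\<lambda>k. r k + s k)"
  using assms finite_support_vec_on[OF assms(1) finq] finite_support_vec_on[OF assms(2) finq]
  by (intro trow_trow) (auto simp: vec_on_def)

lemma Aut_tcol_move:
  assumes g: "g \<in> Aut (I - {p})" and v: "v \<in> vec_on (I - {p}) J"
  shows "g \<circ> tcol p v = tcol p (g v) \<circ> g" "g v \<in> vec_on (I - {p}) J"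
proof -
  show "g \<circ> tcol p v = tcol p (g v) \<circ> g"
    by (rule tcol_move[OF Aut_linear[OF g]]) (simp add: Aut_outside[OF g])
  show "g v \<in> vec_on (I - {p}) J"
    using Aut_mem[OF g finp, of v] vec_on_mem[OF v] Aut_outside[OF g] v
    by (simp add: vec_on_def)
qed

lemma E_rel_p_Aut: "f \<in> E_rel (I - {p}) \<Longrightarrow> f \<in> Aut (I - {p})"
  and E_rel_q_Aut: "f \<in> E_rel (I - {q}) \<Longrightarrow> f \<in> Aut (I - {q})"
  using E_rel_GL_rel GL_rel_Aut finp finq by blast+

lemma Aut_trow_move:
  assumes b: "b \<in> Aut (I - {q})" and r: "r \<in> vec_on (I - {q}) J"
  shows "\<exists>r'\<in>vec_on (I - {q}) J. trow q r \<circ> b = b \<circ> trow q r'"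
proof -
  obtain r' where r': "r' \<in> vec_on (I - {q}) J" "inv_map b \<circ> trow q r = trow q r' \<circ> inv_map b"
    using trow_conj_left[OF Aut_inv[OF b] finq _ r, of q] by auto
  have "trow q r \<circ> b = b \<circ> trow q r'"
  proof
    fix x
    have "inv_map b (trow q r (b x)) = trow q r' x"
      using fun_cong[OF r'(2), of "b x"] by (simp add: inv_comp_cancel Aut_bij[OF b])
    then show "(trow q r \<circ> b) x = (b \<circ> trow q r') x"
      using inv_comp_cancel(2)[OF Aut_bij[OF b]] by (metis o_apply)
  qed
  then show ?thesis using r'(1) by blast
qed

lemma parabolic_comp: assumes "g \<in> parabolic" "h \<in> parabolic" shows "g \<circ> h \<in> parabolic"
proof -
  obtain v f where g: "g = tcol p v \<circ> f" "v \<in> vec_on (I - {p}) J" "f \<in> E_rel (I - {p})"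
    using assms(1) by (auto simp: parabolic_def)
  obtain w e where h: "h = tcol p w \<circ> e" "w \<in> vec_on (I - {p}) J" "e \<in> E_rel (I - {p})"
    using assms(2) by (auto simp: parabolic_def)
  note mv = Aut_tcol_move[OF E_rel_p_Aut[OF g(3)] h(2)]
  have "g \<circ> h = tcol p v \<circ> (f \<circ> tcol p w) \<circ> e" by (simp only: g(1) h(1) comp_assoc)
  also have "\<dots> = (tcol p v \<circ> tcol p (f w)) \<circ> (f \<circ> e)" by (simp only: mv(1) comp_assoc)
  also have "\<dots> = tcol p (\<lambda>k. v k + f w k) \<circ> (f \<circ> e)" by (simp only: tcol_p_comp[OF g(2) mv(2)])
  finally show ?thesis using paraI[OF vec_on_add[OF g(2) mv(2)] E_rel_comp[OF g(3) h(3)]] by simp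
qed

lemma tcol_p_E_rel: "v \<in> vec_on (I - {p}) J \<Longrightarrow> tcol p v \<in> E_rel I"
  using tcol_E_rel pI fin by blast

lemma trow_q_E_rel: "r \<in> vec_on (I - {q}) J \<Longrightarrow> trow q r \<in> E_rel I"
  using trow_E_rel qI fin by blast

lemma parabolic_E_rel: "g \<in> parabolic \<Longrightarrow> g \<in> E_rel I"
  unfolding parabolic_def using tcol_p_E_rel E_rel_mono[of _ "I - {p}" I] E_rel_comp by blast

lemma parabolic_GL_rel: "g \<in> parabolic \<Longrightarrow> g \<in> GL_rel I"
  using parabolic_E_rel E_rel_GL_rel fin by blast

lemma coparabolic_E_rel: "g \<in> coparabolic \<Longrightarrow> g \<in> E_rel I"
  unfolding coparabolic_def using trow_q_E_rel E_rel_mono[of _ "I - {q}" I] E_rel_comp by blast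

lemma parabolic_row: assumes "g \<in> parabolic" shows "g x p = x p"
proof -
  obtain v f where g: "g = tcol p v \<circ> f" "v \<in> vec_on (I - {p}) J" "f \<in> E_rel (I - {p})"
    using assms by (auto simp: parabolic_def)
  have "f x p = x p" using Aut_outside[OF E_rel_p_Aut[OF g(3)], of p] by simp
  moreover have "v p = 0" using g(2) by (simp add: vec_on_def)
  ultimately show ?thesis by (simp add: g(1) tcol_def)
qed

lemma inv_tcol_p: "v \<in> vec_on (I - {p}) J \<Longrightarrow> inv_map (tcol p v) = tcol p (\<lambda>k. - v k)"
  by (rule inv_tcol) (simp add: vec_on_def)

lemma inv_trow_q: "r \<in> vec_on (I - {q}) J \<Longrightarrow> inv_map (trow q r) = trow q (\<lambda>k. - r k)"
  by (rule inv_trow) (auto simp: vec_on_def finq intro: finite_support_vec_on[OF _ finq])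

lemma parabolic_inv: assumes "g \<in> parabolic" shows "inv_map g \<in> parabolic"
proof -
  obtain v f where g: "g = tcol p v \<circ> f" "v \<in> vec_on (I - {p}) J" "f \<in> E_rel (I - {p})"
    using assms by (auto simp: parabolic_def)
  have "inv_map g = inv_map f \<circ> tcol p (\<lambda>k. - v k)"
    unfolding g(1) using inv_tcol_p[OF g(2)] E_rel_bij[OF tcol_p_E_rel[OF g(2)]] E_rel_bij[OF g(3)]
    by (simp add: o_inv_distrib)
  then show ?thesis
    using parabolic_comp[OF E_rel_parabolic[OF E_rel_inv[OF g(3)]] tcol_parabolic[OF vec_on_minus[OF g(2)]]] by simp
qed

lemma coparabolic_comp: assumes "g \<in> coparabolic" "h \<in> coparabolic" shows "g \<circ> h \<in> coparabolic"
proof -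
  obtain f r where g: "g = f \<circ> trow q r" "r \<in> vec_on (I - {q}) J" "f \<in> E_rel (I - {q})"
    using assms(1) by (auto simp: coparabolic_def)
  obtain e s where h: "h = e \<circ> trow q s" "s \<in> vec_on (I - {q}) J" "e \<in> E_rel (I - {q})"
    using assms(2) by (auto simp: coparabolic_def)
  obtain r' where r': "r' \<in> vec_on (I - {q}) J" "trow q r \<circ> e = e \<circ> trow q r'"
    using Aut_trow_move[OF E_rel_q_Aut[OF h(3)] g(2)] by blast
  have "g \<circ> h = f \<circ> (trow q r \<circ> e) \<circ> trow q s" by (simp only: g(1) h(1) comp_assoc)
  also have "\<dots> = (f \<circ> e) \<circ> (trow q r' \<circ> trow q s)" by (simp only: r'(2) comp_assoc)
  also have "\<dots> = (f \<circ> e) \<circ> trow q (\<lambda>k. r' k + s k)" by (simp only: trow_q_comp[OF r'(1) h(2)])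
  finally show ?thesis using coparabolicI[OF E_rel_comp[OF g(3) h(3)] vec_on_add[OF r'(1) h(2)]] by simp
qed

lemma coparabolic_inv: assumes "g \<in> coparabolic" shows "inv_map g \<in> coparabolic"
proof -
  obtain f r where g: "g = f \<circ> trow q r" "r \<in> vec_on (I - {q}) J" "f \<in> E_rel (I - {q})"
    using assms by (auto simp: coparabolic_def)
  have "inv_map g = trow q (\<lambda>k. - r k) \<circ> inv_map f"
    unfolding g(1) using inv_trow_q[OF g(2)] E_rel_bij[OF trow_q_E_rel[OF g(2)]] E_rel_bij[OF g(3)]
    by (simp add: o_inv_distrib)
  then show ?thesis
    using coparabolic_comp[OF trow_coparabolic[OF vec_on_minus[OF g(2)]] E_rel_coparabolic[OF E_rel_inv[OF g(3)]]] by simp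
qed

lemma coparabolic_conjugate:
  assumes g: "g \<in> coparabolic" and s: "\<sigma> \<in> E_int (I - {q})"
  shows "conjugate \<sigma> g \<in> coparabolic"
proof -
  obtain f r where g: "g = f \<circ> trow q r" "r \<in> vec_on (I - {q}) J" "f \<in> E_rel (I - {q})"
    using g by (auto simp: coparabolic_def)
  obtain r' where r': "r' \<in> vec_on (I - {q}) J" "\<sigma> \<circ> trow q r = trow q r' \<circ> \<sigma>"
    using trow_conj_left[OF E_int_Aut[OF s] finq _ g(2), of q] by auto
  have "conjugate \<sigma> g = conjugate \<sigma> f \<circ> trow q r'"
    unfolding g(1) conjugate_comp[OF E_int_bij[OF s]]
    using conjugateI[OF E_int_bij[OF s] r'(2)] by simp
  then show ?thesis using coparabolicI[OF E_rel_conjugate[OF g(3) s] r'(1)] by simp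
qed

lemma parabolic_conjugate_tcol:
  assumes e: "e \<in> vec_on (I - {p}) UNIV" and g: "g \<in> parabolic"
  shows "conjugate (tcol p e) g \<in> parabolic"
proof -
  obtain v f where g: "g = tcol p v \<circ> f" "v \<in> vec_on (I - {p}) J" "f \<in> E_rel (I - {p})"
    using g by (auto simp: parabolic_def)
  have ep: "e p = 0" and vp: "v p = 0" using e g(2) by (auto simp: vec_on_def)
  note fG = E_rel_GL_rel[OF g(3) finp]
  note fA = GL_rel_Aut[OF fG]
  have fep: "f e p = 0" using Aut_outside[OF fA, of p e] ep by simp
  let ?d = "\<lambda>k. e k - f e k"
  have d: "?d \<in> vec_on (I - {p}) J"
    using GL_rel_cong[OF fG, of e] diff_commute_mem Aut_outside[OF fA] by (auto simp: vec_on_def)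
  have "conjugate (tcol p e) g = tcol p v \<circ> (tcol p ?d \<circ> f)"
  proof (rule conjugateI)
    show "bij (tcol p e)" using ep by (rule bij_tcol)
    have fm: "f \<circ> tcol p e = tcol p (f e) \<circ> f"
      by (rule tcol_move[OF Aut_linear[OF fA]]) (simp add: Aut_outside[OF fA])
    have "tcol p v \<circ> (tcol p ?d \<circ> f) \<circ> tcol p e = tcol p v \<circ> tcol p ?d \<circ> (f \<circ> tcol p e)"
      by (simp only: comp_assoc)
    also have "\<dots> = tcol p v \<circ> (tcol p ?d \<circ> tcol p (f e)) \<circ> f" by (simp only: fm comp_assoc)
    also have "\<dots> = tcol p e \<circ> g"
      unfolding g(1) by (simp add: tcol_tcol ep fep vp comp_assoc[symmetric] add.commute)
    finally show "tcol p e \<circ> g = tcol p v \<circ> (tcol p ?d \<circ> f) \<circ> tcol p e" by simp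
  qed
  then show ?thesis
    using parabolic_comp[OF tcol_parabolic[OF g(2)] paraI[OF d g(3)]] by simp
qed

text \<open>
  For \<open>t\<close> vanishing at \<open>p\<close> and \<open>q\<close>, a conjugate of \<open>tcol p t\<close> that fixes the column
  \<open>e\<^sub>q + e\<^sub>p x\<close>.
\<close>

definition shear :: "'r \<Rightarrow> (nat \<Rightarrow> 'r) \<Rightarrow> (nat \<Rightarrow> 'r) \<Rightarrow> nat \<Rightarrow> 'r" where
  "shear x t = tcol p t \<circ> tcol q (\<lambda>i. - t i * x)"

lemma conjugate_shear:
  assumes t: "t \<in> vec_on (I - {p, q}) S"
  shows "conjugate (tv p q (- x)) (shear x t) = tcol p t"
proof (rule conjugateI)
  show "bij (tv p q (- x))" using pq by (rule bij_tv)
  have "t p = 0" "t q = 0" using t by (auto simp: vec_on_def)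
  then show "tv p q (- x) \<circ> shear x t = tcol p t \<circ> tv p q (- x)"
    using pq by (auto simp: shear_def tv_def tcol_def fun_eq_iff algebra_simps)
qed

lemma conjugate_trow_q:
  assumes r: "r \<in> vec_on (I - {p, q}) J"
  shows "conjugate (tv p q (- x)) (trow q r) = trow p (\<lambda>i. - x * r i) \<circ> trow q r"
proof (rule conjugateI)
  show "bij (tv p q (- x))" using pq by (rule bij_tv)
  have r0: "r p = 0" "r q = 0" using r by (auto simp: vec_on_def)
  have fs: "finite {k. r k \<noteq> 0}" using finite_support_vec_on[OF r] fin by simp
  have d: "dot r (y(p := a)) = dot r y" "dot r (y(q := a)) = dot r y" for y a
    by (rule dot_upd_outside, rule r0)+
  show "tv p q (- x) \<circ> trow q r = trow p (\<lambda>i. - x * r i) \<circ> trow q r \<circ> tv p q (- x)"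
    using pq by (auto simp: tv_def trow_def fun_eq_iff d dot_scale_left[OF fs, of "- x", simplified]
        dot_scale_left[OF fs] algebra_simps)
qed

lemma stable_range_inner: "stable_range_at (card (I - {p, q}))"
  using sr fin pI qI pq by (simp add: card_Diff_subset numeral_2_eq_2)

text \<open>
  A matrix using neither \<open>p\<close> nor \<open>q\<close> commutes with the signed transposition of \<open>p\<close> and \<open>q\<close>, which
  exchanges the two elementary groups.
\<close>

lemma Aut_pq_E_rel:
  assumes b: "b \<in> Aut (I - {p, q})" "b \<in> E_rel (I - {p})"
  shows "b \<in> E_rel (I - {q})"
proof -
  have qp: "q \<noteq> p" using pq by simp
  have "swap q p \<in> Aut {p, q}" by (rule E_int_Aut[OF swap_E_int]) (use pq in auto)
  then have "swap q p \<circ> b = b \<circ> swap q p"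
    by (rule Aut_disjoint_commute[OF _ b(1)]) (use fin in auto)
  then have c: "conjugate (swap q p) b = b" by (rule conjugateI[OF bij_swap[OF qp]])
  have "conjugate (swap q p) b \<in> E_rel (insert p (I - {p} - {q}))"
    by (rule E_rel_conjugate_swap[OF b(2) qp]) simp
  moreover have "insert p (I - {p} - {q}) = I - {q}" using pI pq by auto
  ultimately show ?thesis unfolding c by (simp only:)
qed

text \<open>
  This is an unstable form of Whitehead's observation that \<open>1 - X K\<close> and \<open>1 - K X\<close> have the same class in
  \<open>K\<^sub>1\<close>.  If \<open>g\<close> fixes \<open>w = e\<^sub>q + e\<^sub>p x\<close>, then \<open>g\<close> and \<open>u g u\<^sup>-\<^sup>1\<close> with \<open>u = e\<^sub>p\<^sub>q(-x)\<close> have blocks of the shapes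
  \<open>1 - K X\<close> and \<open>1 - X K\<close> over \<open>I - {p}\<close> and \<open>I - {q}\<close>, where \<open>X\<close> is diagonal with the only nontrivial
  entry \<open>x\<close>.
  
  The matrices \<open>h\<close> with \<open>u h u\<^sup>-\<^sup>1\<close> coparabolic form a group.  It contains \<open>shear x t\<close> and \<open>trow q r\<close>, and it
  is stable under conjugation by \<open>\<tau> = shear x (basis m)\<close>.  These operations, all of which fix \<open>w\<close>,
  reduce \<open>g\<close> to a matrix that uses neither \<open>p\<close> nor \<open>q\<close>, for which the claim is clear.  The stable range
  condition for \<open>card I - 2\<close> entries is used once, for the sum of columns \<open>p\<close> and \<open>m\<close>.
\<close>

lemma parabolic_fixing_vector:
  assumes g: "g \<in> parabolic" and x: "x \<in> J"
    and fix_w: "g (\<lambda>i. basis q i + basis p i * x) = (\<lambda>i. basis q i + basis p i * x)"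
  shows "conjugate (tv p q (- x)) g \<in> coparabolic"
proof -
  define w where "w = (\<lambda>i. basis q i + basis p i * x)"
  define u where "u = tv p q (- x)"
  have bu: "bij u" unfolding u_def using pq by (rule bij_tv)
  have u: "u \<in> Aut {p, q}" unfolding u_def using pq by (intro tv_Aut) auto
  let ?K = "I - {p, q}"
  have finK: "finite ?K" and Kp: "?K \<subseteq> I - {p}" and Kq: "?K \<subseteq> I - {q}" and mK: "m \<in> ?K"
    using fin mI mp mq by auto
  have Kpq: "I - {p} - {q} = ?K" "I - {q} - {p} = ?K" by auto
  have w_simps: "w p = x" "w q = 1" "i \<noteq> p \<Longrightarrow> i \<noteq> q \<Longrightarrow> w i = 0" for i
    using pq by (auto simp: w_def basis_def)
  have good_comp: "conjugate u (a \<circ> h) \<in> coparabolic" if "conjugate u a \<in> coparabolic" "conjugate u h \<in> coparabolic" for a h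
    unfolding conjugate_comp[OF bu] using that by (rule coparabolic_comp)
  have good_cancel: "conjugate u h \<in> coparabolic"
    if "a \<in> parabolic" "conjugate u a \<in> coparabolic" "conjugate u (a \<circ> h) \<in> coparabolic" for a h
  proof -
    have ba: "bij a" using that(1) parabolic_E_rel E_rel_bij by blast
    have "h = inv_map a \<circ> (a \<circ> h)" by (simp add: fun_eq_iff inv_comp_cancel ba)
    moreover have "conjugate u (inv_map a \<circ> (a \<circ> h)) \<in> coparabolic"
      using that(2) by (intro good_comp that(3)) (simp add: conjugate_inv bu ba coparabolic_inv)
    ultimately show ?thesis by metis
  qed
  have shear_parabolic: "shear x t \<in> parabolic" and shear_good: "conjugate u (shear x t) \<in> coparabolic"
    and shear_w: "shear x t w = w" if t: "t \<in> vec_on ?K J" for t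
  proof -
    have "tcol p t \<in> parabolic" using tcol_parabolic vec_on_mono[OF t Kp] by blast
    moreover have "tcol q (\<lambda>i. - t i * x) \<in> E_rel (I - {p})"
    proof (rule tcol_E_rel)
      show "(\<lambda>i. - t i * x) \<in> vec_on (I - {p} - {q}) J"
        using t mult_left_mem[OF x] unfolding Kpq by (auto simp: vec_on_def minus_mem_iff)
    qed (use qI pq finp in auto)
    ultimately show "shear x t \<in> parabolic"
      unfolding shear_def by (rule parabolic_comp[OF _ E_rel_parabolic])
    have "tcol p t \<in> E_rel (I - {q})"
      by (rule tcol_E_rel) (use t pI pq finq in \<open>auto simp: Kpq\<close>)
    then show "conjugate u (shear x t) \<in> coparabolic"
      unfolding u_def conjugate_shear[OF t] by (rule E_rel_coparabolic)
    have "t p = 0" using t by (simp add: vec_on_def)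
    then show "shear x t w = w" using t pq
      by (auto simp: shear_def tcol_def w_simps fun_eq_iff)
  qed
  have row_parabolic: "trow q r \<in> parabolic" and row_good: "conjugate u (trow q r) \<in> coparabolic"
    and row_w: "trow q r w = w" if r: "r \<in> vec_on ?K J" for r
  proof -
    show "trow q r \<in> parabolic"
      by (intro E_rel_parabolic trow_E_rel) (use r qI pq finp in \<open>auto simp: Kpq\<close>)
    have "trow p (\<lambda>i. - x * r i) \<in> E_rel (I - {q})"
    proof (rule trow_E_rel)
      show "(\<lambda>i. - x * r i) \<in> vec_on (I - {q} - {p}) J"
        using r mult_left_mem unfolding Kpq by (auto simp: vec_on_def minus_mem_iff)
    qed (use pI pq finq in auto)
    then show "conjugate u (trow q r) \<in> coparabolic"
      unfolding u_def conjugate_trow_q[OF r] by (rule coparabolicI[OF _ vec_on_mono[OF r Kq]])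
    have "dot r w = dot r (\<lambda>k. 0)"
    proof (rule dot_cong_support)
      fix k assume "r k \<noteq> 0"
      then have "k \<in> ?K" using r unfolding vec_on_def by blast
      then show "w k = 0" using w_simps(3) by auto
    qed
    then show "trow q r w = w" by (simp add: trow_def dot_def)
  qed
  (* The column p alone is congruent to 0 on the inner indices, where no column can be made
     unimodular; its sum with column m is congruent to the basis vector m there. *)
  define e :: "nat \<Rightarrow> 'r" where "e i = basis p i + basis m i" for i
  have e_simps: "e p = 1" "e m = 1" "e q = 0" "i \<noteq> p \<Longrightarrow> i \<noteq> m \<Longrightarrow> e i = 0" for i
    using pq mp mq by (auto simp: e_def basis_def)
  define Y where "Y = g e"
  have gG: "g \<in> GL_rel I" using g by (rule parabolic_GL_rel)
  note gA = GL_rel_Aut[OF gG]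
  have Yp: "Y p = 1" unfolding Y_def using parabolic_row[OF g] e_simps by simp
  have YJ: "Y i - e i \<in> J" for i unfolding Y_def by (rule GL_rel_cong[OF gG])
  have Ym: "Y m - 1 \<in> J" using YJ[of m] e_simps by simp
  have Yi: "Y i \<in> J" if "i \<noteq> p" "i \<noteq> m" for i using YJ[of i] e_simps that by simp
  (* The sum of columns p and m of the conjugate of g is unimodular and has no entry q to spare. *)
  obtain d e1 where uni: "(\<Sum>i\<in>?K. d i * Y i) + e1 * (1 - x * Y q) + 0 * 0 = 1"
  proof -
    let ?h = "conjugate u g"
    have hA: "?h \<in> Aut I" by (rule Aut_conjugate[OF Aut_mono[OF u] gA]) (use pI qI in auto)
    have ue: "inv_map u e = e"
      unfolding u_def using pq e_simps by (simp add: inv_tv tv_def fun_eq_iff)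
    have he: "?h e = Y(p := 1 - x * Y q)"
      by (simp add: conjugate_def ue Y_def[symmetric] del: fun_upd_apply) (simp add: u_def tv_def Yp)
    have uq: "inv_map u (basis q) = w"
      unfolding u_def using pq by (auto simp: inv_tv tv_def basis_def w_def fun_eq_iff)
    have uw: "u w = basis q"
      unfolding u_def using pq by (auto simp: tv_def basis_def w_simps fun_eq_iff)
    have "?h (basis q) = basis q"
      by (simp add: conjugate_def uq) (simp add: fix_w[folded w_def] uw)
    then have hq: "inv_map ?h (basis q) = basis q"
      using inv_comp_cancel(1)[OF Aut_bij[OF hA], of "basis q"] by simp
    let ?d = "\<lambda>l. inv_map ?h (basis l) m"
    have "(\<Sum>l\<in>I. ?d l * ?h e l) = 1"
      by (rule unimodular_column[OF hA fin mI]) (simp add: e_simps)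
    then have "?d p * ?h e p + (?d q * ?h e q + (\<Sum>l\<in>?K. ?d l * ?h e l)) = 1"
      unfolding sum_remove2[OF fin pI qI pq] .
    moreover have "?h e p = 1 - x * Y q" by (simp add: he)
    moreover have "?d q = 0" using mq by (simp add: hq basis_other)
    moreover have "(\<Sum>l\<in>?K. ?d l * ?h e l) = (\<Sum>l\<in>?K. ?d l * Y l)"
      by (rule sum.cong) (auto simp: he)
    ultimately show ?thesis by (intro that[of ?d "?d p"]) (simp add: add.commute)
  qed
  obtain t0 t1 where t0: "\<And>i. t0 i \<in> J"
    "unimodular ?K (\<lambda>i. Y i + t0 i * (1 - x * Y q) + t1 i * 0)"
    using stable_range_extend[OF stable_range_inner finK mK Ym _ uni] Yi by auto
  define t where "t i = (if i \<in> ?K then t0 i else 0)" for i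
  have t: "t \<in> vec_on ?K J" using t0 by (auto simp: t_def vec_on_def)
  have tpq: "t p = 0" "t q = 0" by (simp_all add: t_def)
  define g1 where "g1 = shear x t \<circ> g"
  have Y1: "g1 e i = Y i + t i * (1 - x * Y q)" for i
    unfolding g1_def Y_def[symmetric] o_apply shear_def tcol_def
    using pq by (simp add: Y_def[symmetric] Yp tpq algebra_simps)
  obtain d where d: "(\<Sum>i\<in>?K. d i * g1 e i) = 1"
    using t0(2) unfolding unimodular_def Y1 t_def by auto
  define a where "a i = (if i \<in> ?K then - Y q * d i else 0)" for i
  have YqJ: "Y q \<in> J" using Yi pq mq by metis
  have a: "a \<in> vec_on ?K J"
    using mult_right_mem[OF minus_mem[OF YqJ]] by (auto simp: a_def vec_on_def)
  have "dot a (g1 e) = (\<Sum>i\<in>?K. a i * g1 e i)"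
    by (rule dot_eq_sum) (use finK in \<open>auto simp: a_def\<close>)
  also have "\<dots> = (\<Sum>i\<in>?K. - Y q * (d i * g1 e i))"
    by (rule sum.cong) (simp_all add: a_def mult.assoc)
  also have "\<dots> = - Y q" by (simp only: sum_distrib_left[symmetric] d mult_1_right)
  finally have dota: "dot a (g1 e) = - Y q" .
  (* With unimodular inner entries, entry q of the sum of columns can be cleared. *)
  define g2 where "g2 = trow q a \<circ> g1"
  have g2q: "g2 e q = 0" by (simp add: g2_def trow_def dota Y1 tpq)
  have g2p: "g2 \<in> parabolic" and g2w: "g2 w = w"
    unfolding g2_def g1_def using t a g
    by (auto intro!: parabolic_comp row_parabolic shear_parabolic simp: fix_w[folded w_def] shear_w row_w)
  have red1: "conjugate u g \<in> coparabolic" if "conjugate u g2 \<in> coparabolic"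
    using that good_cancel[OF row_parabolic[OF a] row_good[OF a]] good_cancel[OF shear_parabolic[OF t] shear_good[OF t]]
    unfolding g2_def g1_def by blast
  (* Conjugation by this map turns the sum of columns p and m into column p. *)
  define \<tau> where "\<tau> = shear x (basis m)"
  have mv: "basis m \<in> vec_on ?K UNIV" using mK by (rule basis_vec_on)
  define c where "c = tcol q (\<lambda>i. - basis m i * x)"
  have cE: "c \<in> E_rel (I - {p})"
    unfolding c_def
  proof (rule tcol_E_rel)
    show "(\<lambda>i. - basis m i * x) \<in> vec_on (I - {p} - {q}) J"
      using mI mp mq x minus_mem unfolding Kpq by (auto simp: vec_on_def basis_def zero_mem)
  qed (use qI pq finp in auto)
  define z where "z = tcol p (basis m :: nat \<Rightarrow> 'r)"
  have z: "z = tv m p 1" by (simp add: z_def fun_eq_iff tv_def tcol_def basis_def)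
  have bz: "bij z" unfolding z using mp by (rule bij_tv)
  have bc: "bij c" using cE by (rule E_rel_bij)
  have \<tau>: "\<tau> = z \<circ> c" by (simp add: \<tau>_def shear_def z_def c_def)
  have b\<tau>: "bij \<tau>" unfolding \<tau> using bc bz by (rule bij_comp)
  have \<tau>e: "\<tau> (basis p) = e"
    using pq mp by (auto simp: \<tau> c_def z_def tcol_def basis_def e_def fun_eq_iff)
  have \<tau>w: "\<tau> w = w"
    using pq mp mq by (auto simp: \<tau> c_def z_def tcol_def basis_def w_simps fun_eq_iff)
  have \<tau>row: "\<tau> y p = y p" "\<tau> y q = y q" for y
    using pq mp mq by (simp_all add: \<tau> c_def z_def tcol_def basis_def)
  define g3 where "g3 = conjugate (inv_map \<tau>) g2"
  have g2g3: "g2 = conjugate \<tau> g3"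
    unfolding g3_def by (simp add: conjugate_conjugate_inv[OF b\<tau>])
  have g3p: "g3 \<in> parabolic"
  proof -
    have "g3 = conjugate (inv_map c) (conjugate (inv_map z) g2)"
      unfolding g3_def \<tau> by (simp add: o_inv_distrib bc bz conjugate_conjugate bij_imp_bij_inv)
    moreover have "inv_map z = tcol p (\<lambda>i. - basis m i)"
      unfolding z_def using mp by (intro inv_tcol) (simp add: basis_def)
    moreover have "(\<lambda>i. - basis m i :: 'r) \<in> vec_on (I - {p}) UNIV"
      using mI mp by (auto simp: vec_on_def basis_def)
    ultimately have "g3 = inv_map c \<circ> conjugate (inv_map z) g2 \<circ> c" "conjugate (inv_map z) g2 \<in> parabolic"
      using parabolic_conjugate_tcol[OF _ g2p] by (auto simp: conjugate_def inv_inv_eq bc)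
    then show ?thesis
      using parabolic_comp parabolic_inv E_rel_parabolic[OF cE] by metis
  qed
  have g3w: "g3 w = w"
  proof -
    have "inv_map \<tau> w = w" using inv_comp_cancel(1)[OF b\<tau>, of w] \<tau>w by simp
    then show ?thesis using \<tau>w by (simp add: g3_def conjugate_def inv_inv_eq[OF b\<tau>] g2w)
  qed
  have red2: "conjugate u g2 \<in> coparabolic" if "conjugate u g3 \<in> coparabolic"
  proof -
    have "conjugate u \<tau> = z" unfolding u_def \<tau>_def conjugate_shear[OF mv] z_def ..
    then have uz: "u \<circ> \<tau> = z \<circ> u" using conjugate_swap[OF bu, of \<tau>] by simp
    have "conjugate u g2 = conjugate z (conjugate u g3)"
      unfolding g2g3 by (simp only: conjugate_conjugate bu b\<tau> bz uz)
    moreover have "z \<in> E_int (I - {q})"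
      unfolding z using mI pI mp mq pq by (intro tv_E_int) auto
    ultimately show ?thesis using coparabolic_conjugate[OF that] by metis
  qed
  have g3e: "\<tau> (g3 (basis p)) = g2 e"
    by (simp add: g3_def conjugate_def inv_inv_eq[OF b\<tau>] \<tau>e inv_comp_cancel[OF b\<tau>])
  then have col_q: "g3 (basis p) q = 0" using \<tau>row(2)[of "g3 (basis p)"] g2q by simp
  define v where "v i = (if i \<in> ?K then - g3 (basis p) i else 0)" for i
  have v: "v \<in> vec_on ?K J"
    using GL_rel_mem[OF parabolic_GL_rel[OF g3p], of "basis p"]
    by (auto simp: v_def vec_on_def minus_mem_iff basis_def zero_mem)
  (* Since entry q of column p is now 0, the shear clears the inner entries of column p; column q
     then is trivial as well, because the vector w is fixed. *)
  define g4 where "g4 = shear x v \<circ> g3"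
  have red3: "conjugate u g3 \<in> coparabolic" if "conjugate u g4 \<in> coparabolic"
    using that good_cancel[OF shear_parabolic[OF v] shear_good[OF v]] unfolding g4_def by blast
  have g4p: "g4 \<in> parabolic" unfolding g4_def using v g3p by (intro parabolic_comp shear_parabolic)
  have g4w: "g4 w = w" by (simp add: g4_def g3w shear_w[OF v])
  have g4e: "g4 (basis p) = basis p"
  proof
    fix i
    have out: "g3 (basis p) i = basis p i" if "i \<notin> I" for i
      using Aut_outside[OF GL_rel_Aut[OF parabolic_GL_rel[OF g3p]] that] .
    show "g4 (basis p) i = basis p i"
      using parabolic_row[OF g3p, of "basis p"] out[of i] pq
      by (auto simp: g4_def shear_def tcol_def v_def col_q basis_def)
  qed
  note g4A = GL_rel_Aut[OF parabolic_GL_rel[OF g4p]]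
  have g4q: "g4 (basis q) = basis q"
  proof -
    have "g4 w = (\<lambda>i. g4 (basis q) i + basis p i * x)"
      unfolding w_def by (simp only: linear_mapD[OF Aut_linear[OF g4A]] g4e)
    then have "(\<lambda>i. g4 (basis q) i + basis p i * x) = (\<lambda>i. basis q i + basis p i * x)"
      unfolding g4w by (simp add: w_def)
    then show ?thesis by (simp add: fun_eq_iff)
  qed
  have g4E: "g4 \<in> E_rel (I - {p})"
  proof -
    obtain v' f where g4: "g4 = tcol p v' \<circ> f" "v' \<in> vec_on (I - {p}) J" "f \<in> E_rel (I - {p})"
      using g4p by (auto simp: parabolic_def)
    have "f (basis p) = basis p" using Aut_basis[OF E_rel_p_Aut[OF g4(3)]] by simp
    then have "(\<lambda>i. basis p i + v' i) = basis p"
      using g4e by (simp add: g4(1) tcol_def)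
    then have "v' = (\<lambda>k. 0)" by (simp add: fun_eq_iff)
    then show ?thesis using g4 by (simp only: tcol_zero id_o)
  qed
  obtain b r where b: "b \<in> GL_rel (I - {p} - {q})" and r: "r \<in> vec_on (I - {p} - {q}) J"
    and g4: "g4 = b \<circ> trow q r"
    using fixed_column_decomposition[OF E_rel_GL_rel[OF g4E finp] finp _ g4q] qI pq by auto
  note b = b[unfolded Kpq] and r = r[unfolded Kpq]
  have "b = g4 \<circ> inv_map (trow q r)"
    unfolding g4 using E_rel_bij[OF parabolic_E_rel[OF row_parabolic[OF r]]] by (simp add: fun_eq_iff inv_comp_cancel)
  moreover have "trow q r \<in> E_rel (I - {p})"
    by (rule trow_E_rel) (use r qI pq finp in \<open>auto simp: Kpq\<close>)
  ultimately have bE: "b \<in> E_rel (I - {p})" using g4E E_rel_comp E_rel_inv by metis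
  have "u \<circ> b = b \<circ> u"
    by (rule Aut_disjoint_commute[OF u GL_rel_Aut[OF b]]) (use finK in auto)
  then have "conjugate u b = b" using bu by (intro conjugateI)
  then have "conjugate u b \<in> coparabolic"
    using E_rel_coparabolic[OF Aut_pq_E_rel[OF GL_rel_Aut[OF b] bE]] by simp
  then have "conjugate u g4 \<in> coparabolic"
    unfolding g4 by (rule good_comp[OF _ row_good[OF r]])
  then show ?thesis using red1 red2 red3 unfolding u_def by blast
qed

end

context cell
begin

lemma trow_parabolic: assumes r: "r \<in> vec_on (I - {q}) J" shows "trow q r \<in> parabolic"
proof -
  let ?r = "r(p := 0)"
  have r': "?r \<in> vec_on (I - {p} - {q}) J" using r by (auto simp: vec_on_def)
  have "trow q r = tv q p (r p) \<circ> trow q ?r"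
    unfolding tv_eq_trow using r pq finite_support_vec_on[OF r'] fin
    by (subst trow_trow) (auto simp: vec_on_def intro!: arg_cong[where f = "trow q"])
  moreover have "trow q ?r \<in> E_rel (I - {p})" by (rule trow_E_rel[OF r']) (use qI pq finp in auto)
  moreover have "tv q p (r p) \<in> parabolic"
    unfolding tv_eq_tcol by (rule tcol_parabolic) (use vec_on_mem[OF r] qI pq zero_mem in \<open>auto simp: vec_on_def\<close>)
  ultimately show ?thesis using parabolic_comp E_rel_parabolic by metis
qed

lemma parabolic_conjugate_int:
  assumes s: "\<sigma> \<in> E_int (I - {p})" and g: "g \<in> parabolic"
  shows "conjugate \<sigma> g \<in> parabolic"
proof -
  obtain v f where g: "g = tcol p v \<circ> f" "v \<in> vec_on (I - {p}) J" "f \<in> E_rel (I - {p})"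
    using g by (auto simp: parabolic_def)
  note mv = Aut_tcol_move[OF E_int_Aut[OF s] g(2)]
  note bs = E_int_bij[OF s]
  have "conjugate \<sigma> g = tcol p (\<sigma> v) \<circ> conjugate \<sigma> f"
    unfolding g(1) conjugate_comp[OF bs] conjugateI[OF bs mv(1)] ..
  then show ?thesis using paraI[OF mv(2) E_rel_conjugate[OF g(3) s]] by simp
qed

definition bigcell :: "((nat \<Rightarrow> 'r) \<Rightarrow> nat \<Rightarrow> 'r) set" where
  "bigcell = {g \<circ> tv p q x \<circ> h | g x h. g \<in> parabolic \<and> x \<in> J \<and> h \<in> coparabolic}"

lemma bigcellI: "g \<in> parabolic \<Longrightarrow> x \<in> J \<Longrightarrow> h \<in> coparabolic \<Longrightarrow> g \<circ> tv p q x \<circ> h \<in> bigcell"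
  by (auto simp: bigcell_def)

lemma bigcell_parabolic: assumes g: "g \<in> parabolic" and T: "T \<in> bigcell" shows "g \<circ> T \<in> bigcell"
proof -
  obtain g' x h where T: "T = g' \<circ> tv p q x \<circ> h" "g' \<in> parabolic" "x \<in> J" "h \<in> coparabolic"
    using T by (auto simp: bigcell_def)
  show ?thesis using bigcellI[OF parabolic_comp[OF g T(2)] T(3,4)] by (simp only: T(1) comp_assoc)
qed

lemma tv_pq_comp: "tv p q a \<circ> tv p q b = tv p q (a + b)"
  by (rule tv_tv[OF pq])

lemma coparabolic_bigcell: "h \<in> coparabolic \<Longrightarrow> h \<in> bigcell"
  using bigcellI[OF E_rel_parabolic[OF E_rel_id] zero_mem, of h] by (simp only: tv_zero id_o)

lemma tv_pq_E_rel: "x \<in> J \<Longrightarrow> tv p q x \<in> E_rel I"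
  by (rule tv_E_rel[OF pI qI pq])

lemma bigcell_E_rel: "T \<in> bigcell \<Longrightarrow> T \<in> E_rel I"
  unfolding bigcell_def using parabolic_E_rel coparabolic_E_rel tv_pq_E_rel E_rel_comp by blast

lemma coparabolic_fixes: assumes "h \<in> coparabolic" shows "h (basis q) = basis q"
proof -
  obtain f r where h: "h = f \<circ> trow q r" "f \<in> E_rel (I - {q})" "r \<in> vec_on (I - {q}) J"
    using assms by (auto simp: coparabolic_def)
  have "dot r (basis q) = 0"
    using dot_basis[OF finite_support_vec_on[OF h(3) finq], of q] h(3) by (simp add: vec_on_def)
  then have "trow q r (basis q) = basis q" by (simp add: trow_def fun_eq_iff)
  then show ?thesis using Aut_basis[OF E_rel_q_Aut[OF h(2)], of q] by (simp add: h(1))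
qed

lemma block_unique:
  assumes eq: "b \<circ> trow q r = f \<circ> trow q s" and b: "b \<in> Aut (I - {q})" and f: "f \<in> Aut (I - {q})"
  shows "b = f"
proof (intro ext)
  fix x i
  have upd: "b (x(q := c)) = (b x)(q := c)" "f (x(q := c)) = (f x)(q := c)" for c
    using Aut_upd[OF b, of q] Aut_upd[OF f, of q] by simp_all
  have "(b x)(q := x q + dot r x) = (f x)(q := x q + dot s x)"
    using fun_cong[OF eq, of x] by (simp only: o_apply trow_def upd)
  then have "b x i = f x i" if "i \<noteq> q" using that by (metis fun_upd_other)
  then show "b x i = f x i"
    using Aut_outside[OF b, of q] Aut_outside[OF f, of q] by (cases "i = q") auto
qed

text \<open>
  The decomposition is unique up to relative elementary blocks.  Two decompositions give a parabolic \<open>G\<close>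
  with \<open>G e\<^sub>p\<^sub>q(x\<^sub>1) = e\<^sub>p\<^sub>q(x) Q\<close>, where \<open>Q\<close> fixes \<open>e\<^sub>q\<close>.  Column \<open>q\<close> of this equation shows that \<open>x\<^sub>1 = x\<close> and that
  \<open>G\<close> fixes \<open>e\<^sub>q + e\<^sub>p x\<close>, so that \<open>parabolic_fixing_vector\<close> applies.
\<close>

lemma bigcell_block:
  assumes T: "T \<in> bigcell" and eq: "T = g \<circ> tv p q x \<circ> b \<circ> trow q r"
    and g: "g \<in> parabolic" and x: "x \<in> J" and b: "b \<in> GL_rel (I - {q})" and r: "r \<in> vec_on (I - {q}) J"
  shows "b \<in> E_rel (I - {q})"
proof -
  obtain g1 x1 h1 where T1: "T = g1 \<circ> tv p q x1 \<circ> h1" "g1 \<in> parabolic" "x1 \<in> J" "h1 \<in> coparabolic"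
    using T by (auto simp: bigcell_def)
  define G where "G = inv_map g \<circ> g1"
  define Q where "Q = b \<circ> trow q r \<circ> inv_map h1"
  have G: "G \<in> parabolic" unfolding G_def using g T1(2) by (intro parabolic_comp parabolic_inv)
  have bij: "bij g" "bij h1" "bij b" "bij (tv p q x)"
    using E_rel_bij parabolic_E_rel[OF g] coparabolic_E_rel[OF T1(4)] GL_rel_bij[OF b] bij_tv[OF pq] by blast+
  have GQ: "G \<circ> tv p q x1 = tv p q x \<circ> Q"
  proof
    fix y
    have "g1 (tv p q x1 (h1 (inv_map h1 y))) = g (tv p q x (b (trow q r (inv_map h1 y))))"
      using eq unfolding T1(1) by (metis o_apply)
    then show "(G \<circ> tv p q x1) y = (tv p q x \<circ> Q) y"
      by (simp add: G_def Q_def inv_comp_cancel bij)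
  qed
  have fx: "inv_map h1 (basis q) = basis q"
    using inv_comp_cancel(1)[OF bij(2), of "basis q"] coparabolic_fixes[OF T1(4)] by simp
  have "dot r (basis q) = 0"
    using dot_basis[OF finite_support_vec_on[OF r finq], of q] r by (simp add: vec_on_def)
  then have "trow q r (basis q) = basis q" by (simp add: trow_def fun_eq_iff)
  then have Qq: "Q (basis q) = basis q"
    using Aut_basis[OF GL_rel_Aut[OF b], of q] by (simp add: Q_def fx)
  have w: "tv p q y (basis q) = (\<lambda>i. basis q i + basis p i * y)" for y :: 'r
    using pq by (auto simp: tv_def basis_def)
  have Gw: "G (\<lambda>i. basis q i + basis p i * x1) = (\<lambda>i. basis q i + basis p i * x)"
    using fun_cong[OF GQ, of "basis q"] by (simp add: Qq w)
  then have "x1 = x" using parabolic_row[OF G, of "\<lambda>i. basis q i + basis p i * x1"] pq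
    by (simp add: basis_other)
  then have "conjugate (tv p q (- x)) G \<in> coparabolic"
    using parabolic_fixing_vector[OF G x] Gw by simp
  moreover have "conjugate (tv p q (- x)) G = Q"
  proof (rule conjugateI)
    show "bij (tv p q (- x))" by (rule bij_tv[OF pq])
    have i: "tv p q (- x) \<circ> tv p q x = id" "tv p q x \<circ> tv p q (- x) = id"
      using pq by (simp_all add: tv_tv)
    have "tv p q (- x) \<circ> G = tv p q (- x) \<circ> (G \<circ> tv p q x1) \<circ> tv p q (- x)"
      unfolding \<open>x1 = x\<close> comp_assoc i by (simp only: o_id)
    also have "\<dots> = (tv p q (- x) \<circ> tv p q x) \<circ> Q \<circ> tv p q (- x)" unfolding GQ comp_assoc ..
    finally show "tv p q (- x) \<circ> G = Q \<circ> tv p q (- x)" by (simp only: i id_o)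
  qed
  ultimately have "Q \<circ> h1 \<in> coparabolic" using coparabolic_comp T1(4) by metis
  moreover have "Q \<circ> h1 = b \<circ> trow q r"
    by (simp add: fun_eq_iff Q_def inv_comp_cancel bij)
  ultimately obtain f s where fs: "b \<circ> trow q r = f \<circ> trow q s" "f \<in> E_rel (I - {q})"
    by (auto simp: coparabolic_def)
  then have "b = f" using block_unique GL_rel_Aut[OF b] E_rel_q_Aut by blast
  then show ?thesis using fs by simp
qed

text \<open>
  Every matrix of the congruence subgroup has such a decomposition, with an arbitrary block \<open>b\<close>.  Reduce
  column \<open>q\<close> to \<open>e\<^sub>q + e\<^sub>p x\<close> by adding multiples of entry \<open>p\<close> to the others and applying a relative elementary
  matrix over \<open>I - {p}\<close>.  Making the entries off \<open>p\<close> and \<open>k\<close> unimodular by multiples of these two leaves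
  entry \<open>k\<close> untouched; the freedom \<open>v k = 0\<close> makes the big cell stable under conjugation by \<open>e\<^sub>p\<^sub>k(\<plusminus>1)\<close>.
\<close>

lemma cell_decomposition:
  assumes g: "g \<in> GL_rel I" and k: "k \<in> I" "k \<noteq> p" "k \<noteq> q"
  shows "\<exists>v f x b r. g = tcol p v \<circ> f \<circ> tv p q x \<circ> b \<circ> trow q r \<and>
    v \<in> vec_on (I - {p}) J \<and> v k = 0 \<and> f \<in> E_rel (I - {p}) \<and> x \<in> J \<and>
    b \<in> GL_rel (I - {q}) \<and> r \<in> vec_on (I - {q}) J"
proof -
  note gA = GL_rel_Aut[OF g]
  define Y where "Y = g (basis q)"
  have Yq: "Y q - 1 \<in> J" using GL_rel_cong[OF g, of "basis q" q] by (simp add: Y_def)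
  have Yi: "Y i \<in> J" if "i \<noteq> q" for i
    using GL_rel_cong[OF g, of "basis q" i] that by (simp add: Y_def basis_other)
  let ?K = "I - {p, k}"
  have finK: "finite ?K" and qK: "q \<in> ?K" using fin qI pq k by auto
  have card: "card ?K = card I - 2" using fin pI k by (simp add: card_Diff_subset numeral_2_eq_2)
  let ?d = "\<lambda>l. inv_map g (basis l) q"
  have "(\<Sum>l\<in>I. ?d l * Y l) = 1"
    unfolding Y_def by (rule unimodular_column[OF gA fin qI]) simp
  moreover have "(\<Sum>l\<in>I. ?d l * Y l) = ?d p * Y p + (?d k * Y k + (\<Sum>l\<in>?K. ?d l * Y l))"
    using sum_remove2[OF fin pI k(1)] k by simp
  ultimately have uni: "(\<Sum>l\<in>?K. ?d l * Y l) + ?d p * Y p + ?d k * Y k = 1"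
    by (simp add: add_ac)
  obtain t1 t2 where t: "\<And>i. t1 i \<in> J" "unimodular ?K (\<lambda>i. Y i + t1 i * Y p + t2 i * Y k)"
    using stable_range_extend[OF _ finK qK Yq _ uni] Yi sr card by auto
  define v where "v i = (if i \<in> ?K then t1 i else 0)" for i
  have v: "v \<in> vec_on (I - {p}) J" and v0: "v p = 0" "v k = 0"
    using t(1) zero_mem by (auto simp: v_def vec_on_def)
  define Z where "Z = tcol p v Y"
  have Z: "Z i = Y i + v i * Y p" for i by (simp add: Z_def tcol_def)
  obtain d where d: "(\<Sum>i\<in>?K. d i * (Z i + t2 i * Y k)) = 1"
    using t(2) unfolding unimodular_def Z v_def by auto
  have "unimodular (I - {p}) Z"
    unfolding unimodular_def
  proof
    let ?e = "\<lambda>i. if i = k then (\<Sum>i\<in>?K. d i * t2 i) else d i"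
    have "I - {p} = insert k ?K" using k by auto
    moreover have "(\<Sum>i\<in>?K. ?e i * Z i) = (\<Sum>i\<in>?K. d i * Z i)" by (rule sum.cong) auto
    ultimately have "(\<Sum>i\<in>I - {p}. ?e i * Z i) = (\<Sum>i\<in>?K. d i * t2 i) * Z k + (\<Sum>i\<in>?K. d i * Z i)"
      using finK by (simp add: sum.insert)
    also have "Z k = Y k" by (simp add: Z v0)
    also have "(\<Sum>i\<in>?K. d i * t2 i) * Y k + (\<Sum>i\<in>?K. d i * Z i) = 1"
      using d by (simp add: distrib_left sum.distrib sum_distrib_right mult.assoc add.commute)
    finally show "(\<Sum>i\<in>I - {p}. ?e i * Z i) = 1" .
  qed
  moreover have "stable_range_at (card (I - {p}) - 1)"
    using sr pI fin by (simp add: numeral_2_eq_2)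
  moreover have "Z q - 1 \<in> J"
  proof -
    have "(Y q - 1) + v q * Y p \<in> J" using Yq Yi[OF pq] add_mem mult_left_mem by blast
    then show ?thesis by (simp add: Z algebra_simps)
  qed
  moreover have "Z i \<in> J" if "i \<noteq> q" for i
    unfolding Z using Yi[OF that] Yi[OF pq] add_mem mult_left_mem by blast
  ultimately obtain f where f: "f \<in> E_rel (I - {p})" "\<forall>i\<in>I - {p}. f Z i = basis q i"
    using column_reduction[of "I - {p}" q k Z] finp qI pq k by auto
  note fA = E_rel_p_Aut[OF f(1)]
  define h where "h = tv p q (- Y p) \<circ> (f \<circ> (tcol p v \<circ> g))"
  have "f Z = (\<lambda>i. basis q i + basis p i * Y p)"
  proof
    fix i
    show "f Z i = basis q i + basis p i * Y p"
    proof (cases "i \<in> I - {p}")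
      case True
      then show ?thesis using f(2) by (simp add: basis_other)
    next
      case False
      then have "f Z i = Z i" by (rule Aut_outside[OF fA])
      moreover have "Z i = basis q i + basis p i * Y p"
      proof (cases "i = p")
        case True
        then show ?thesis using pq by (simp add: Z v0 basis_other)
      next
        case i: False
        then have "i \<notin> I" using False by simp
        then have "Y i = basis q i" unfolding Y_def by (rule Aut_outside[OF gA])
        then show ?thesis using \<open>i \<notin> I\<close> i by (simp add: Z v_def basis_other)
      qed
      ultimately show ?thesis by simp
    qed
  qed
  then have "h (basis q) = basis q"
    unfolding h_def o_apply Y_def[symmetric] Z_def[symmetric]
    using pq by (auto simp: tv_def basis_def)
  moreover have hG: "h \<in> GL_rel I"
    unfolding h_def
    using g v f(1) Yi[OF pq] minus_mem parabolic_GL_rel tcol_parabolic E_rel_parabolic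
      E_rel_GL_rel[OF tv_pq_E_rel fin]
    by (intro GL_rel_comp) blast+
  ultimately obtain b r where b: "b \<in> GL_rel (I - {q})" "r \<in> vec_on (I - {q}) J" "h = b \<circ> trow q r"
    using fixed_column_decomposition[OF _ fin qI] by blast
  have bf: "bij f" using f(1) by (rule E_rel_bij)
  have "g = tcol p (\<lambda>i. - v i) \<circ> inv_map f \<circ> tv p q (Y p) \<circ> h"
  proof
    fix y
    have 1: "tv p q (Y p) (tv p q (- Y p) z) = z" for z
      using fun_cong[OF tv_pq_comp[of "Y p" "- Y p"], of z] by simp
    have 2: "tcol p (\<lambda>i. - v i) (tcol p v z) = z" for z
      using fun_cong[OF tcol_tcol[of v p "\<lambda>i. - v i"], of z] v0
      by (simp add: tcol_def)
    show "g y = (tcol p (\<lambda>i. - v i) \<circ> inv_map f \<circ> tv p q (Y p) \<circ> h) y"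
      by (simp add: h_def 1 2 inv_comp_cancel bf)
  qed
  then have "g = tcol p (\<lambda>i. - v i) \<circ> inv_map f \<circ> tv p q (Y p) \<circ> b \<circ> trow q r"
    unfolding b(3) by (simp only: comp_assoc)
  then show ?thesis using b vec_on_minus[OF v] v0 E_rel_inv[OF f(1)] Yi[OF pq]
    by (intro exI[of _ "\<lambda>i. - v i"] exI[of _ "inv_map f"] exI[of _ "Y p"] exI[of _ b] exI[of _ r]) simp
qed

lemma bigcell_conjugate_to_p:
  assumes T: "T \<in> bigcell" and k: "k \<in> I" "k \<noteq> p" "k \<noteq> q" and s: "s \<in> {1, - 1}"
  shows "conjugate (tv k p s) T \<in> bigcell"
proof -
  let ?s = "tv k p s"
  have bs: "bij ?s" using k by (intro bij_tv)
  obtain g x h where T: "T = g \<circ> tv p q x \<circ> h" "g \<in> parabolic" "x \<in> J" "h \<in> coparabolic"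
    using T by (auto simp: bigcell_def)
  have "conjugate ?s g \<in> parabolic"
    unfolding tv_eq_tcol by (rule parabolic_conjugate_tcol[OF _ T(2)]) (use k in \<open>auto simp: vec_on_def\<close>)
  moreover have u: "conjugate ?s (tv p q x) = tv k q (s * x) \<circ> tv p q x"
    by (rule conjugateI[OF bs]) (use k pq in \<open>auto simp: tv_def fun_eq_iff algebra_simps\<close>)
  moreover have "tv k q (s * x) \<in> parabolic"
    by (intro E_rel_parabolic tv_E_rel mult_left_mem) (use k qI pq T(3) in auto)
  moreover have "conjugate ?s h \<in> coparabolic"
    by (rule coparabolic_conjugate[OF T(4)]) (intro tv_E_int; use k pI pq s in auto)
  moreover have "conjugate ?s T = (conjugate ?s g \<circ> tv k q (s * x)) \<circ> tv p q x \<circ> conjugate ?s h"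
    unfolding T(1) by (simp only: conjugate_comp[OF bs] u comp_assoc)
  ultimately show ?thesis using bigcellI[OF parabolic_comp T(3)] by metis
qed

text \<open>
  A decomposition with \<open>v k = 0\<close> exists, and by uniqueness its block is relative elementary again.
\<close>

lemma bigcell_conjugate_from_p:
  assumes T: "T \<in> bigcell" and k: "k \<in> I" "k \<noteq> p" "k \<noteq> q" and s: "s \<in> {1, - 1}"
  shows "conjugate (tv p k s) T \<in> bigcell"
proof -
  let ?s = "tv p k s"
  have bs: "bij ?s" using k by (intro bij_tv) auto
  obtain v f x b r where dec: "T = tcol p v \<circ> f \<circ> tv p q x \<circ> b \<circ> trow q r"
    "v \<in> vec_on (I - {p}) J" "v k = 0" "f \<in> E_rel (I - {p})" "x \<in> J"
    "b \<in> GL_rel (I - {q})" "r \<in> vec_on (I - {q}) J"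
    using cell_decomposition[OF E_rel_GL_rel[OF bigcell_E_rel[OF T] fin] k] by blast
  have b: "b \<in> E_rel (I - {q})"
    using bigcell_block[OF T dec(1) paraI[OF dec(2,4)] dec(5,6,7)] .
  have vp: "v p = 0" using dec(2) by (simp add: vec_on_def)
  have c1: "conjugate ?s (tcol p v) = tcol p v \<circ> tcol k (\<lambda>i. - (v i * s))"
    by (rule conjugateI[OF bs]) (use k vp dec(3) in \<open>auto simp: tv_def tcol_def fun_eq_iff algebra_simps\<close>)
  define \<rho> where "\<rho> = (\<lambda>l. s * (f (basis l) k - basis l k))"
  have fG: "f \<in> GL_rel (I - {p})" using E_rel_GL_rel[OF dec(4) finp] .
  note fA = GL_rel_Aut[OF fG]
  have \<rho>: "\<rho> \<in> vec_on (I - {p}) J"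
    using GL_rel_cong[OF fG] Aut_basis[OF fA] by (auto simp: \<rho>_def vec_on_def intro!: mult_left_mem)
  have c2: "conjugate ?s f = f \<circ> trow p \<rho>"
    unfolding \<rho>_def by (rule conjugate_tv_row[OF fA finp]) (use k in auto)
  have c3: "conjugate ?s (tv p q x) = tv p q x"
    by (rule conjugateI[OF bs]) (use k pq in \<open>auto simp: tv_def fun_eq_iff algebra_simps\<close>)
  have c4: "conjugate ?s (b \<circ> trow q r) \<in> coparabolic"
    by (rule coparabolic_conjugate[OF coparabolicI[OF b dec(7)]]) (intro tv_E_int; use k pI pq s in auto)
  let ?\<rho> = "\<rho>(q := 0)"
  have \<rho>': "?\<rho> \<in> vec_on (I - {q} - {p}) J" using \<rho> by (auto simp: vec_on_def)
  have fs: "finite {k. ?\<rho> k \<noteq> 0}" using finite_support_vec_on[OF \<rho>'] fin by simp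
  have \<rho>p: "\<rho> p = 0" "?\<rho> p = 0" using \<rho> pq by (auto simp: vec_on_def)
  have c5: "trow p \<rho> \<circ> tv p q x = tv p q (\<rho> q + x) \<circ> trow p ?\<rho>"
  proof -
    have sp: "tv p q y = trow p (\<lambda>k. if k = q then y else 0)" for y by (rule tv_eq_trow)
    have f1: "finite {k. \<rho> k \<noteq> 0}" using finite_support_vec_on[OF \<rho> finp] .
    have f2: "finite {k. (if k = q then y else 0) \<noteq> 0}" for y :: 'r by simp
    have "trow p \<rho> \<circ> tv p q x = trow p (\<lambda>k. \<rho> k + (if k = q then x else 0))"
      unfolding sp by (rule trow_trow[OF _ _ f1 f2]) (use \<rho>p pq in auto)
    moreover have "tv p q (\<rho> q + x) \<circ> trow p ?\<rho> = trow p (\<lambda>k. (if k = q then \<rho> q + x else 0) + ?\<rho> k)"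
      unfolding sp by (rule trow_trow[OF _ _ f2 fs]) (use \<rho>p pq in auto)
    moreover have "(\<lambda>k. \<rho> k + (if k = q then x else 0)) = (\<lambda>k. (if k = q then \<rho> q + x else 0) + ?\<rho> k)"
      by auto
    ultimately show ?thesis by simp
  qed
  have "conjugate ?s T = (tcol p v \<circ> tcol k (\<lambda>i. - (v i * s)) \<circ> f) \<circ> (trow p \<rho> \<circ> tv p q x)
      \<circ> conjugate ?s (b \<circ> trow q r)"
    unfolding dec(1) by (simp only: conjugate_comp[OF bs] c1 c2 c3 comp_assoc)
  also have "\<dots> = (tcol p v \<circ> (tcol k (\<lambda>i. - (v i * s)) \<circ> f)) \<circ> tv p q (\<rho> q + x)
      \<circ> (trow p ?\<rho> \<circ> conjugate ?s (b \<circ> trow q r))"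
    by (simp only: c5 comp_assoc)
  also have "\<dots> \<in> bigcell"
  proof (rule bigcellI)
    have "tcol k (\<lambda>i. - (v i * s)) \<in> E_rel (I - {p})"
    proof (rule tcol_E_rel)
      show "(\<lambda>i. - (v i * s)) \<in> vec_on (I - {p} - {k}) J"
        using dec(2,3) mult_right_mem by (auto simp: vec_on_def minus_mem_iff)
    qed (use k finp in auto)
    then show "tcol p v \<circ> (tcol k (\<lambda>i. - (v i * s)) \<circ> f) \<in> parabolic"
      using dec(2,4) by (intro paraI E_rel_comp)
    show "\<rho> q + x \<in> J" using vec_on_mem[OF \<rho>] dec(5) by (rule add_mem)
    have "trow p ?\<rho> \<in> E_rel (I - {q})"
      by (rule trow_E_rel[OF \<rho>']) (use pI pq finq in auto)
    then show "trow p ?\<rho> \<circ> conjugate ?s (b \<circ> trow q r) \<in> coparabolic"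
      using coparabolic_comp[OF E_rel_coparabolic c4] by blast
  qed
  finally show ?thesis .
qed

text \<open>
  Multiplication by \<open>e\<^sub>p\<^sub>q(a)\<close> does not obviously preserve the big cell.  But multiplication by \<open>e\<^sub>m\<^sub>q(a)\<close>
  does, and conjugating it by \<open>e\<^sub>p\<^sub>m(1)\<close> gives \<open>e\<^sub>m\<^sub>q(a) e\<^sub>p\<^sub>q(a)\<close>.
\<close>

lemma bigcell_tv_pq: assumes T: "T \<in> bigcell" and a: "a \<in> J" shows "tv p q a \<circ> T \<in> bigcell"
proof -
  let ?s = "tv p m (1::'r)"
  have bs: "bij ?s" using mp by (intro bij_tv) auto
  have si: "inv_map ?s = tv p m (- 1)" using mp by (intro inv_tv) auto
  have tm: "tv m q y \<in> parabolic" if "y \<in> J" for y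
    by (intro E_rel_parabolic tv_E_rel) (use mI mp mq qI pq that in auto)
  have c: "conjugate (tv p m (- 1)) T \<in> bigcell"
    using bigcell_conjugate_from_p[OF T mI mp mq] by simp
  have "conjugate ?s (tv m q a \<circ> conjugate (inv_map ?s) T) \<in> bigcell"
    unfolding si by (rule bigcell_conjugate_from_p[OF bigcell_parabolic[OF tm[OF a] c] mI mp mq]) simp
  moreover have "conjugate ?s (tv m q a) = tv m q a \<circ> tv p q a"
    by (rule conjugateI[OF bs]) (use mp mq pq in \<open>auto simp: tv_def fun_eq_iff algebra_simps\<close>)
  ultimately have "(tv m q a \<circ> tv p q a) \<circ> T \<in> bigcell"
    by (simp only: conjugate_comp[OF bs] conjugate_conjugate_inv[OF bs])
  then have "tv m q (- a) \<circ> ((tv m q a \<circ> tv p q a) \<circ> T) \<in> bigcell"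
    by (rule bigcell_parabolic[OF tm[OF minus_mem[OF a]]])
  moreover have "tv m q (- a) \<circ> ((tv m q a \<circ> tv p q a) \<circ> T) = (tv m q (- a) \<circ> tv m q a) \<circ> (tv p q a \<circ> T)"
    by (simp only: comp_assoc)
  ultimately show ?thesis by (simp only: tv_tv[OF mq] left_minus tv_zero id_o)
qed

lemma bigcell_conjugate_from_q:
  assumes T: "T \<in> bigcell" and k: "k \<in> I" "k \<noteq> p" "k \<noteq> q" and s: "s \<in> {1, - 1}"
  shows "conjugate (tv q k s) T \<in> bigcell"
proof -
  let ?s = "tv q k s"
  have bs: "bij ?s" using k by (intro bij_tv) auto
  obtain g x h where T: "T = g \<circ> tv p q x \<circ> h" "g \<in> parabolic" "x \<in> J" "h \<in> coparabolic"
    using T by (auto simp: bigcell_def)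
  obtain f r where h: "h = f \<circ> trow q r" "f \<in> E_rel (I - {q})" "r \<in> vec_on (I - {q}) J"
    using T(4) by (auto simp: coparabolic_def)
  have c1: "conjugate ?s g \<in> parabolic"
    by (rule parabolic_conjugate_int[OF _ T(2)]) (intro tv_E_int; use k qI pq s in auto)
  have c2: "conjugate ?s (tv p q x) = tv p q x \<circ> tv p k (- (x * s))"
    by (rule conjugateI[OF bs]) (use k pq in \<open>auto simp: tv_def fun_eq_iff algebra_simps\<close>)
  have fG: "f \<in> GL_rel (I - {q})" using E_rel_GL_rel[OF h(2) finq] .
  note fA = GL_rel_Aut[OF fG]
  define \<rho> where "\<rho> = (\<lambda>l. s * (f (basis l) k - basis l k))"
  have \<rho>: "\<rho> \<in> vec_on (I - {q}) J"
    using GL_rel_cong[OF fG] Aut_basis[OF fA] by (auto simp: \<rho>_def vec_on_def intro!: mult_left_mem)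
  have c3: "conjugate ?s f = f \<circ> trow q \<rho>"
    unfolding \<rho>_def by (rule conjugate_tv_row[OF fA finq]) (use k in auto)
  have "r q = 0" using h(3) by (simp add: vec_on_def)
  then have c4: "conjugate ?s (trow q r) = trow q r"
    by (intro conjugateI[OF bs]) (use k in \<open>auto simp: tv_def trow_def fun_eq_iff dot_upd_outside algebra_simps\<close>)
  have "tv p k (- (x * s)) \<in> coparabolic"
    by (intro E_rel_coparabolic tv_E_rel minus_mem mult_right_mem T(3)) (use k pI pq in auto)
  then have c5: "tv p k (- (x * s)) \<circ> (f \<circ> trow q \<rho> \<circ> trow q r) \<in> coparabolic"
    by (rule coparabolic_comp[OF _ coparabolic_comp[OF coparabolicI[OF h(2) \<rho>] trow_coparabolic[OF h(3)]]])
  have "conjugate ?s T = conjugate ?s g \<circ> tv p q x \<circ> (tv p k (- (x * s)) \<circ> (f \<circ> trow q \<rho> \<circ> trow q r))"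
    unfolding T(1) h(1) by (simp only: conjugate_comp[OF bs] c2 c3 c4 comp_assoc)
  then show ?thesis using bigcellI[OF c1 T(3) c5] by simp
qed

text \<open>
  The last factor is first moved to the left through the block; there it is parabolic.  The commutator of
  the block with \<open>e\<^sub>k\<^sub>q(s)\<close> has entries in column \<open>q\<close> only.
\<close>

lemma bigcell_conjugate_to_q:
  assumes T: "T \<in> bigcell" and k: "k \<in> I" "k \<noteq> p" "k \<noteq> q" and s: "s \<in> {1, - 1}"
  shows "conjugate (tv k q s) T \<in> bigcell"
proof -
  let ?s = "tv k q s"
  have bs: "bij ?s" using k by (intro bij_tv)
  have si: "?s \<in> E_int (I - {p})" by (intro tv_E_int) (use k qI pq s in auto)
  obtain g x h where T: "T = g \<circ> tv p q x \<circ> h" "g \<in> parabolic" "x \<in> J" "h \<in> coparabolic"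
    using T by (auto simp: bigcell_def)
  obtain f r where h: "h = f \<circ> trow q r" "f \<in> E_rel (I - {q})" "r \<in> vec_on (I - {q}) J"
    using T(4) by (auto simp: coparabolic_def)
  have fG: "f \<in> GL_rel (I - {q})" using E_rel_GL_rel[OF h(2) finq] .
  note fA = GL_rel_Aut[OF fG]
  obtain r' where r': "r' \<in> vec_on (I - {q}) J" "f \<circ> trow q r = trow q r' \<circ> f"
    using trow_conj_left[OF fA finq _ h(3), of q] by auto
  have c1: "conjugate ?s g \<in> parabolic" "conjugate ?s (trow q r') \<in> parabolic"
    using parabolic_conjugate_int[OF si] T(2) trow_parabolic[OF r'(1)] by blast+
  have c2: "conjugate ?s (tv p q x) = tv p q x"
    by (rule conjugateI[OF bs]) (use k pq in \<open>auto simp: tv_def fun_eq_iff algebra_simps\<close>)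
  define c where "c = (\<lambda>i. (basis k i - f (basis k) i) * s)"
  have c: "c \<in> vec_on (I - {q}) J"
    using GL_rel_cong[OF fG, of "basis k"] Aut_outside[OF fA]
    by (auto simp: c_def vec_on_def diff_commute_mem intro!: mult_right_mem)
  have c3: "conjugate ?s f = tcol q c \<circ> f"
    unfolding c_def by (rule conjugate_tv_col[OF fA]) (use k in auto)
  let ?c = "c(p := 0)"
  have c': "?c \<in> vec_on (I - {p} - {q}) J" using c by (auto simp: vec_on_def)
  have c4: "tcol q c = tv p q (c p) \<circ> tcol q ?c"
    unfolding tv_eq_tcol using c pq
    by (subst tcol_tcol) (auto simp: vec_on_def intro!: arg_cong[where f = "tcol q"])
  have c5: "tcol q ?c \<in> parabolic"
    by (intro E_rel_parabolic tcol_E_rel[OF c']) (use qI pq finp in auto)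
  have "tv p q (c p) \<circ> (tcol q ?c \<circ> f) \<in> bigcell"
    by (intro bigcell_tv_pq bigcell_parabolic[OF c5] coparabolic_bigcell E_rel_coparabolic h(2) vec_on_mem[OF c])
  then have "conjugate ?s g \<circ> (tv p q x \<circ> (conjugate ?s (trow q r') \<circ> (tv p q (c p) \<circ> (tcol q ?c \<circ> f)))) \<in> bigcell"
    by (rule bigcell_parabolic[OF c1(1) bigcell_tv_pq[OF bigcell_parabolic[OF c1(2)] T(3)]])
  moreover have "conjugate ?s T = conjugate ?s g \<circ> (tv p q x \<circ> (conjugate ?s (trow q r') \<circ> (tv p q (c p) \<circ> (tcol q ?c \<circ> f))))"
    unfolding T(1) h(1) r'(2) by (simp only: conjugate_comp[OF bs] c2 c3 c4 comp_assoc)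
  ultimately show ?thesis by simp
qed

text \<open>
  The four preceding cases generate: the elementary matrices within \<open>{p, q}\<close> and within its complement are
  commutators of matrices between the two sets.
\<close>

lemma bigcell_conjugate:
  assumes "\<sigma> \<in> E_int I" and "T \<in> bigcell"
  shows "conjugate \<sigma> T \<in> bigcell"
proof -
  define C where "C \<sigma> \<longleftrightarrow> bij \<sigma> \<and> (\<forall>T\<in>bigcell. conjugate \<sigma> T \<in> bigcell)" for \<sigma>
  have comp: "C (\<sigma> \<circ> \<tau>)" if "C \<sigma>" "C \<tau>" for \<sigma> \<tau>
    using that unfolding C_def by (metis bij_comp conjugate_conjugate)
  have mid: "C (tv i j s)" if "i \<in> I" "j \<in> I" "i \<noteq> j" "s \<in> {1, - 1}" "(i \<in> {p, q}) \<noteq> (j \<in> {p, q})" for i j s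
    unfolding C_def
    using that bij_tv[OF that(3)] bigcell_conjugate_to_p bigcell_conjugate_from_p
      bigcell_conjugate_to_q bigcell_conjugate_from_q by (intro conjI ballI) (assumption, auto)
  have com: "C (tv i j s)" if "C (tv i k s)" "C (tv i k (- s))" "C (tv k j 1)" "C (tv k j (- 1))"
    "i \<noteq> j" "i \<noteq> k" "j \<noteq> k" for i j k s
  proof -
    have "tv i j s = tv i k s \<circ> (tv k j 1 \<circ> (tv i k (- s) \<circ> tv k j (- 1)))"
      using tv_commutator[of i j k s 1] that(5-7) by (simp add: inv_tv comp_assoc)
    then show ?thesis using that comp by metis
  qed
  have gen: "C (tv i j s)" if ij: "i \<in> I" "j \<in> I" "i \<noteq> j" and s: "s \<in> {1, - 1}" for i j s
  proof (cases "(i \<in> {p, q}) = (j \<in> {p, q})")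
    case True
    define k where "k = (if i \<in> {p, q} then m else p)"
    have "k \<in> I" "k \<noteq> i" "k \<noteq> j" "(i \<in> {p, q}) \<noteq> (k \<in> {p, q})"
      using True mp mq mI pI by (auto simp: k_def)
    then show ?thesis using True ij s by (intro com[of i k s j] mid) auto
  qed (use mid ij s in blast)
  have "C \<sigma>" using assms(1)
  proof (induction \<sigma> rule: E_int.induct)
    case E_int_id
    show "C id" unfolding C_def using conjugate_id by (simp add: conjugate_def)
  next
    case (E_int_step i j s \<sigma>)
    then show "C (tv i j s \<circ> \<sigma>)" by (intro comp gen)
  qed
  then show ?thesis using assms(2) by (simp add: C_def)
qed

lemma bigcell_tv:
  assumes T: "T \<in> bigcell" and ij: "i \<in> I" "j \<in> I" "i \<noteq> j" and a: "a \<in> J"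
  shows "tv i j a \<circ> T \<in> bigcell"
proof -
  consider "j = p" | "i \<noteq> p" "j \<noteq> p" | "i = p" "j = q" | "i = p" "j \<noteq> q" "j \<noteq> p" using ij by blast
  then show ?thesis
  proof cases
    case 1
    then have "tv i j a \<in> parabolic"
      unfolding tv_eq_tcol 1 by (intro tcol_parabolic) (use 1 ij a zero_mem in \<open>auto simp: vec_on_def\<close>)
    then show ?thesis using T by (rule bigcell_parabolic)
  next
    case 2
    then have "tv i j a \<in> parabolic" using ij a by (intro E_rel_parabolic tv_E_rel) auto
    then show ?thesis using T by (rule bigcell_parabolic)
  next
    case 3
    then show ?thesis using bigcell_tv_pq[OF T a] by simp
  next
    case 4
    let ?s = "tv q j (1::'r)"
    have s: "?s \<in> E_int I" using 4 ij qI by (intro tv_E_int) auto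
    note bs = E_int_bij[OF s]
    have "conjugate ?s (tv p q (- a) \<circ> conjugate (inv_map ?s) T) \<in> bigcell"
      by (intro bigcell_conjugate s bigcell_tv_pq E_int_inv T minus_mem a)
    moreover have "conjugate ?s (tv p q (- a)) = tv p q (- a) \<circ> tv p j a"
      by (rule conjugateI[OF bs]) (use 4 pq in \<open>auto simp: tv_def fun_eq_iff algebra_simps\<close>)
    ultimately have "tv p q (- a) \<circ> tv p j a \<circ> T \<in> bigcell"
      by (simp only: conjugate_comp[OF bs] conjugate_conjugate_inv[OF bs])
    then have "tv p q a \<circ> (tv p q (- a) \<circ> tv p j a \<circ> T) \<in> bigcell" using a by (rule bigcell_tv_pq)
    moreover have "tv p q a \<circ> (tv p q (- a) \<circ> tv p j a \<circ> T) = (tv p q a \<circ> tv p q (- a)) \<circ> (tv p j a \<circ> T)"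
      by (simp only: comp_assoc)
    ultimately show ?thesis by (simp only: tv_pq_comp right_minus tv_zero id_o 4)
  qed
qed

lemma E_rel_bigcell: "f \<in> E_rel I \<Longrightarrow> f \<in> bigcell"
proof (induction f rule: E_rel.induct)
  case E_rel_id
  show "id \<in> bigcell" by (rule coparabolic_bigcell[OF E_rel_coparabolic[OF E_rel.E_rel_id]])
next
  case (E_rel_step \<sigma> i j a f)
  note bs = E_int_bij[OF E_rel_step(1)]
  have "conjugate \<sigma> (tv i j a \<circ> conjugate (inv_map \<sigma>) f) \<in> bigcell"
    using E_rel_step by (intro bigcell_conjugate bigcell_tv E_int_inv)
  then show "conjugate \<sigma> (tv i j a) \<circ> f \<in> bigcell"
    by (simp only: conjugate_comp[OF bs] conjugate_conjugate_inv[OF bs])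
qed

lemma E_rel_Aut_restrict:
  assumes f: "f \<in> E_rel I" and A: "f \<in> Aut (I - {q})"
  shows "f \<in> E_rel (I - {q})"
proof (rule bigcell_block[OF E_rel_bigcell[OF f]])
  show "f = id \<circ> tv p q 0 \<circ> f \<circ> trow q (\<lambda>k. 0)" by (simp only: tv_zero trow_zero id_o o_id)
  show "f \<in> GL_rel (I - {q})" using E_rel_GL_rel[OF f fin] A by (simp add: GL_rel_def)
qed (auto intro: E_rel_parabolic E_rel_id zero_mem zero_vec_on)

end

context two_sided_ideal
begin

text \<open>
  Injective stability.  An element \<open>f\<close> that does not use \<open>q\<close> lies in the big cell and is its own block.
\<close>

theorem E_rel_injective_stability:
  assumes I: "finite I" "q \<in> I" "4 \<le> card I" and sr: "stable_range_at (card I - 2)"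
    and f: "f \<in> E_rel I" "f \<in> Aut (I - {q})"
  shows "f \<in> E_rel (I - {q})"
proof -
  have "2 \<le> card (I - {q})" using I by simp
  then obtain p m where pm: "p \<in> I - {q}" "m \<in> I - {q}" "p \<noteq> m"
    by (metis I(1) card_le_Suc0_iff_eq finite_Diff not_less_eq_eq numeral_2_eq_2)
  interpret cell J I p q m
    by unfold_locales (use I pm sr in auto)
  show ?thesis using f by (rule E_rel_Aut_restrict)
qed

end

section \<open>A unital ring containing all unitalizations\<close>

context nonunital_ring
begin

lemma zero_mult [simp]: assumes "x \<in> carrier A" shows "\<zero> \<otimes> x = \<zero>" "x \<otimes> \<zero> = \<zero>"
proof -
  have c: "\<zero> \<otimes> x \<in> carrier A" "x \<otimes> \<zero> \<in> carrier A" using assms by (simp_all add: mult_closed)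
  have "\<zero> \<otimes> x \<oplus> \<zero> \<otimes> x = \<zero> \<otimes> x" using left_distrib[of \<zero> \<zero> x] assms by simp
  then show "\<zero> \<otimes> x = \<zero>" using c(1) by (metis add.r_cancel_one' add.l_cancel_one)
  have "x \<otimes> \<zero> \<oplus> x \<otimes> \<zero> = x \<otimes> \<zero>" using right_distrib[of \<zero> \<zero> x] assms by simp
  then show "x \<otimes> \<zero> = \<zero>" using c(2) by (metis add.r_cancel_one' add.l_cancel_one)
qed

lemma int_mult_left:
  assumes "a \<in> carrier A" "b \<in> carrier A"
  shows "add_pow A (k::int) a \<otimes> b = add_pow A k (a \<otimes> b)"
proof -
  have "(\<lambda>x. x \<otimes> b) \<in> hom (add_monoid A) (add_monoid A)"
    using assms by (auto simp: hom_def mult_closed left_distrib)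
  then show ?thesis
    using hom_int_pow[of "\<lambda>x. x \<otimes> b" "add_monoid A" "add_monoid A" a k] assms(1) add.is_group
    by (simp add: add_pow_def)
qed

lemma int_mult_right:
  assumes "a \<in> carrier A" "b \<in> carrier A"
  shows "a \<otimes> add_pow A (k::int) b = add_pow A k (a \<otimes> b)"
proof -
  have "(\<lambda>x. a \<otimes> x) \<in> hom (add_monoid A) (add_monoid A)"
    using assms by (auto simp: hom_def mult_closed right_distrib)
  then show ?thesis
    using hom_int_pow[of "\<lambda>x. a \<otimes> x" "add_monoid A" "add_monoid A" b k] assms(2) add.is_group
    by (simp add: add_pow_def)
qed

lemma int_mult_add: "a \<in> carrier A \<Longrightarrow> add_pow A (k + l :: int) a = add_pow A k a \<oplus> add_pow A l a"
  using add.int_pow_mult[of a k l] by simp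

lemma int_mult_mult: "a \<in> carrier A \<Longrightarrow> add_pow A (k :: int) (add_pow A (l :: int) a) = add_pow A (k * l) a"
  using add.int_pow_pow[of a k l] by (simp add: mult.commute)

lemma int_mult_distrib:
  "a \<in> carrier A \<Longrightarrow> b \<in> carrier A \<Longrightarrow> add_pow A (k :: int) (a \<oplus> b) = add_pow A k a \<oplus> add_pow A k b"
  using add.int_pow_distrib[of a b k] by simp

lemma int_mult_closed [simp]: "a \<in> carrier A \<Longrightarrow> add_pow A (k :: int) a \<in> carrier A"
  using add.int_pow_closed[of a k] by simp

lemma int_mult_one [simp]: "a \<in> carrier A \<Longrightarrow> add_pow A (1 :: int) a = a"
  using add.int_pow_1[of a] by simp

lemma int_mult_zero [simp]: "add_pow A (k :: int) \<zero> = \<zero>" "add_pow A (0 :: int) a = \<zero>"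
  using add.int_pow_one[of k] by (simp_all add: add_pow_def)

lemma unitalization_ring: "ring (unitalization A)"
proof (rule ringI)
  show "abelian_group (unitalization A)"
  proof (rule abelian_groupI)
    fix x assume "x \<in> carrier (unitalization A)"
    then show "\<exists>y\<in>carrier (unitalization A). y \<oplus>\<^bsub>unitalization A\<^esub> x = \<zero>\<^bsub>unitalization A\<^esub>"
      by (intro bexI[of _ "(- fst x, \<ominus> snd x)"]) (auto simp: unitalization_def split: prod.splits intro: l_neg)
  qed (auto simp: unitalization_def a_ac)
  show "monoid (unitalization A)"
  proof (rule monoidI)
    fix x y z assume "x \<in> carrier (unitalization A)" "y \<in> carrier (unitalization A)" "z \<in> carrier (unitalization A)"
    then obtain k a l b m c where xyz: "x = (k, a)" "y = (l, b)" "z = (m, c)"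
      "a \<in> carrier A" "b \<in> carrier A" "c \<in> carrier A"
      by (auto simp: unitalization_def)
    note [simp] = xyz(4-6) mult_closed
    show "(x \<otimes>\<^bsub>unitalization A\<^esub> y) \<otimes>\<^bsub>unitalization A\<^esub> z = x \<otimes>\<^bsub>unitalization A\<^esub> (y \<otimes>\<^bsub>unitalization A\<^esub> z)"
      unfolding xyz(1-3)
      by (simp add: unitalization_def left_distrib right_distrib int_mult_left int_mult_right int_mult_distrib
          int_mult_mult mult_assoc a_ac mult.commute mult.left_commute)
  qed (auto simp: unitalization_def mult_closed)
next
  fix x y z assume "x \<in> carrier (unitalization A)" "y \<in> carrier (unitalization A)" "z \<in> carrier (unitalization A)"
  then obtain k a l b m c where xyz: "x = (k, a)" "y = (l, b)" "z = (m, c)"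
    "a \<in> carrier A" "b \<in> carrier A" "c \<in> carrier A"
    by (auto simp: unitalization_def)
  note [simp] = xyz(4-6) mult_closed
  show "(x \<oplus>\<^bsub>unitalization A\<^esub> y) \<otimes>\<^bsub>unitalization A\<^esub> z =
        x \<otimes>\<^bsub>unitalization A\<^esub> z \<oplus>\<^bsub>unitalization A\<^esub> y \<otimes>\<^bsub>unitalization A\<^esub> z"
    "z \<otimes>\<^bsub>unitalization A\<^esub> (x \<oplus>\<^bsub>unitalization A\<^esub> y) =
        z \<otimes>\<^bsub>unitalization A\<^esub> x \<oplus>\<^bsub>unitalization A\<^esub> z \<otimes>\<^bsub>unitalization A\<^esub> y"
    unfolding xyz(1-3)
    by (simp_all add: unitalization_def left_distrib right_distrib int_mult_add int_mult_distrib
        a_ac distrib_left distrib_right)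
qed

end

definition trivial_ring :: "'a ring" where
  "trivial_ring = \<lparr>carrier = {undefined}, monoid.mult = (\<lambda>_ _. undefined), one = undefined,
     ring.zero = undefined, add = (\<lambda>_ _. undefined)\<rparr>"

lemma nonunital_trivial_ring: "nonunital_ring trivial_ring"
  unfolding nonunital_ring_def nonunital_ring_axioms_def
  by (auto simp: trivial_ring_def intro: abelian_groupI)

text \<open>
  A total version of the choice of a non-unital ring, so that unitalizations exist without side
  condition.
\<close>

definition some_ring :: "'a ring \<Rightarrow> 'a ring" where
  "some_ring A = (if nonunital_ring A then A else trivial_ring)"

lemma nonunital_some_ring: "nonunital_ring (some_ring A)"
  by (simp add: some_ring_def nonunital_trivial_ring)

lemma some_ring_eq [simp]: "nonunital_ring A \<Longrightarrow> some_ring A = A"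
  by (simp add: some_ring_def)

abbreviation U :: "'a ring \<Rightarrow> (int \<times> 'a) ring" where
  "U A \<equiv> unitalization (some_ring A)"

lemma ring_U: "ring (U A)"
  using nonunital_ring.unitalization_ring nonunital_some_ring by blast

text \<open>
  The product of the unitalizations of all non-unital rings with elements in \<open>'a\<close>.  It is a unital ring
  that does not depend on a particular \<open>A\<close>, and every \<open>A\<close> is an ideal of it.  The stable range condition
  and the congruence subgroups only depend on the ideal, so the matrix theory over a type of class
  \<open>ring_1\<close> applies to each \<open>A\<close>; and homomorphisms between non-unital rings become endomorphisms of a
  single ring.
\<close>

typedef 'a uring = "{f :: 'a ring \<Rightarrow> int \<times> 'a. \<forall>A. f A \<in> carrier (U A)}"
  by (rule exI[of _ "\<lambda>A. \<zero>\<^bsub>U A\<^esub>"]) (simp add: ring.ring_simprules(2)[OF ring_U])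

lemma U_null:
  assumes "x \<in> carrier (U A)"
  shows "\<zero>\<^bsub>U A\<^esub> \<otimes>\<^bsub>U A\<^esub> x = \<zero>\<^bsub>U A\<^esub>" "x \<otimes>\<^bsub>U A\<^esub> \<zero>\<^bsub>U A\<^esub> = \<zero>\<^bsub>U A\<^esub>"
    "x \<otimes>\<^bsub>U A\<^esub> \<one>\<^bsub>U A\<^esub> = x"
proof -
  interpret ring "U A" by (rule ring_U)
  show "\<zero>\<^bsub>U A\<^esub> \<otimes>\<^bsub>U A\<^esub> x = \<zero>\<^bsub>U A\<^esub>" "x \<otimes>\<^bsub>U A\<^esub> \<zero>\<^bsub>U A\<^esub> = \<zero>\<^bsub>U A\<^esub>" "x \<otimes>\<^bsub>U A\<^esub> \<one>\<^bsub>U A\<^esub> = x"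
    using assms by simp_all
qed

definition coord :: "'a ring \<Rightarrow> 'a uring \<Rightarrow> int \<times> 'a" where
  "coord A f = Rep_uring f A"

definition of_coord :: "('a ring \<Rightarrow> int \<times> 'a) \<Rightarrow> 'a uring" where
  "of_coord f = Abs_uring f"

lemma coord_closed [simp]: "coord A f \<in> carrier (U A)"
  using Rep_uring[of f] by (simp add: coord_def)

lemma coord_of_coord: "(\<And>B. f B \<in> carrier (U B)) \<Longrightarrow> coord A (of_coord f) = f A"
  by (simp add: coord_def of_coord_def Abs_uring_inverse)

lemma uring_eqI: "(\<And>A. coord A f = coord A g) \<Longrightarrow> f = g"
  using Rep_uring_inject by (fastforce simp: coord_def fun_eq_iff)

instantiation uring :: (type) ring_1
begin

definition "0 = of_coord (\<lambda>A. \<zero>\<^bsub>U A\<^esub>)"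
definition "1 = of_coord (\<lambda>A. \<one>\<^bsub>U A\<^esub>)"
definition "f + g = of_coord (\<lambda>A. coord A f \<oplus>\<^bsub>U A\<^esub> coord A g)"
definition "f * g = of_coord (\<lambda>A. coord A f \<otimes>\<^bsub>U A\<^esub> coord A g)"
definition "- f = of_coord (\<lambda>A. \<ominus>\<^bsub>U A\<^esub> coord A f)"
definition "(f :: 'a uring) - g = f + - g"

lemma coord_ops:
  "coord A 0 = \<zero>\<^bsub>U A\<^esub>" "coord A 1 = \<one>\<^bsub>U A\<^esub>"
  "coord A (f + g) = coord A f \<oplus>\<^bsub>U A\<^esub> coord A g"
  "coord A (f * g) = coord A f \<otimes>\<^bsub>U A\<^esub> coord A g"
  "coord A (- f) = \<ominus>\<^bsub>U A\<^esub> coord A f"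
  unfolding zero_uring_def one_uring_def plus_uring_def times_uring_def uminus_uring_def
  by (subst coord_of_coord; simp add: ring.ring_simprules[OF ring_U])+

instance
proof
  fix a b c :: "'a uring"
  note r = ring.ring_simprules[OF ring_U] U_null(3)
  show "(0 :: 'a uring) \<noteq> 1"
  proof
    assume "(0 :: 'a uring) = 1"
    then have "fst (coord trivial_ring (0 :: 'a uring)) = fst (coord trivial_ring (1 :: 'a uring))" by simp
    then show False by (simp add: coord_ops unitalization_def)
  qed
  show "a + b + c = a + (b + c)" "a + b = b + a" "0 + a = a" "- a + a = 0" "a - b = a + - b"
    "a * b * c = a * (b * c)" "1 * a = a" "a * 1 = a" "(a + b) * c = a * c + b * c"
    "a * (b + c) = a * b + a * c"
    by (rule uring_eqI, simp add: coord_ops minus_uring_def r; fail)+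
qed

end

text \<open>
  The unital embedding of the unitalization of \<open>A\<close> that keeps the integer part in the other
  coordinates.
\<close>

definition emb :: "'a ring \<Rightarrow> int \<times> 'a \<Rightarrow> 'a uring" where
  "emb A u = of_coord (\<lambda>B. if B = A then u else (fst u, \<zero>\<^bsub>some_ring B\<^esub>))"

definition emb_ideal :: "'a ring \<Rightarrow> 'a uring set" where
  "emb_ideal A = {f. fst (coord A f) = 0 \<and> (\<forall>B. B \<noteq> A \<longrightarrow> coord B f = \<zero>\<^bsub>U B\<^esub>)}"

lemma zero_in_some_ring [simp]: "\<zero>\<^bsub>some_ring B\<^esub> \<in> carrier (some_ring B)"
proof -
  interpret nonunital_ring "some_ring B" by (rule nonunital_some_ring)
  show ?thesis by simp
qed

lemma carrier_U: "carrier (U A) = UNIV \<times> carrier (some_ring A)"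
  by (simp add: unitalization_def)

lemma U_ops:
  "\<zero>\<^bsub>U A\<^esub> = (0, \<zero>\<^bsub>some_ring A\<^esub>)" "\<one>\<^bsub>U A\<^esub> = (1, \<zero>\<^bsub>some_ring A\<^esub>)"
  "fst (x \<oplus>\<^bsub>U A\<^esub> y) = fst x + fst y" "fst (x \<otimes>\<^bsub>U A\<^esub> y) = fst x * fst y"
  by (auto simp: unitalization_def split: prod.splits)

lemma coord_emb:
  assumes "u \<in> carrier (U A)"
  shows "coord B (emb A u) = (if B = A then u else (fst u, \<zero>\<^bsub>some_ring B\<^esub>))"
  unfolding emb_def by (rule coord_of_coord) (use assms in \<open>auto simp: carrier_U\<close>)

lemma emb_inj: "u \<in> carrier (U A) \<Longrightarrow> v \<in> carrier (U A) \<Longrightarrow> emb A u = emb A v \<Longrightarrow> u = v"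
  by (metis coord_emb)

lemma U_const:
  "(k, \<zero>\<^bsub>some_ring B\<^esub>) \<oplus>\<^bsub>U B\<^esub> (l, \<zero>\<^bsub>some_ring B\<^esub>) = (k + l, \<zero>\<^bsub>some_ring B\<^esub>)"
  "(k, \<zero>\<^bsub>some_ring B\<^esub>) \<otimes>\<^bsub>U B\<^esub> (l, \<zero>\<^bsub>some_ring B\<^esub>) = (k * l, \<zero>\<^bsub>some_ring B\<^esub>)"
proof -
  interpret nonunital_ring "some_ring B" by (rule nonunital_some_ring)
  show "(k, \<zero>\<^bsub>some_ring B\<^esub>) \<oplus>\<^bsub>U B\<^esub> (l, \<zero>\<^bsub>some_ring B\<^esub>) = (k + l, \<zero>\<^bsub>some_ring B\<^esub>)"
    "(k, \<zero>\<^bsub>some_ring B\<^esub>) \<otimes>\<^bsub>U B\<^esub> (l, \<zero>\<^bsub>some_ring B\<^esub>) = (k * l, \<zero>\<^bsub>some_ring B\<^esub>)"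
    by (simp_all add: unitalization_def)
qed

lemma emb_add:
  assumes "u \<in> carrier (U A)" "v \<in> carrier (U A)"
  shows "emb A (u \<oplus>\<^bsub>U A\<^esub> v) = emb A u + emb A v"
  by (rule uring_eqI) (simp add: coord_ops coord_emb assms ring.ring_simprules(1)[OF ring_U] U_ops U_const)

lemma emb_mult:
  assumes "u \<in> carrier (U A)" "v \<in> carrier (U A)"
  shows "emb A (u \<otimes>\<^bsub>U A\<^esub> v) = emb A u * emb A v"
  by (rule uring_eqI) (simp add: coord_ops coord_emb assms ring.ring_simprules(5)[OF ring_U] U_ops U_const)

lemma emb_zero: "emb A \<zero>\<^bsub>U A\<^esub> = 0" and emb_one: "emb A \<one>\<^bsub>U A\<^esub> = 1"
  by (rule uring_eqI, simp add: coord_ops coord_emb carrier_U U_ops)+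

lemma two_sided_ideal_emb: "two_sided_ideal (emb_ideal A)"
proof
  fix a b x :: "'a uring"
  note r = ring.ring_simprules[OF ring_U]
  show "0 \<in> emb_ideal A" by (simp add: emb_ideal_def coord_ops U_ops)
  show "a \<in> emb_ideal A \<Longrightarrow> b \<in> emb_ideal A \<Longrightarrow> a + b \<in> emb_ideal A"
    by (auto simp: emb_ideal_def coord_ops U_ops(3) r)
  show "a \<in> emb_ideal A \<Longrightarrow> x * a \<in> emb_ideal A" "a \<in> emb_ideal A \<Longrightarrow> a * x \<in> emb_ideal A"
    by (auto simp: emb_ideal_def coord_ops U_ops(4) U_null)
qed

lemma emb_mem_ideal: "(0, a) \<in> carrier (U A) \<Longrightarrow> emb A (0, a) \<in> emb_ideal A"
  by (simp add: emb_ideal_def coord_emb U_ops)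

lemma emb_coord_ideal:
  assumes "f \<in> emb_ideal A" shows "f = emb A (coord A f)"
  by (rule uring_eqI) (use assms in \<open>auto simp: coord_emb emb_ideal_def U_ops\<close>)

lemma emb_coord_add:
  assumes "f = emb A (coord A f)" "g = emb A (coord A g)"
  shows "f + g = emb A (coord A (f + g))"
  unfolding coord_ops using assms by (simp add: emb_add)

lemma fst_coord_diff: "fst (coord A (f - g)) = fst (coord A f) - fst (coord A g)"
proof -
  have "fst (coord A (f - g + g)) = fst (coord A (f - g)) + fst (coord A g)"
    by (simp only: coord_ops U_ops)
  then show ?thesis by simp
qed

section \<open>General linear groups as groups of linear automorphisms\<close>

definition row_finite :: "'a ring \<Rightarrow> (nat \<Rightarrow> nat \<Rightarrow> int \<times> 'a) set" where
  "row_finite A = {\<alpha>. (\<forall>i j. \<alpha> i j \<in> carrier (U A)) \<and> (\<forall>i. finite {k. \<alpha> i k \<noteq> \<zero>\<^bsub>U A\<^esub>})}"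

definition mat_act :: "'a ring \<Rightarrow> (nat \<Rightarrow> nat \<Rightarrow> int \<times> 'a) \<Rightarrow> (nat \<Rightarrow> 'a uring) \<Rightarrow> nat \<Rightarrow> 'a uring" where
  "mat_act A \<alpha> x i = dot (\<lambda>k. emb A (\<alpha> i k)) x"

lemma U_one_zero [simp]: "\<zero>\<^bsub>U A\<^esub> \<in> carrier (U A)" "\<one>\<^bsub>U A\<^esub> \<in> carrier (U A)" "\<one>\<^bsub>U A\<^esub> \<noteq> \<zero>\<^bsub>U A\<^esub>"
  by (simp_all add: carrier_U U_ops)

lemma emb_eq_0_iff: "u \<in> carrier (U A) \<Longrightarrow> emb A u = 0 \<longleftrightarrow> u = \<zero>\<^bsub>U A\<^esub>"
  using emb_inj[of u A "\<zero>\<^bsub>U A\<^esub>"] by (auto simp: emb_zero)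

lemma row_finiteD:
  assumes "\<alpha> \<in> row_finite A"
  shows "\<alpha> i j \<in> carrier (U A)" "finite {k. emb A (\<alpha> i k) \<noteq> 0}" "finite {k. \<alpha> i k \<noteq> \<zero>\<^bsub>U A\<^esub>}"
  using assms by (simp_all add: row_finite_def emb_eq_0_iff)

lemma mat_act_basis: "\<alpha> \<in> row_finite A \<Longrightarrow> mat_act A \<alpha> (basis j) i = emb A (\<alpha> i j)"
  unfolding mat_act_def by (rule dot_basis) (rule row_finiteD)

lemma mat_act_inj:
  assumes "\<alpha> \<in> row_finite A" "\<beta> \<in> row_finite A" "\<And>j. mat_act A \<alpha> (basis j) = mat_act A \<beta> (basis j)"
  shows "\<alpha> = \<beta>"
proof (intro ext)
  fix i j show "\<alpha> i j = \<beta> i j"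
    using fun_cong[OF assms(3), of j i] emb_inj row_finiteD(1)[OF assms(1)] row_finiteD(1)[OF assms(2)]
    unfolding mat_act_basis[OF assms(1)] mat_act_basis[OF assms(2)] by blast
qed

lemma linear_map_mat_act: "linear_map (mat_act A \<alpha>)"
  by (simp add: linear_map_def mat_act_def dot_add_right dot_scale_right fun_eq_iff)

lemma emb_finsum:
  assumes "finite S" "\<And>k. k \<in> S \<Longrightarrow> f k \<in> carrier (U A)"
  shows "emb A (finsum (U A) f S) = (\<Sum>k\<in>S. emb A (f k)) \<and> finsum (U A) f S \<in> carrier (U A)"
  using assms
proof (induction S rule: finite_induct)
  interpret ring "U A" by (rule ring_U)
  case empty
  show ?case by (simp add: emb_zero)
next
  interpret ring "U A" by (rule ring_U)
  case (insert k S)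
  then have "finsum (U A) f (insert k S) = f k \<oplus>\<^bsub>U A\<^esub> finsum (U A) f S"
    by (intro finsum_insert) auto
  then show ?case using insert by (simp add: emb_add)
qed

lemma matrix_mult_closed:
  assumes "\<alpha> \<in> row_finite A" "\<beta> \<in> row_finite A"
  shows "matrix_mult (U A) \<alpha> \<beta> \<in> row_finite A"
    and "emb A (matrix_mult (U A) \<alpha> \<beta> i j) = (\<Sum>k | \<alpha> i k \<noteq> \<zero>\<^bsub>U A\<^esub>. emb A (\<alpha> i k) * emb A (\<beta> k j))"
proof -
  interpret ring "U A" by (rule ring_U)
  note a = row_finiteD[OF assms(1)] and b = row_finiteD[OF assms(2)]
  have *: "emb A (matrix_mult (U A) \<alpha> \<beta> i j) = (\<Sum>k | \<alpha> i k \<noteq> \<zero>\<^bsub>U A\<^esub>. emb A (\<alpha> i k) * emb A (\<beta> k j)) \<and>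
      matrix_mult (U A) \<alpha> \<beta> i j \<in> carrier (U A)" for i j
    unfolding matrix_mult_def
    using emb_finsum[OF a(3), of i "\<lambda>k. \<alpha> i k \<otimes>\<^bsub>U A\<^esub> \<beta> k j" A] a(1) b(1) by (simp add: emb_mult)
  then show "emb A (matrix_mult (U A) \<alpha> \<beta> i j) = (\<Sum>k | \<alpha> i k \<noteq> \<zero>\<^bsub>U A\<^esub>. emb A (\<alpha> i k) * emb A (\<beta> k j))" by blast
  have "finite {j. matrix_mult (U A) \<alpha> \<beta> i j \<noteq> \<zero>\<^bsub>U A\<^esub>}" for i
  proof (rule finite_subset)
    show "{j. matrix_mult (U A) \<alpha> \<beta> i j \<noteq> \<zero>\<^bsub>U A\<^esub>} \<subseteq> (\<Union>k\<in>{k. \<alpha> i k \<noteq> \<zero>\<^bsub>U A\<^esub>}. {j. \<beta> k j \<noteq> \<zero>\<^bsub>U A\<^esub>})"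
    proof (rule subsetI, rule ccontr)
      fix j assume j: "j \<in> {j. matrix_mult (U A) \<alpha> \<beta> i j \<noteq> \<zero>\<^bsub>U A\<^esub>}"
        and n: "j \<notin> (\<Union>k\<in>{k. \<alpha> i k \<noteq> \<zero>\<^bsub>U A\<^esub>}. {j. \<beta> k j \<noteq> \<zero>\<^bsub>U A\<^esub>})"
      have "emb A (matrix_mult (U A) \<alpha> \<beta> i j) = 0"
        using * n by (auto intro!: sum.neutral simp: emb_zero)
      then show False using j * emb_eq_0_iff by blast
    qed
    show "finite (\<Union>k\<in>{k. \<alpha> i k \<noteq> \<zero>\<^bsub>U A\<^esub>}. {j. \<beta> k j \<noteq> \<zero>\<^bsub>U A\<^esub>})"
      using a(3) b(3) by auto
  qed
  then show "matrix_mult (U A) \<alpha> \<beta> \<in> row_finite A" using * by (simp add: row_finite_def)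
qed

lemma dot_dot:
  assumes r: "finite {k. r k \<noteq> 0}" and s: "\<And>k. finite {j. s k j \<noteq> 0}"
  shows "dot r (\<lambda>k. dot (s k) x) = dot (\<lambda>j. \<Sum>k | r k \<noteq> 0. r k * s k j) x"
proof -
  let ?K = "{k. r k \<noteq> 0}" and ?L = "\<Union>k\<in>{k. r k \<noteq> 0}. {j. s k j \<noteq> 0}"
  have L: "finite ?L" using r s by auto
  have "dot r (\<lambda>k. dot (s k) x) = (\<Sum>k\<in>?K. r k * (\<Sum>j\<in>?L. s k j * x j))"
    unfolding dot_def[of r] by (rule sum.cong[OF refl], subst dot_eq_sum[OF L]) auto
  also have "\<dots> = (\<Sum>k\<in>?K. \<Sum>j\<in>?L. r k * s k j * x j)"
    by (simp add: sum_distrib_left mult.assoc)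
  also have "\<dots> = (\<Sum>j\<in>?L. (\<Sum>k\<in>?K. r k * s k j) * x j)"
    unfolding sum_distrib_right by (rule sum.swap)
  also have "\<dots> = dot (\<lambda>j. \<Sum>k\<in>?K. r k * s k j) x"
    by (rule dot_eq_sum[symmetric, OF L]) (auto intro!: sum.neutral)
  finally show ?thesis .
qed

lemma mat_act_mult:
  assumes a: "\<alpha> \<in> row_finite A" and b: "\<beta> \<in> row_finite A"
  shows "mat_act A (matrix_mult (U A) \<alpha> \<beta>) = mat_act A \<alpha> \<circ> mat_act A \<beta>"
proof (intro ext)
  fix x i
  have "(mat_act A \<alpha> \<circ> mat_act A \<beta>) x i = dot (\<lambda>k. emb A (\<alpha> i k)) (\<lambda>k. dot (\<lambda>j. emb A (\<beta> k j)) x)"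
    by (simp add: mat_act_def[abs_def])
  also have "\<dots> = dot (\<lambda>j. \<Sum>k | emb A (\<alpha> i k) \<noteq> 0. emb A (\<alpha> i k) * emb A (\<beta> k j)) x"
    by (rule dot_dot) (rule row_finiteD(2)[OF a], rule row_finiteD(2)[OF b])
  also have "{k. emb A (\<alpha> i k) \<noteq> 0} = {k. \<alpha> i k \<noteq> \<zero>\<^bsub>U A\<^esub>}"
    using row_finiteD(1)[OF a] by (simp add: emb_eq_0_iff)
  finally show "mat_act A (matrix_mult (U A) \<alpha> \<beta>) x i = (mat_act A \<alpha> \<circ> mat_act A \<beta>) x i"
    by (simp add: mat_act_def[abs_def] matrix_mult_closed(2)[OF a b])
qed

lemma id_matrix_row_finite: "id_matrix (U A) \<in> row_finite A"
  by (auto simp: row_finite_def id_matrix_def)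

lemma mat_act_id: "mat_act A (id_matrix (U A)) = id"
proof (intro ext)
  fix x :: "nat \<Rightarrow> 'a uring" and i
  have "(\<lambda>k. emb A (id_matrix (U A) i k)) = (\<lambda>k. if k = i then 1 else 0)"
    by (auto simp: id_matrix_def emb_zero emb_one fun_eq_iff)
  then show "mat_act A (id_matrix (U A)) x i = id x i" by (simp add: mat_act_def dot_single)
qed

lemma matrix_monoid_row_finite: "\<alpha> \<in> carrier (matrix_monoid n (U A)) \<Longrightarrow> \<alpha> \<in> row_finite A"
proof -
  assume a: "\<alpha> \<in> carrier (matrix_monoid n (U A))"
  have "finite {k. \<alpha> i k \<noteq> \<zero>\<^bsub>U A\<^esub>}" for i
    by (rule finite_subset[of _ "insert i {..<n}"])
       (use a in \<open>auto simp: matrix_monoid_def id_matrix_def split: if_splits\<close>)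
  then show ?thesis using a by (simp add: row_finite_def matrix_monoid_def)
qed

lemma matrix_monoid_supported:
  assumes a: "\<alpha> \<in> carrier (matrix_monoid n (U A))"
  shows "supported {..<n} (mat_act A \<alpha>)"
  unfolding supported_def
proof (intro conjI allI impI)
  fix x :: "nat \<Rightarrow> 'a uring" and i assume "i \<notin> {..<n}"
  then have "(\<lambda>k. emb A (\<alpha> i k)) = (\<lambda>k. if k = i then 1 else 0)"
    using a by (auto simp: matrix_monoid_def id_matrix_def emb_zero emb_one fun_eq_iff)
  then show "mat_act A \<alpha> x i = x i" by (simp add: mat_act_def dot_single)
next
  fix x :: "nat \<Rightarrow> 'a uring" assume x: "\<forall>i\<in>{..<n}. x i = 0"
  have "mat_act A \<alpha> x i = x i" for i
  proof (cases "i < n")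
    case True
    have "dot (\<lambda>k. emb A (\<alpha> i k)) x = 0"
      unfolding dot_def
    proof (rule sum.neutral, clarify)
      fix k assume "emb A (\<alpha> i k) \<noteq> 0"
      moreover have "\<alpha> i k = \<zero>\<^bsub>U A\<^esub>" if "\<not> k < n"
        using a True that by (auto simp: matrix_monoid_def id_matrix_def)
      ultimately have "k < n" using emb_zero by metis
      then show "emb A (\<alpha> i k) * x k = 0" using x by simp
    qed
    then show ?thesis using x True by (simp add: mat_act_def)
  next
    case False
    then have "(\<lambda>k. emb A (\<alpha> i k)) = (\<lambda>k. if k = i then 1 else 0)"
      using a by (auto simp: matrix_monoid_def id_matrix_def emb_zero emb_one fun_eq_iff)
    then show ?thesis by (simp add: mat_act_def dot_single)
  qed
  then show "mat_act A \<alpha> x = x" by (rule ext)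
qed

abbreviation GLJ :: "'a ring \<Rightarrow> nat set \<Rightarrow> ((nat \<Rightarrow> 'a uring) \<Rightarrow> nat \<Rightarrow> 'a uring) set" where
  "GLJ A \<equiv> two_sided_ideal.GL_rel (emb_ideal A)"

lemma emb_diff_basis:
  assumes u: "u \<in> carrier (U A)"
  shows "emb A u - basis j i \<in> emb_ideal A \<longleftrightarrow> fst u = (if i = j then 1 else 0)"
proof -
  have "fst (coord A (emb A u - basis j i)) = fst u - (if i = j then 1 else 0)"
    by (simp add: fst_coord_diff coord_emb u basis_def coord_ops U_ops)
  moreover have "coord B (emb A u - basis j i) = \<zero>\<^bsub>U B\<^esub>" if "fst u = (if i = j then 1 else 0)" "B \<noteq> A" for B
  proof -
    have "coord B (emb A u) = coord B (basis j i)"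
      using that by (simp add: coord_emb u basis_def coord_ops U_ops)
    then have "coord B (emb A u - basis j i) = coord B (basis j i - basis j i)"
      by (simp only: diff_conv_add_uminus coord_ops)
    then show ?thesis by (simp add: coord_ops)
  qed
  ultimately show ?thesis by (auto simp: emb_ideal_def)
qed

lemma coord_emb_basis:
  assumes "f - basis j i \<in> emb_ideal A" shows "emb A (coord A f) = f"
proof -
  have b: "(basis j i :: 'a uring) = emb A (coord A (basis j i))"
  proof (cases "i = j")
    case True
    then show ?thesis by (simp add: coord_ops emb_one)
  next
    case False
    then show ?thesis by (simp add: basis_other coord_ops emb_zero)
  qed
  have "f - basis j i + basis j i = emb A (coord A (f - basis j i + basis j i))"
    by (rule emb_coord_add[OF emb_coord_ideal[OF assms] b])
  then show ?thesis by simp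
qed

lemma mat_act_surj:
  assumes T: "T \<in> GLJ A {..<n}"
  shows "\<exists>\<alpha>\<in>row_finite A. mat_act A \<alpha> = T"
proof
  interpret J: two_sided_ideal "emb_ideal A" by (rule two_sided_ideal_emb)
  note TA = J.GL_rel_Aut[OF T]
  define \<alpha> where "\<alpha> i j = coord A (T (basis j) i)" for i j
  have e: "emb A (\<alpha> i j) = T (basis j) i" for i j
    unfolding \<alpha>_def by (rule coord_emb_basis[OF J.GL_rel_cong[OF T]])
  have c: "\<alpha> i j \<in> carrier (U A)" for i j by (simp add: \<alpha>_def)
  have "finite {k. \<alpha> i k \<noteq> \<zero>\<^bsub>U A\<^esub>}" for i
    using Aut_row_support[OF TA, of i] by (simp add: e[symmetric] emb_eq_0_iff c)
  then show "\<alpha> \<in> row_finite A" using c by (simp add: row_finite_def)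
  show "mat_act A \<alpha> = T"
  proof (intro ext)
    fix x i show "mat_act A \<alpha> x i = T x i"
      unfolding mat_act_def e using Aut_row[OF TA, of x i] by simp
  qed
qed

lemma carrier_GL_iff:
  assumes N: "nonunital_ring A"
  shows "\<alpha> \<in> carrier (GL n A) \<longleftrightarrow> \<alpha> \<in> carrier (matrix_monoid n (U A)) \<and>
      (\<exists>\<beta>\<in>carrier (matrix_monoid n (U A)). matrix_mult (U A) \<beta> \<alpha> = id_matrix (U A) \<and>
          matrix_mult (U A) \<alpha> \<beta> = id_matrix (U A)) \<and>
      (\<forall>i j. fst (\<alpha> i j) = (if i = j then 1 else 0))"
proof -
  have UA: "unitalization A = U A" using N by simp
  show ?thesis
    unfolding GL_def UA
    by (auto simp: kernel_def unital_GL_def units_of_def Units_def matrix_monoid_def matrix_map_def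
        id_matrix_def fun_eq_iff)
qed

lemma carrier_GL:
  assumes N: "nonunital_ring A"
  shows "carrier (GL n A) = {\<alpha> \<in> row_finite A. mat_act A \<alpha> \<in> GLJ A {..<n}}"
proof -
  interpret J: two_sided_ideal "emb_ideal A" by (rule two_sided_ideal_emb)
  note car = carrier_GL_iff[OF N]
  show ?thesis
  proof (intro equalityI subsetI)
    fix \<alpha> assume "\<alpha> \<in> carrier (GL n A)"
    then obtain \<beta> where a: "\<alpha> \<in> carrier (matrix_monoid n (U A))" and b: "\<beta> \<in> carrier (matrix_monoid n (U A))"
      and ab: "matrix_mult (U A) \<beta> \<alpha> = id_matrix (U A)" "matrix_mult (U A) \<alpha> \<beta> = id_matrix (U A)"
      and f: "\<And>i j. fst (\<alpha> i j) = (if i = j then 1 else 0)"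
      unfolding car by blast
    note ra = matrix_monoid_row_finite[OF a] and rb = matrix_monoid_row_finite[OF b]
    have "mat_act A \<alpha> \<circ> mat_act A \<beta> = id" "mat_act A \<beta> \<circ> mat_act A \<alpha> = id"
      using mat_act_mult[OF ra rb] mat_act_mult[OF rb ra] ab by (simp_all add: mat_act_id)
    then have "bij (mat_act A \<alpha>)" using bij_of_inverse by blast
    moreover have "mat_act A \<alpha> x i - x i \<in> emb_ideal A" for x i
    proof -
      have fin: "finite {k. emb A (\<alpha> i k) \<noteq> 0}" "finite {k. - basis i k \<noteq> (0 :: 'a uring)}"
        using row_finiteD(2)[OF ra] by (auto simp: basis_def)
      have "mat_act A \<alpha> x i - x i = dot (\<lambda>k. emb A (\<alpha> i k) + - basis i k) x"
        unfolding dot_add_left[OF fin] dot_uminus_left by (simp add: mat_act_def basis_def dot_single)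
      moreover have "dot (\<lambda>k. emb A (\<alpha> i k) + - basis i k) x \<in> emb_ideal A"
        unfolding dot_def
        by (intro J.sum_mem J.mult_right_mem)
           (simp add: emb_diff_basis[OF row_finiteD(1)[OF ra]] f)
      ultimately show ?thesis by simp
    qed
    ultimately show "\<alpha> \<in> {\<alpha> \<in> row_finite A. mat_act A \<alpha> \<in> GLJ A {..<n}}"
      using ra matrix_monoid_supported[OF a] linear_map_mat_act by (simp add: J.GL_rel_def Aut_def)
  next
    fix \<alpha> assume "\<alpha> \<in> {\<alpha> \<in> row_finite A. mat_act A \<alpha> \<in> GLJ A {..<n}}"
    then have ra: "\<alpha> \<in> row_finite A" and ga: "mat_act A \<alpha> \<in> GLJ A {..<n}" by auto
    obtain \<beta> where rb: "\<beta> \<in> row_finite A" and lb: "mat_act A \<beta> = inv_map (mat_act A \<alpha>)"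
      using mat_act_surj[OF J.GL_rel_inv[OF ga]] by blast
    then have gb: "mat_act A \<beta> \<in> GLJ A {..<n}" using J.GL_rel_inv[OF ga] by simp
    have mm: "\<gamma> \<in> carrier (matrix_monoid n (U A))" if r: "\<gamma> \<in> row_finite A" and g: "mat_act A \<gamma> \<in> GLJ A {..<n}" for \<gamma>
    proof -
      note gA = J.GL_rel_Aut[OF g]
      have "\<gamma> i j = id_matrix (U A) i j" if "\<not> (i < n \<and> j < n)" for i j
      proof -
        have "mat_act A \<gamma> (basis j) i = basis j i"
          using that Aut_outside[OF gA, of i "basis j"] Aut_basis[OF gA, of j] by auto
        then have "emb A (\<gamma> i j) = emb A (id_matrix (U A) i j)"
          unfolding mat_act_basis[OF r] by (simp add: id_matrix_def basis_def emb_one emb_zero)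
        then show ?thesis
          using emb_inj row_finiteD(1)[OF r] row_finiteD(1)[OF id_matrix_row_finite] by blast
      qed
      then show ?thesis using row_finiteD(1)[OF r] by (simp add: matrix_monoid_def)
    qed
    note bij = J.GL_rel_bij[OF ga]
    have "matrix_mult (U A) \<alpha> \<beta> = id_matrix (U A)"
      by (rule mat_act_inj[of _ A]) (simp_all add: matrix_mult_closed id_matrix_row_finite ra rb mat_act_mult mat_act_id lb
          inv_comp_cancel[OF bij])
    moreover have "matrix_mult (U A) \<beta> \<alpha> = id_matrix (U A)"
      by (rule mat_act_inj[of _ A]) (simp_all add: matrix_mult_closed id_matrix_row_finite ra rb mat_act_mult mat_act_id lb
          inv_comp_cancel[OF bij])
    moreover have "fst (\<alpha> i j) = (if i = j then 1 else 0)" for i j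
      using J.GL_rel_cong[OF ga, of "basis j" i] emb_diff_basis[OF row_finiteD(1)[OF ra]]
      unfolding mat_act_basis[OF ra] by blast
    ultimately show "\<alpha> \<in> carrier (GL n A)"
      unfolding car using mm[OF ra ga] mm[OF rb gb] by blast
  qed
qed

lemma coord_sum_cong:
  "(\<And>i. i \<in> S \<Longrightarrow> coord A (f i) = coord A (g i)) \<Longrightarrow> coord A (sum f S) = coord A (sum g S)"
  by (induction S rule: infinite_finite_induct) (simp_all add: coord_ops)

lemma coord_ideal_other: "f - g \<in> emb_ideal A \<Longrightarrow> B \<noteq> A \<Longrightarrow> coord B f = coord B g"
proof -
  assume a: "f - g \<in> emb_ideal A" "B \<noteq> A"
  have "coord B f = coord B ((f - g) + g)" by simp
  also have "\<dots> = coord B (f - g) \<oplus>\<^bsub>U B\<^esub> coord B g" by (simp only: coord_ops)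
  also have "\<dots> = coord B g" using a by (simp add: emb_ideal_def ring.ring_simprules(8)[OF ring_U])
  finally show ?thesis .
qed

text \<open>
  In the coordinate \<open>A\<close> this is the condition on \<open>A\<close>.  In every other coordinate the column is a standard
  basis vector and stays one.
\<close>

lemma stable_range_emb:
  assumes N: "nonunital_ring A" and sr: "stable_range_condition n A" and n: "1 \<le> n"
  shows "two_sided_ideal.stable_range_at (emb_ideal A) n"
proof -
  interpret J: two_sided_ideal "emb_ideal A" by (rule two_sided_ideal_emb)
  have UA: "unitalization A = U A" using N by simp
  interpret R: ring "U A" by (rule ring_U)
  have aug: "augmentation_ideal A = {u \<in> carrier (U A). fst u = 0}"
    using N by (auto simp: augmentation_ideal_def unitalization_def)
  show ?thesis
    unfolding J.stable_range_at_def
  proof (intro allI impI, elim conjE)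
    fix I :: "nat set" and i\<^sub>0 and c :: "nat \<Rightarrow> 'a uring" and b
    assume I: "finite I" "card I = n" "i\<^sub>0 \<in> I" and c0: "c i\<^sub>0 - 1 \<in> emb_ideal A"
      and c: "\<forall>i\<in>I - {i\<^sub>0}. c i \<in> emb_ideal A" and b: "b \<in> emb_ideal A"
      and "\<exists>d e. (\<Sum>i\<in>I. d i * c i) + e * b = 1"
    then obtain d e where de: "(\<Sum>i\<in>I. d i * c i) + e * b = 1" by blast
    have "card {2..n} = card (I - {i\<^sub>0})" using I n by simp
    then obtain g where g: "bij_betw g {2..n} (I - {i\<^sub>0})"
      using finite_same_card_bij[of "{2..n}" "I - {i\<^sub>0}"] I(1) by auto
    define h where "h j = (if j = 1 then i\<^sub>0 else g j)" for j
    have "bij_betw h ({1} \<union> {2..n}) ({i\<^sub>0} \<union> (I - {i\<^sub>0}))"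
    proof (rule bij_betw_combine)
      show "bij_betw h {2..n} (I - {i\<^sub>0})"
        by (rule bij_betw_cong[THEN iffD1, OF _ g]) (auto simp: h_def)
    qed (auto simp: h_def bij_betw_def)
    moreover have "{1} \<union> {2..n} = {1..n}" "{i\<^sub>0} \<union> (I - {i\<^sub>0}) = I" using n I by auto
    ultimately have h: "bij_betw h {1..n} I" by simp
    have hI: "h j \<in> I" if "j \<in> {1..n}" for j using h that by (auto simp: bij_betw_def)
    have h0: "h j \<noteq> i\<^sub>0" if "j \<in> {2..n}" for j
      using g that by (auto simp: h_def bij_betw_def)
    define k where "k = inv_into {1..n} h"
    have kh: "k (h j) = j" if "j \<in> {1..n}" for j
      unfolding k_def using h that by (simp add: bij_betw_inv_into_left)
    have hk: "h (k i) = i" "k i \<in> {1..n}" if "i \<in> I" for i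
      unfolding k_def using h that by (auto simp: bij_betw_inv_into_right) (metis bij_betw_def inv_into_into atLeastAtMost_iff)+
    define a where "a j = (if j = n + 1 then coord A b else coord A (c (h j)))" for j
    have "\<exists>cc. (\<forall>i\<in>{1..n}. cc i \<in> augmentation_ideal A) \<and>
             generated_left_ideal (U A) ((\<lambda>i. a i \<oplus>\<^bsub>U A\<^esub> cc i \<otimes>\<^bsub>U A\<^esub> a (n + 1)) ` {1..n}) = carrier (U A)"
    proof (rule sr[unfolded stable_range_condition_def Let_def UA, rule_format], intro conjI ballI)
      show "a i \<in> carrier (U A)" for i by (simp add: a_def)
      have "fst (coord A (c i\<^sub>0 - 1)) = 0" using c0 by (simp add: emb_ideal_def)
      moreover have "a 1 \<ominus>\<^bsub>U A\<^esub> \<one>\<^bsub>U A\<^esub> = coord A (c i\<^sub>0 - 1)"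
      proof -
        have "coord A (c i\<^sub>0 - 1) = coord A (c i\<^sub>0) \<ominus>\<^bsub>U A\<^esub> \<one>\<^bsub>U A\<^esub>"
          by (simp only: diff_conv_add_uminus coord_ops a_minus_def)
        then show ?thesis using n by (simp add: a_def h_def)
      qed
      ultimately show "a 1 \<ominus>\<^bsub>U A\<^esub> \<one>\<^bsub>U A\<^esub> \<in> augmentation_ideal A" by (simp add: aug)
      show "a i \<in> augmentation_ideal A" if "i \<in> {2..n + 1}" for i
      proof (cases "i = n + 1")
        case True then show ?thesis using b by (simp add: a_def aug emb_ideal_def)
      next
        case False
        then have "h i \<in> I - {i\<^sub>0}" using that h0[of i] hI[of i] by auto
        then show ?thesis using c False by (auto simp: a_def aug emb_ideal_def)
      qed
      show "generated_left_ideal (U A) (a ` {1..n + 1}) = carrier (U A)"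
      proof
        have "subgroup (carrier (U A)) (add_monoid (U A))"
          using group.subgroup_self[OF R.a_group] by simp
        then have "left_ideal (carrier (U A)) (U A)"
          by (intro left_ideal.intro additive_subgroup.intro left_ideal_axioms.intro) auto
        moreover have "a ` {1..n + 1} \<subseteq> carrier (U A)" by (simp add: a_def image_subset_iff)
        ultimately show "generated_left_ideal (U A) (a ` {1..n + 1}) \<subseteq> carrier (U A)"
          unfolding generated_left_ideal_def by blast
        show "carrier (U A) \<subseteq> generated_left_ideal (U A) (a ` {1..n + 1})"
          unfolding generated_left_ideal_def
        proof (rule Inter_greatest, clarify)
          fix L x y assume L: "left_ideal L (U A)" "a ` {1..n + 1} \<subseteq> L" and x: "(x, y) \<in> carrier (U A)"
          interpret L: left_ideal L "U A" by (rule L(1))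
          have "coord A (\<Sum>i\<in>S. d i * c i) \<in> L" if "finite S" "S \<subseteq> I" for S
            using that
          proof (induction S rule: finite_induct)
            case empty then show ?case by (simp add: coord_ops)
          next
            case (insert i S)
            have "coord A (c i) = a (k i)" using hk[of i] insert by (auto simp: a_def)
            moreover have "a (k i) \<in> L" using L(2) hk[of i] insert by auto
            ultimately show ?case using insert by (simp add: coord_ops L.left_mult_closed L.a_closed)
          qed
          moreover have "coord A b \<in> L" using L(2) by (force simp: a_def)
          ultimately have "coord A ((\<Sum>i\<in>I. d i * c i) + e * b) \<in> L"
            using I by (simp add: coord_ops L.left_mult_closed L.a_closed)
          then have "\<one>\<^bsub>U A\<^esub> \<in> L" unfolding de by (simp add: coord_ops)
          then show "(x, y) \<in> L" using L.left_mult_closed[OF _ x] x by (metis R.r_one)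
        qed
      qed
    qed
    then obtain cc where cc: "\<And>i. i \<in> {1..n} \<Longrightarrow> cc i \<in> augmentation_ideal A"
      and gen: "generated_left_ideal (U A) ((\<lambda>i. a i \<oplus>\<^bsub>U A\<^esub> cc i \<otimes>\<^bsub>U A\<^esub> a (n + 1)) ` {1..n}) = carrier (U A)"
      by blast
    define t where "t i = (if i \<in> I then emb A (cc (k i)) else 0)" for i
    have ccU: "cc (k i) \<in> carrier (U A)" "fst (cc (k i)) = 0" if "i \<in> I" for i
      using cc[OF hk(2)[OF that]] by (auto simp: aug)
    have t: "t i \<in> emb_ideal A" for i
      using ccU[of i] emb_mem_ideal[of "snd (cc (k i))" A] J.zero_mem unfolding t_def
      by (metis prod.collapse)
    define y where "y i = c i + t i * b" for i
    have coord_y: "coord A (y (h j)) = a j \<oplus>\<^bsub>U A\<^esub> cc j \<otimes>\<^bsub>U A\<^esub> a (n + 1)" if "j \<in> {1..n}" for j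
      using that hI[OF that] kh[OF that] ccU(1)[OF hI[OF that]]
      by (simp add: y_def t_def coord_ops coord_emb a_def)
    define L where "L = {coord A (\<Sum>i\<in>I. d i * y i) | d. True}"
    have LI: "coord A (\<Sum>i\<in>I. d i * y i) \<in> L" for d by (auto simp: L_def)
    have "left_ideal L (U A)"
    proof (intro left_ideal.intro additive_subgroup.intro left_ideal_axioms.intro subgroup.intro)
      show "L \<subseteq> carrier (add_monoid (U A))" by (auto simp: L_def)
      show "\<one>\<^bsub>add_monoid (U A)\<^esub> \<in> L" using LI[of "\<lambda>_. 0"] by (simp add: coord_ops)
      show "u \<otimes>\<^bsub>add_monoid (U A)\<^esub> v \<in> L" if uv: "u \<in> L" "v \<in> L" for u v
      proof -
        obtain d d' where "u = coord A (\<Sum>i\<in>I. d i * y i)" "v = coord A (\<Sum>i\<in>I. d' i * y i)"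
          using uv by (auto simp: L_def)
        then have "u \<otimes>\<^bsub>add_monoid (U A)\<^esub> v = coord A (\<Sum>i\<in>I. (d i + d' i) * y i)"
          by (simp add: coord_ops(3)[symmetric] distrib_right sum.distrib)
        then show ?thesis using LI[of "\<lambda>i. d i + d' i"] by simp
      qed
      show "inv\<^bsub>add_monoid (U A)\<^esub> u \<in> L" if u: "u \<in> L" for u
      proof -
        obtain d where "u = coord A (\<Sum>i\<in>I. d i * y i)" using u by (auto simp: L_def)
        then have "\<ominus>\<^bsub>U A\<^esub> u = coord A (\<Sum>i\<in>I. (- d i) * y i)"
          by (simp add: coord_ops(5)[symmetric] sum_negf)
        then show ?thesis using LI[of "\<lambda>i. - d i"] by (simp add: a_inv_def)
      qed
      show "x \<otimes>\<^bsub>U A\<^esub> u \<in> L" if u: "u \<in> L" and x: "x \<in> carrier (U A)" for u x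
      proof -
        obtain d where "u = coord A (\<Sum>i\<in>I. d i * y i)" using u by (auto simp: L_def)
        then have "x \<otimes>\<^bsub>U A\<^esub> u = coord A (emb A x * (\<Sum>i\<in>I. d i * y i))"
          using x by (simp add: coord_ops coord_emb)
        also have "\<dots> = coord A (\<Sum>i\<in>I. (emb A x * d i) * y i)"
          by (simp add: sum_distrib_left mult.assoc)
        finally show ?thesis using LI[of "\<lambda>i. emb A x * d i"] by simp
      qed
    qed
    moreover have "(\<lambda>i. a i \<oplus>\<^bsub>U A\<^esub> cc i \<otimes>\<^bsub>U A\<^esub> a (n + 1)) ` {1..n} \<subseteq> L"
    proof (rule image_subsetI)
      fix j assume j: "j \<in> {1..n}"
      have "(\<Sum>i\<in>I. (if i = h j then 1 else 0) * y i) = (\<Sum>i\<in>I. if i = h j then y i else 0)"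
        by (rule sum.cong) auto
      also have "\<dots> = y (h j)" using I hI[OF j] by simp
      finally show "a j \<oplus>\<^bsub>U A\<^esub> cc j \<otimes>\<^bsub>U A\<^esub> a (n + 1) \<in> L"
        using LI[of "\<lambda>i. if i = h j then 1 else 0"] coord_y[OF j] by simp
    qed
    ultimately have "carrier (U A) \<subseteq> L"
      unfolding gen[symmetric] generated_left_ideal_def by blast
    then have "\<one>\<^bsub>U A\<^esub> \<in> L" by blast
    then obtain d where d: "coord A (\<Sum>i\<in>I. d i * y i) = \<one>\<^bsub>U A\<^esub>" by (auto simp: L_def)
    (* The coefficient 1 serves in the coordinates other than A, where the column is a basis vector. *)
    define d' where "d' i = of_coord (\<lambda>B. if B = A then coord A (d i) else \<one>\<^bsub>U B\<^esub>)" for i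
    have d': "coord B (d' i) = (if B = A then coord A (d i) else \<one>\<^bsub>U B\<^esub>)" for B i
      unfolding d'_def using coord_closed by (subst coord_of_coord) (auto simp: R.one_closed ring.ring_simprules(6)[OF ring_U])
    have "(\<Sum>i\<in>I. d' i * y i) = 1"
    proof (rule uring_eqI)
      fix B
      show "coord B (\<Sum>i\<in>I. d' i * y i) = coord B 1"
      proof (cases "B = A")
        case True
        have "coord A (\<Sum>i\<in>I. d' i * y i) = coord A (\<Sum>i\<in>I. d i * y i)"
          by (rule coord_sum_cong) (simp add: coord_ops d')
        then show ?thesis using d True by (simp add: coord_ops)
      next
        case False
        have "coord B (d' i * y i) = coord B (if i = i\<^sub>0 then 1 else 0)" if i: "i \<in> I" for i
        proof -
          have "coord B (d' i * y i) = coord B (y i)"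
            using False by (simp add: coord_ops d' ring.ring_simprules(12)[OF ring_U])
          moreover have "coord B (t i * b) = coord B 0"
            using b False by (simp add: coord_ops emb_ideal_def U_null)
          then have "coord B (y i) = coord B (c i + 0)"
            unfolding y_def coord_ops(3) by (simp only:)
          then have "coord B (y i) = coord B (c i)" by simp
          moreover have "coord B (c i) = coord B (if i = i\<^sub>0 then 1 else 0)"
            using coord_ideal_other[OF c0 False] c i False by (auto simp: emb_ideal_def coord_ops)
          ultimately show ?thesis by simp
        qed
        then have "coord B (\<Sum>i\<in>I. d' i * y i) = coord B (\<Sum>i\<in>I. if i = i\<^sub>0 then 1 else 0)"
          by (rule coord_sum_cong)
        also have "(\<Sum>i\<in>I. if i = i\<^sub>0 then 1 else 0) = (1 :: 'a uring)" using I by simp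
        finally show ?thesis .
      qed
    qed
    then show "\<exists>t. (\<forall>i. t i \<in> emb_ideal A) \<and> unimodular I (\<lambda>i. c i + t i * b)"
      using t unfolding y_def unimodular_def by blast
  qed
qed

section \<open>First homology and commutators\<close>

lemma bar_face_sum_1: "bar_face_sum G [g] = 0"
  by (simp add: bar_face_sum_def)

lemma bar_face_sum_2: "bar_face_sum G [g, h] = frag_of [h] - frag_of [g \<otimes>\<^bsub>G\<^esub> h] + frag_of [g]"
  by (simp add: bar_face_sum_def)

abbreviation letters :: "'g monoid \<Rightarrow> 'g list set" where
  "letters G \<equiv> (\<lambda>g. [g]) ` carrier G"

abbreviation letter_pairs :: "'g monoid \<Rightarrow> 'g list set" where
  "letter_pairs G \<equiv> (\<lambda>(g, h). [g, h]) ` (carrier G \<times> carrier G)"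

lemma words_eq:
  "{gs. length gs = 1 \<and> set gs \<subseteq> carrier G} = letters G"
  "{gs. length gs = Suc 1 \<and> set gs \<subseteq> carrier G} = letter_pairs G"
  by (auto simp: length_Suc_conv)

text \<open>
  The two faces of a letter agree, so that every \<open>1\<close>-chain is a cycle.
\<close>

lemma bar_cycles_1: "bar_cycles 1 G = free_Abelian_group (letters G)"
proof -
  have "bar_differential G c = 0" if "c \<in> carrier (bar_chains 1 G)" for c
  proof -
    have k: "Poly_Mapping.keys c \<subseteq> letters G"
      using that unfolding bar_chains_def words_eq by simp
    then have "\<And>x. x \<in> Poly_Mapping.keys c \<Longrightarrow> bar_face_sum G x = 0"
      using bar_face_sum_1 by fastforce
    then show ?thesis unfolding bar_differential_def frag_extend_def
      by (intro sum.neutral) simp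
  qed
  then have "carrier (bar_cycles 1 G) = carrier (bar_chains 1 G)" by (auto simp: bar_cycles_def)
  then have "bar_cycles 1 G = bar_chains 1 G" by (simp add: bar_cycles_def)
  then show ?thesis by (simp only: bar_chains_def words_eq)
qed

text \<open>
  The name recalls that these are generated by \<open>[h] - [g h] + [g]\<close>.
\<close>

definition relators :: "'g monoid \<Rightarrow> ('g list \<Rightarrow>\<^sub>0 int) set" where
  "relators G = bar_boundaries 1 G"

lemma relators_eq: "relators G = bar_differential G ` {c. Poly_Mapping.keys c \<subseteq> letter_pairs G}"
  unfolding relators_def bar_boundaries_def bar_chains_def words_eq by (simp add: free_Abelian_group_def)

definition bar_class :: "'g monoid \<Rightarrow> 'g \<Rightarrow> ('g list \<Rightarrow>\<^sub>0 int) set" where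
  "bar_class G g = relators G #>\<^bsub>free_Abelian_group (letters G)\<^esub> frag_of [g]"

locale bar_group = group G for G :: "'g monoid" (structure)
begin

abbreviation Z where "Z \<equiv> free_Abelian_group (letters G)"
abbreviation B where "B \<equiv> relators G"
abbreviation H1 where "H1 \<equiv> Z Mod B"

lemma H1_eq: "group_homology 1 G = H1"
  by (simp only: group_homology_def bar_cycles_1 relators_def)

lemma comm_Z: "comm_group Z"
  by (rule abelian_free_Abelian_group)

lemma differential_2_closed:
  assumes "Poly_Mapping.keys c \<subseteq> letter_pairs G"
  shows "bar_differential G c \<in> carrier Z"
  using assms
proof (induction c rule: frag_induction)
  case zero
  show ?case by (simp add: bar_differential_def)
next
  case (one x)
  then obtain g h where gh: "x = [g, h]" "g \<in> carrier G" "h \<in> carrier G" by auto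
  then have "frag_of [h] - frag_of [g \<otimes> h] + frag_of [g] \<in> carrier Z"
    using keys_add[of "frag_of [h] - frag_of [g \<otimes> h]" "frag_of [g]"]
      keys_diff[of "frag_of [h]" "frag_of [g \<otimes> h]"] by (auto simp: subset_iff)
  then show ?case by (simp add: bar_differential_def gh bar_face_sum_2)
next
  case (diff a b)
  then show ?case unfolding bar_differential_def frag_extend_diff carrier_free_Abelian_group_iff
    by (intro subset_trans[OF keys_diff] Un_least)
qed

lemma B_subgroup: "subgroup B Z"
proof (rule subgroup.intro)
  have BI: "bar_differential G c \<in> B" if "Poly_Mapping.keys c \<subseteq> letter_pairs G" for c
    unfolding relators_eq using that by blast
  have BE: "\<exists>c. x = bar_differential G c \<and> Poly_Mapping.keys c \<subseteq> letter_pairs G" if "x \<in> B" for x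
    using that unfolding relators_eq by blast
  show sub: "B \<subseteq> carrier Z"
    using BE differential_2_closed by blast
  show "x \<otimes>\<^bsub>Z\<^esub> y \<in> B" if xy: "x \<in> B" "y \<in> B" for x y
  proof -
    obtain c d where "x = bar_differential G c" "Poly_Mapping.keys c \<subseteq> letter_pairs G"
      "y = bar_differential G d" "Poly_Mapping.keys d \<subseteq> letter_pairs G"
      using BE xy by metis
    moreover from this have "Poly_Mapping.keys (c + d) \<subseteq> letter_pairs G" using keys_add[of c d] by blast
    ultimately show ?thesis
      using BI[of "c + d"] by (simp add: bar_differential_def frag_extend_add)
  qed
  show "\<one>\<^bsub>Z\<^esub> \<in> B" using BI[of 0] by (simp add: bar_differential_def)
  show "inv\<^bsub>Z\<^esub> x \<in> B" if x: "x \<in> B" for x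
  proof -
    obtain c where c: "x = bar_differential G c" "Poly_Mapping.keys c \<subseteq> letter_pairs G"
      using BE x by metis
    have "inv\<^bsub>Z\<^esub> x = - x" using sub x by auto
    then show ?thesis
      using BI[of "- c"] c by (simp add: bar_differential_def frag_extend_minus)
  qed
qed

lemma B_diff: assumes "u \<in> B" "v \<in> B" shows "u - v \<in> B"
proof -
  have "inv\<^bsub>Z\<^esub> v = - v" using subgroup.subset[OF B_subgroup] assms by auto
  then show ?thesis
    using subgroup.m_closed[OF B_subgroup assms(1) subgroup.m_inv_closed[OF B_subgroup assms(2)]] by simp
qed

lemma B_normal: "B \<lhd> Z"
  using comm_group.subgroup_imp_normal[OF comm_Z B_subgroup] .

lemma boundary_2:
  assumes "g \<in> carrier G" "h \<in> carrier G"
  shows "frag_of [h] - frag_of [g \<otimes> h] + frag_of [g] \<in> B"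
proof -
  have "bar_differential G (frag_of [g, h]) \<in> B"
    unfolding relators_eq by (rule imageI) (use assms in auto)
  then show ?thesis by (simp add: bar_differential_def bar_face_sum_2)
qed

lemma comm_H1: "comm_group H1"
  using comm_group.abelian_FactGroup[OF comm_Z B_subgroup] .

lemma coset_eq:
  assumes "a \<in> carrier Z" "b \<in> carrier Z"
  shows "B #>\<^bsub>Z\<^esub> a = B #>\<^bsub>Z\<^esub> b \<longleftrightarrow> a - b \<in> B"
proof -
  interpret Z: comm_group Z by (rule comm_Z)
  interpret S: subgroup B Z by (rule B_subgroup)
  have "B #>\<^bsub>Z\<^esub> a = B #>\<^bsub>Z\<^esub> b \<longleftrightarrow> a \<in> B #>\<^bsub>Z\<^esub> b"
    using Z.rcos_self[OF assms(1) B_subgroup] Z.repr_independence[OF _ assms(2) B_subgroup, of a] by blast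
  also have "\<dots> \<longleftrightarrow> a \<otimes>\<^bsub>Z\<^esub> inv\<^bsub>Z\<^esub> b \<in> B"
    using S.rcos_module[OF Z.is_group assms(2,1)] .
  also have "inv\<^bsub>Z\<^esub> b = - b" using assms(2) by simp
  finally show ?thesis by simp
qed

lemma class_mult:
  assumes "g \<in> carrier G" "h \<in> carrier G"
  shows "bar_class G (g \<otimes> h) = bar_class G g \<otimes>\<^bsub>H1\<^esub> bar_class G h"
proof -
  interpret Z: comm_group Z by (rule comm_Z)
  interpret N: normal B Z by (rule B_normal)
  have gZ: "frag_of [g] \<in> carrier Z" "frag_of [h] \<in> carrier Z" "frag_of [g \<otimes> h] \<in> carrier Z"
    using assms by auto
  have "bar_class G g \<otimes>\<^bsub>H1\<^esub> bar_class G h = B #>\<^bsub>Z\<^esub> (frag_of [g] \<otimes>\<^bsub>Z\<^esub> frag_of [h])"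
    using N.rcos_sum[OF gZ(1,2)] by (simp add: FactGroup_def bar_class_def)
  also have "\<dots> = B #>\<^bsub>Z\<^esub> frag_of [g \<otimes> h]"
    unfolding coset_eq[OF Z.m_closed[OF gZ(1,2)] gZ(3)]
    using boundary_2[OF assms] by (simp add: algebra_simps)
  finally show ?thesis by (simp add: bar_class_def)
qed

lemma class_closed: "g \<in> carrier G \<Longrightarrow> bar_class G g \<in> carrier H1"
  unfolding bar_class_def FactGroup_def RCOSETS_def by (auto intro!: bexI[of _ "frag_of [g]"])

lemma class_hom: "bar_class G \<in> hom G H1"
  by (simp add: hom_def class_closed class_mult)

text \<open>
  The difference of the letters \<open>g\<close> and \<open>h\<close> is homologous to the letter \<open>g h\<^sup>-\<^sup>1\<close>, so an
  integral combination of letters reduces to a single one.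
\<close>

lemma chain_class:
  assumes "c \<in> carrier Z" shows "\<exists>g\<in>carrier G. c - frag_of [g] \<in> B"
proof -
  have "Poly_Mapping.keys c \<subseteq> letters G" using assms by simp
  then show ?thesis
  proof (induction c rule: frag_induction)
    case zero
    have "0 - (frag_of [\<one>] - frag_of [\<one> \<otimes> \<one>] + frag_of [\<one>]) \<in> B"
      using subgroup.one_closed[OF B_subgroup] by (intro B_diff boundary_2) auto
    then show ?case by (intro bexI[of _ \<one>]) auto
  next
    case (one x)
    then obtain g where "x = [g]" "g \<in> carrier G" by auto
    then show ?case using subgroup.one_closed[OF B_subgroup] by (intro bexI[of _ g]) auto
  next
    case (diff a b)
    then obtain g h where g: "g \<in> carrier G" "a - frag_of [g] \<in> B" and h: "h \<in> carrier G" "b - frag_of [h] \<in> B"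
      by blast
    let ?x = "g \<otimes> inv h"
    have gx: "?x \<otimes> h = g" using g h by (simp add: m_assoc)
    have "frag_of [h] - frag_of [g] + frag_of [?x] \<in> B"
      using boundary_2[of ?x h] g h unfolding gx by simp
    then have "((a - frag_of [g]) - (b - frag_of [h])) - (frag_of [h] - frag_of [g] + frag_of [?x]) \<in> B"
      using g h B_diff by blast
    then have "a - b - frag_of [?x] \<in> B"
      by (simp add: algebra_simps)
    then show ?case using g h by (intro bexI[of _ ?x]) auto
  qed
qed

lemma class_surj: assumes "C \<in> carrier H1" shows "\<exists>g\<in>carrier G. C = bar_class G g"
proof -
  obtain c where c: "c \<in> carrier Z" "C = B #>\<^bsub>Z\<^esub> c"
    using assms unfolding FactGroup_def RCOSETS_def by auto
  obtain g where g: "g \<in> carrier G" "c - frag_of [g] \<in> B" using chain_class[OF c(1)] by blast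
  then have "frag_of [g] \<in> carrier Z" by auto
  then show ?thesis using coset_eq[OF c(1)] c(2) g by (auto simp: bar_class_def)
qed

lemma one_H1: "\<one>\<^bsub>H1\<^esub> = B"
  by (simp add: FactGroup_def)

text \<open>
  The homology group is commutative, so it kills commutators.  Conversely the map from chains to the
  abelianization that sends a letter to its coset vanishes on boundaries.
\<close>

lemma class_eq_one_iff:
  assumes g: "g \<in> carrier G"
  shows "bar_class G g = \<one>\<^bsub>H1\<^esub> \<longleftrightarrow> g \<in> derived G (carrier G)"
proof
  interpret H: comm_group H1 by (rule comm_H1)
  interpret h: group_hom G H1 "bar_class G"
    using class_hom by (simp add: group_hom_def group_hom_axioms_def H.is_group)
  assume "g \<in> derived G (carrier G)"
  moreover have "derived H1 (bar_class G ` carrier G) = bar_class G ` derived G (carrier G)"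
    by (rule h.derived_img) auto
  moreover have "derived H1 (bar_class G ` carrier G) = {\<one>\<^bsub>H1\<^esub>}"
    by (rule H.derived_eq_singleton) (use class_closed in auto)
  ultimately show "bar_class G g = \<one>\<^bsub>H1\<^esub>" by blast
next
  let ?D = "derived G (carrier G)"
  interpret D: normal ?D G by (rule derived_self_is_normal)
  interpret Q: comm_group "G Mod ?D" by (rule derived_quot_is_comm_group)
  interpret Z: comm_group Z by (rule comm_Z)
  have "(\<lambda>x. ?D #> hd x) ` letters G \<subseteq> carrier (G Mod ?D)"
    by (auto simp: FactGroup_def RCOSETS_def)
  then obtain h where h: "h \<in> hom Z (G Mod ?D)" "\<And>x. x \<in> letters G \<Longrightarrow> h (frag_of x) = ?D #> hd x"
    using Q.free_Abelian_group_universal by metis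
  interpret h: group_hom Z "G Mod ?D" h
    using h(1) by (simp add: group_hom_def group_hom_axioms_def Q.is_group)
  have hf: "h (frag_of [x]) = ?D #> x" if "x \<in> carrier G" for x using h(2)[of "[x]"] that by auto
  have hd: "h (a - b) = h a \<otimes>\<^bsub>G Mod ?D\<^esub> inv\<^bsub>G Mod ?D\<^esub> h b" if "a \<in> carrier Z" "b \<in> carrier Z" for a b
    using h.hom_mult[of a "inv\<^bsub>Z\<^esub> b"] h.hom_inv[of b] that by simp
  have "bar_differential G c \<in> carrier Z \<and> h (bar_differential G c) = \<one>\<^bsub>G Mod ?D\<^esub>"
    if "Poly_Mapping.keys c \<subseteq> letter_pairs G" for c
    using that
  proof (induction c rule: frag_induction)
    case zero
    show ?case using h.hom_one by (simp add: bar_differential_def del: one_FactGroup)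
  next
    case (one x)
    then obtain a b where ab: "x = [a, b]" "a \<in> carrier G" "b \<in> carrier G" by auto
    have Zab: "frag_of [a] \<in> carrier Z" "frag_of [b] \<in> carrier Z" "frag_of [a \<otimes> b] \<in> carrier Z"
      using ab by auto
    have "bar_differential G (frag_of x) = (frag_of [b] \<otimes>\<^bsub>Z\<^esub> frag_of [a]) - frag_of [a \<otimes> b]"
      by (simp add: bar_differential_def ab bar_face_sum_2)
    then have "h (bar_differential G (frag_of x)) =
        (?D #> b) \<otimes>\<^bsub>G Mod ?D\<^esub> (?D #> a) \<otimes>\<^bsub>G Mod ?D\<^esub> inv\<^bsub>G Mod ?D\<^esub> (?D #> (a \<otimes> b))"
      using hd[OF Z.m_closed[OF Zab(2,1)] Zab(3)] h.hom_mult[OF Zab(2,1)] ab by (simp only: hf m_closed)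
    also have "(?D #> b) \<otimes>\<^bsub>G Mod ?D\<^esub> (?D #> a) = (?D #> a) \<otimes>\<^bsub>G Mod ?D\<^esub> (?D #> b)"
      using Q.m_comm h.hom_closed[OF Zab(1)] h.hom_closed[OF Zab(2)] ab by (simp add: hf)
    also have "\<dots> = ?D #> (a \<otimes> b)" using D.rcos_sum[OF ab(2,3)] by (simp add: FactGroup_def)
    finally have "h (bar_differential G (frag_of x)) = \<one>\<^bsub>G Mod ?D\<^esub>"
      using Q.r_inv[OF h.hom_closed[OF Zab(3)]] ab by (simp only: hf m_closed)
    moreover have "bar_differential G (frag_of x) \<in> carrier Z"
      by (rule differential_2_closed) (use one in simp)
    ultimately show ?case by blast
  next
    case (diff a b)
    have "bar_differential G (a - b) = bar_differential G a - bar_differential G b"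
      by (simp add: bar_differential_def frag_extend_diff)
    moreover have "bar_differential G a - bar_differential G b \<in> carrier Z"
      using diff keys_diff[of "bar_differential G a" "bar_differential G b"] by auto
    moreover have "h (bar_differential G a - bar_differential G b) = \<one>\<^bsub>G Mod ?D\<^esub>"
      using hd[of "bar_differential G a" "bar_differential G b"] diff Q.r_inv[OF Q.one_closed]
      by (simp only:)
    ultimately show ?case by simp
  qed
  then have hB: "h c = \<one>\<^bsub>G Mod ?D\<^esub>" if "c \<in> B" for c using that unfolding relators_eq by blast
  assume "bar_class G g = \<one>\<^bsub>H1\<^esub>"
  then have "frag_of [g] \<in> B"
    using coset_eq[of "frag_of [g]" 0] g Z.coset_mult_one[of B] subgroup.subset[OF B_subgroup]
    by (simp add: bar_class_def one_H1)
  then have "?D #> g = ?D" using hB hf[OF g] by (simp add: FactGroup_def)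
  then show "g \<in> ?D" using g rcos_self[OF g D.subgroup_axioms] by simp
qed

end

lemma bar_class_map:
  assumes G: "group G" and H: "group H" and f: "f \<in> hom G H" and g: "g \<in> carrier G"
  shows "group_homology_map 1 H f (bar_class G g) = bar_class H (f g)"
proof -
  interpret G: bar_group G using G by (simp add: bar_group_def)
  interpret H: bar_group H using H by (simp add: bar_group_def)
  let ?F = "frag_extend (\<lambda>gs. frag_of (map f gs))"
  have diff: "?F (bar_differential G c) = bar_differential H (?F c) \<and> Poly_Mapping.keys (?F c) \<subseteq> letter_pairs H"
    if "Poly_Mapping.keys c \<subseteq> letter_pairs G" for c
    using that
  proof (induction c rule: frag_induction)
    case zero
    show ?case by (simp add: bar_differential_def)
  next
    case (one x)
    then obtain a b where ab: "x = [a, b]" "a \<in> carrier G" "b \<in> carrier G" by auto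
    then show ?case using f
      by (auto simp: bar_differential_def bar_face_sum_2 frag_extend_add frag_extend_diff hom_def Pi_iff)
  next
    case (diff a b)
    then have "Poly_Mapping.keys (?F a - ?F b) \<subseteq> letter_pairs H" using keys_diff[of "?F a" "?F b"] by blast
    then show ?case using diff by (simp add: bar_differential_def frag_extend_diff)
  qed
  have FB: "?F x \<in> relators H" if "x \<in> relators G" for x
    using that diff unfolding relators_eq by auto
  have "group_homology_map 1 H f (bar_class G g) = relators H <#>\<^bsub>H.Z\<^esub> (?F ` bar_class G g)"
    by (simp only: group_homology_map_def quotient_map_def bar_cycles_1 relators_def)
  also have "\<dots> = bar_class H (f g)"
  proof (intro equalityI subsetI)
    fix y assume "y \<in> relators H <#>\<^bsub>H.Z\<^esub> (?F ` bar_class G g)"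
    then obtain b c where bc: "b \<in> relators H" "c \<in> relators G" "y = b + ?F (c + frag_of [g])"
      by (auto simp: set_mult_def bar_class_def r_coset_def)
    then have "y = (b - (0 - ?F c)) + frag_of [f g]" by (simp add: frag_extend_add)
    moreover have "b - (0 - ?F c) \<in> relators H"
      using bc FB subgroup.one_closed[OF H.B_subgroup] by (intro H.B_diff) auto
    ultimately show "y \<in> bar_class H (f g)" by (auto simp: bar_class_def r_coset_def)
  next
    fix y assume "y \<in> bar_class H (f g)"
    then obtain b where b: "b \<in> relators H" "y = b + frag_of [f g]"
      by (auto simp: bar_class_def r_coset_def)
    have "frag_of [g] \<in> bar_class G g"
      using subgroup.one_closed[OF G.B_subgroup] by (force simp: bar_class_def r_coset_def)
    then show "y \<in> relators H <#>\<^bsub>H.Z\<^esub> (?F ` bar_class G g)"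
      using b unfolding set_mult_def by (auto intro!: bexI[of _ b] bexI[of _ "frag_of [g]"])
  qed
  finally show ?thesis .
qed

section \<open>Base change into the square of a ring\<close>

text \<open>
  The common features of \<open>GL\<^sub>n(A)\<close> and of the stable group: the group structure is transported from the
  group \<open>\<G>\<close> of linear automorphisms.
\<close>

definition matrix_group :: "'a ring \<Rightarrow> ((nat \<Rightarrow> 'a uring) \<Rightarrow> nat \<Rightarrow> 'a uring) set \<Rightarrow> (nat \<Rightarrow> nat \<Rightarrow> int \<times> 'a) monoid \<Rightarrow> bool" where
  "matrix_group A \<G> G \<longleftrightarrow> carrier G = {\<alpha> \<in> row_finite A. mat_act A \<alpha> \<in> \<G>} \<and> monoid.mult G = matrix_mult (U A) \<and>
     one G = id_matrix (U A) \<and> id \<in> \<G> \<and> (\<forall>S\<in>\<G>. \<forall>T\<in>\<G>. S \<circ> T \<in> \<G>) \<and>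
     (\<forall>T\<in>\<G>. bij T \<and> inv_map T \<in> \<G> \<and> (\<exists>\<alpha>\<in>row_finite A. mat_act A \<alpha> = T))"

lemma mat_act_eqI: "\<alpha> \<in> row_finite A \<Longrightarrow> \<beta> \<in> row_finite A \<Longrightarrow> mat_act A \<alpha> = mat_act A \<beta> \<Longrightarrow> \<alpha> = \<beta>"
  by (rule mat_act_inj[of _ A]) simp_all

lemma matrix_group_group:
  assumes R: "matrix_group A \<G> G"
  shows "group G"
    and "\<And>\<alpha> \<beta>. \<alpha> \<in> carrier G \<Longrightarrow> \<beta> \<in> carrier G \<Longrightarrow> mat_act A (\<alpha> \<otimes>\<^bsub>G\<^esub> \<beta>) = mat_act A \<alpha> \<circ> mat_act A \<beta>"
    and "mat_act A \<one>\<^bsub>G\<^esub> = id"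
    and "\<And>\<alpha>. \<alpha> \<in> carrier G \<Longrightarrow> mat_act A (inv\<^bsub>G\<^esub> \<alpha>) = inv_map (mat_act A \<alpha>)"
    and "\<And>T. T \<in> \<G> \<Longrightarrow> \<exists>\<alpha>\<in>carrier G. mat_act A \<alpha> = T"
proof -
  have car: "\<alpha> \<in> carrier G \<longleftrightarrow> \<alpha> \<in> row_finite A \<and> mat_act A \<alpha> \<in> \<G>" for \<alpha>
    using R by (simp add: matrix_group_def)
  have mult: "\<alpha> \<otimes>\<^bsub>G\<^esub> \<beta> = matrix_mult (U A) \<alpha> \<beta>" and one: "\<one>\<^bsub>G\<^esub> = id_matrix (U A)" for \<alpha> \<beta>
    using R by (simp_all add: matrix_group_def)
  show surj: "\<exists>\<alpha>\<in>carrier G. mat_act A \<alpha> = T" if "T \<in> \<G>" for T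
    using R that by (auto simp: matrix_group_def)
  show lm: "mat_act A (\<alpha> \<otimes>\<^bsub>G\<^esub> \<beta>) = mat_act A \<alpha> \<circ> mat_act A \<beta>" if "\<alpha> \<in> carrier G" "\<beta> \<in> carrier G" for \<alpha> \<beta>
    using that by (simp add: car mult mat_act_mult)
  show l1: "mat_act A \<one>\<^bsub>G\<^esub> = id" by (simp add: one mat_act_id)
  have closed: "\<alpha> \<otimes>\<^bsub>G\<^esub> \<beta> \<in> carrier G" if "\<alpha> \<in> carrier G" "\<beta> \<in> carrier G" for \<alpha> \<beta>
    using that R lm[OF that] by (simp add: car mult matrix_mult_closed matrix_group_def)
  have onec: "\<one>\<^bsub>G\<^esub> \<in> carrier G"
    using R l1 by (simp add: car one id_matrix_row_finite matrix_group_def)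
  have eqI: "\<alpha> = \<beta>" if "\<alpha> \<in> carrier G" "\<beta> \<in> carrier G" "mat_act A \<alpha> = mat_act A \<beta>" for \<alpha> \<beta>
    using that mat_act_eqI car by blast
  have ex: "\<exists>\<beta>\<in>carrier G. mat_act A \<beta> = inv_map (mat_act A \<alpha>) \<and> \<beta> \<otimes>\<^bsub>G\<^esub> \<alpha> = \<one>\<^bsub>G\<^esub>" if a: "\<alpha> \<in> carrier G" for \<alpha>
  proof -
    have b: "bij (mat_act A \<alpha>)" and "inv_map (mat_act A \<alpha>) \<in> \<G>" using R a by (auto simp: car matrix_group_def)
    then obtain \<beta> where \<beta>: "\<beta> \<in> carrier G" "mat_act A \<beta> = inv_map (mat_act A \<alpha>)" using surj by blast
    have "\<beta> \<otimes>\<^bsub>G\<^esub> \<alpha> = \<one>\<^bsub>G\<^esub>"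
      by (rule eqI[OF closed[OF \<beta>(1) a] onec])
         (simp add: lm[OF \<beta>(1) a] l1 \<beta>(2) fun_eq_iff inv_comp_cancel[OF b])
    then show ?thesis using \<beta> by blast
  qed
  show "group G"
  proof (rule groupI)
    fix \<alpha> \<beta> \<gamma> assume abc: "\<alpha> \<in> carrier G" "\<beta> \<in> carrier G" "\<gamma> \<in> carrier G"
    show "\<alpha> \<otimes>\<^bsub>G\<^esub> \<beta> \<otimes>\<^bsub>G\<^esub> \<gamma> = \<alpha> \<otimes>\<^bsub>G\<^esub> (\<beta> \<otimes>\<^bsub>G\<^esub> \<gamma>)"
      by (rule eqI) (simp_all add: lm closed abc comp_assoc)
  next
    fix \<alpha> assume a: "\<alpha> \<in> carrier G"
    show "\<one>\<^bsub>G\<^esub> \<otimes>\<^bsub>G\<^esub> \<alpha> = \<alpha>"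
      by (rule eqI) (simp_all add: lm closed onec a l1)
    show "\<exists>\<beta>\<in>carrier G. \<beta> \<otimes>\<^bsub>G\<^esub> \<alpha> = \<one>\<^bsub>G\<^esub>" using ex[OF a] by blast
  qed (use closed onec in auto)
  then interpret group G .
  show "mat_act A (inv\<^bsub>G\<^esub> \<alpha>) = inv_map (mat_act A \<alpha>)" if a: "\<alpha> \<in> carrier G" for \<alpha>
    using ex[OF a] inv_equality a by auto
qed

lemma matrix_group_GL:
  assumes N: "nonunital_ring A"
  shows "matrix_group A (GLJ A {..<n}) (GL n A)"
proof -
  interpret J: two_sided_ideal "emb_ideal A" by (rule two_sided_ideal_emb)
  have UA: "unitalization A = U A" using N by simp
  have "monoid.mult (GL n A) = matrix_mult (U A)" "one (GL n A) = id_matrix (U A)"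
    unfolding GL_def unital_GL_def units_of_def matrix_monoid_def UA by simp_all
  then show ?thesis
    unfolding matrix_group_def carrier_GL[OF N]
    by (intro conjI ballI refl mat_act_surj J.GL_rel_id J.GL_rel_comp J.GL_rel_inv) (auto dest: J.GL_rel_bij)
qed

lemma matrix_group_GL_stable:
  assumes N: "nonunital_ring A"
  shows "matrix_group A (\<Union>n. GLJ A {..<n}) (GL_stable A)"
proof -
  interpret J: two_sided_ideal "emb_ideal A" by (rule two_sided_ideal_emb)
  have UA: "unitalization A = U A" using N by simp
  have "S \<circ> T \<in> (\<Union>n. J.GL_rel {..<n})" if "S \<in> J.GL_rel {..<k}" "T \<in> J.GL_rel {..<l}" for S T k l
  proof -
    have "S \<in> J.GL_rel {..<max k l}" "T \<in> J.GL_rel {..<max k l}"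
      using that by (auto elim: J.GL_rel_mono)
    then show ?thesis using J.GL_rel_comp by blast
  qed
  moreover have "carrier (GL_stable A) = {\<alpha> \<in> row_finite A. mat_act A \<alpha> \<in> (\<Union>n. J.GL_rel {..<n})}"
    by (auto simp: GL_stable_def carrier_GL[OF N])
  moreover have "monoid.mult (GL_stable A) = matrix_mult (U A)" "one (GL_stable A) = id_matrix (U A)"
    unfolding GL_stable_def UA by simp_all
  moreover have "bij T \<and> inv_map T \<in> (\<Union>n. J.GL_rel {..<n}) \<and> (\<exists>\<alpha>\<in>row_finite A. mat_act A \<alpha> = T)"
    if "T \<in> J.GL_rel {..<k}" for T k
    using J.GL_rel_bij[OF that] J.GL_rel_inv[OF that] mat_act_surj[OF that] by blast
  ultimately show ?thesis
    unfolding matrix_group_def using J.GL_rel_id by (intro conjI ballI) auto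
qed

lemma GL_subset_stable: "carrier (GL n A) \<subseteq> carrier (GL_stable A)"
  by (auto simp: GL_stable_def)

lemma GL_inclusion_hom: "(\<lambda>\<alpha>. \<alpha>) \<in> hom (GL n A) (GL_stable A)"
  by (auto simp: hom_def GL_stable_def) (simp add: GL_def unital_GL_def units_of_def matrix_monoid_def)

text \<open>
  The relative elementary groups are not known to be normal, but the union over all sizes contains the
  commutators and is closed under products.
\<close>

lemma derived_stable_E_rel:
  assumes N: "nonunital_ring A" and d: "d \<in> derived (GL_stable A) (carrier (GL_stable A))"
  shows "\<exists>k. mat_act A d \<in> two_sided_ideal.E_rel (emb_ideal A) {..<k}"
proof -
  interpret J: two_sided_ideal "emb_ideal A" by (rule two_sided_ideal_emb)
  note R = matrix_group_GL_stable[OF N]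
  note gr = matrix_group_group[OF R]
  interpret group "GL_stable A" by (rule gr(1))
  have comm: "\<exists>k. mat_act A c \<in> J.E_rel {..<k}" if c: "c \<in> derived_set (GL_stable A) (carrier (GL_stable A))" for c
  proof -
    obtain a b where ab: "a \<in> carrier (GL_stable A)" "b \<in> carrier (GL_stable A)"
      "c = a \<otimes>\<^bsub>GL_stable A\<^esub> b \<otimes>\<^bsub>GL_stable A\<^esub> inv\<^bsub>GL_stable A\<^esub> a \<otimes>\<^bsub>GL_stable A\<^esub> inv\<^bsub>GL_stable A\<^esub> b"
      using c by auto
    obtain k l where "a \<in> carrier (GL k A)" "b \<in> carrier (GL l A)" using ab by (auto simp: GL_stable_def)
    then have "mat_act A a \<in> J.GL_rel {..<max k l}" "mat_act A b \<in> J.GL_rel {..<max k l}"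
      unfolding carrier_GL[OF N] by (auto elim: J.GL_rel_mono)
    then obtain K where K: "finite K" "mat_act A a \<circ> mat_act A b \<circ> inv_map (mat_act A a) \<circ> inv_map (mat_act A b) \<in> J.E_rel K"
      using J.commutator_E_rel by blast
    obtain k where "K \<subseteq> {..<k}" using K(1) finite_nat_bounded by blast
    moreover have "mat_act A c = mat_act A a \<circ> mat_act A b \<circ> inv_map (mat_act A a) \<circ> inv_map (mat_act A b)"
      unfolding ab(3) using ab by (simp only: gr(2,4) m_closed inv_closed)
    ultimately show ?thesis using K(2) J.E_rel_mono by metis
  qed
  have dc: "derived_set (GL_stable A) (carrier (GL_stable A)) \<subseteq> carrier (GL_stable A)"
    by (rule derived_set_in_carrier) simp
  show ?thesis using d unfolding derived_def
  proof (induction d rule: generate.induct)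
    case one
    show ?case unfolding gr(3) using J.E_rel_id by blast
  next
    case (incl c)
    then show ?case by (rule comm)
  next
    case (inv c)
    then have "mat_act A (inv\<^bsub>GL_stable A\<^esub> c) = inv_map (mat_act A c)" using gr(4) dc by blast
    then show ?case using comm[OF inv] J.E_rel_inv by metis
  next
    case (eng c d)
    then obtain k l where kl: "mat_act A c \<in> J.E_rel {..<k}" "mat_act A d \<in> J.E_rel {..<l}" by blast
    have "mat_act A c \<in> J.E_rel {..<max k l}" "mat_act A d \<in> J.E_rel {..<max k l}"
      using J.E_rel_mono[OF kl(1)] J.E_rel_mono[OF kl(2)] by auto
    moreover have "c \<in> carrier (GL_stable A)" "d \<in> carrier (GL_stable A)"
      using eng(1,2) generate_in_carrier[OF dc] by auto
    ultimately show ?case using gr(2) J.E_rel_comp by metis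
  qed
qed

locale base_change =
  fixes A B :: "'a ring" and f :: "'a \<Rightarrow> 'a"
  assumes A: "nonunital_ring A" and B: "nonunital_ring B" and f: "f \<in> nonunital_ring_hom A B"
begin

interpretation NA: nonunital_ring A by (rule A)
interpretation NB: nonunital_ring B by (rule B)

lemma f_closed: "a \<in> carrier A \<Longrightarrow> f a \<in> carrier B"
  and f_add: "a \<in> carrier A \<Longrightarrow> b \<in> carrier A \<Longrightarrow> f (a \<oplus>\<^bsub>A\<^esub> b) = f a \<oplus>\<^bsub>B\<^esub> f b"
  and f_mult: "a \<in> carrier A \<Longrightarrow> b \<in> carrier A \<Longrightarrow> f (a \<otimes>\<^bsub>A\<^esub> b) = f a \<otimes>\<^bsub>B\<^esub> f b"
  using f by (auto simp: nonunital_ring_hom_def hom_def)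

lemma f_hom_add: "f \<in> hom (add_monoid A) (add_monoid B)"
  using f by (simp add: nonunital_ring_hom_def)

lemma f_zero: "f \<zero>\<^bsub>A\<^esub> = \<zero>\<^bsub>B\<^esub>"
  using hom_one[OF f_hom_add NA.add.is_group NB.add.is_group] by simp

lemma f_int: "a \<in> carrier A \<Longrightarrow> f (add_pow A (k :: int) a) = add_pow B k (f a)"
  using hom_int_pow[OF f_hom_add _ NA.add.is_group NB.add.is_group, of a k] by (simp add: add_pow_def)

text \<open>
  The endomorphism of the product ring induced by \<open>f\<close>: it projects to the unitalization of \<open>A\<close>, applies
  \<open>f\<close> and embeds the unitalization of \<open>B\<close>.  The effect of \<open>f\<close> on a matrix is characterized by the
  equation \<open>mat_act_GL_map\<close> because basis vectors are fixed.
\<close>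

definition uring_map :: "'a uring \<Rightarrow> 'a uring" where
  "uring_map r = emb B (map_prod id f (coord A r))"

lemma some: "some_ring A = A" "some_ring B = B"
  using A B by simp_all

lemma map_zero: "map_prod id f \<zero>\<^bsub>U A\<^esub> = \<zero>\<^bsub>U B\<^esub>" and map_one: "map_prod id f \<one>\<^bsub>U A\<^esub> = \<one>\<^bsub>U B\<^esub>"
  by (simp_all add: some unitalization_def f_zero)

lemma map_closed: "u \<in> carrier (U A) \<Longrightarrow> map_prod id f u \<in> carrier (U B)"
  using f_closed by (auto simp: some unitalization_def)

lemma uring_map_emb: "u \<in> carrier (U A) \<Longrightarrow> uring_map (emb A u) = emb B (map_prod id f u)"
  by (simp add: uring_map_def coord_emb)

lemma uring_map_add: "uring_map (r + s) = uring_map r + uring_map s"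
proof -
  have "map_prod id f (u \<oplus>\<^bsub>U A\<^esub> v) = map_prod id f u \<oplus>\<^bsub>U B\<^esub> map_prod id f v"
    if "u \<in> carrier (U A)" "v \<in> carrier (U A)" for u v
    using that by (auto simp: some unitalization_def f_add)
  then show ?thesis by (simp add: uring_map_def coord_ops emb_add map_closed)
qed

lemma uring_map_mult: "uring_map (r * s) = uring_map r * uring_map s"
proof -
  have "map_prod id f (u \<otimes>\<^bsub>U A\<^esub> v) = map_prod id f u \<otimes>\<^bsub>U B\<^esub> map_prod id f v"
    if "u \<in> carrier (U A)" "v \<in> carrier (U A)" for u v
    using that by (auto simp: some unitalization_def f_add f_mult f_int NA.mult_closed)
  then show ?thesis by (simp add: uring_map_def coord_ops emb_mult map_closed)
qed

lemma uring_map_zero: "uring_map 0 = 0" and uring_map_one: "uring_map 1 = 1"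
  using uring_map_emb[OF U_one_zero(1)] uring_map_emb[OF U_one_zero(2)] by (simp_all only: emb_zero emb_one map_zero map_one)

lemma uring_map_minus: "uring_map (- r) = - uring_map r"
  using uring_map_add[of r "- r"] uring_map_zero by (simp add: add_eq_0_iff)

lemma uring_map_sum: "uring_map (sum g K) = (\<Sum>k\<in>K. uring_map (g k))"
  by (induction K rule: infinite_finite_induct) (simp_all add: uring_map_zero uring_map_add)

lemma uring_map_basis: "uring_map \<circ> basis j = basis j"
  by (auto simp: basis_def fun_eq_iff uring_map_zero uring_map_one)

lemma uring_map_tv: "uring_map \<circ> tv i j a x = tv i j (uring_map a) (uring_map \<circ> x)"
  by (auto simp: tv_def fun_eq_iff uring_map_add uring_map_mult)

lemma uring_map_E_int: "\<sigma> \<in> E_int I \<Longrightarrow> uring_map \<circ> \<sigma> x = \<sigma> (uring_map \<circ> x)"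
proof (induction \<sigma> arbitrary: x rule: E_int.induct)
  case E_int_id
  show "uring_map \<circ> id x = id (uring_map \<circ> x)" by simp
next
  case (E_int_step i j s \<sigma>)
  have "uring_map s = s" using E_int_step(4) uring_map_minus[of 1] by (auto simp: uring_map_one)
  have "uring_map \<circ> (tv i j s \<circ> \<sigma>) x = uring_map \<circ> tv i j s (\<sigma> x)" by (simp add: comp_def)
  also have "\<dots> = tv i j (uring_map s) (uring_map \<circ> \<sigma> x)" by (rule uring_map_tv)
  also have "uring_map \<circ> \<sigma> x = \<sigma> (uring_map \<circ> x)" by (rule E_int_step.IH)
  also have "tv i j (uring_map s) (\<sigma> (uring_map \<circ> x)) = (tv i j s \<circ> \<sigma>) (uring_map \<circ> x)" by (simp add: \<open>uring_map s = s\<close>)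
  finally show "uring_map \<circ> (tv i j s \<circ> \<sigma>) x = (tv i j s \<circ> \<sigma>) (uring_map \<circ> x)" .
qed

lemma uring_map_conjugate:
  assumes s: "\<sigma> \<in> E_int I"
  shows "uring_map \<circ> conjugate \<sigma> (tv i j a) x = conjugate \<sigma> (tv i j (uring_map a)) (uring_map \<circ> x)"
  unfolding conjugate_def o_apply[of _ _ x] o_apply[of "\<sigma> \<circ> tv i j (uring_map a)"] o_apply[of \<sigma>]
  by (simp add: uring_map_E_int[OF s] uring_map_tv uring_map_E_int[OF E_int_inv[OF s]])

lemma GL_map_row_finite: "\<alpha> \<in> row_finite A \<Longrightarrow> GL_map f \<alpha> \<in> row_finite B"
proof -
  assume a: "\<alpha> \<in> row_finite A"
  have "{k. GL_map f \<alpha> i k \<noteq> \<zero>\<^bsub>U B\<^esub>} \<subseteq> {k. \<alpha> i k \<noteq> \<zero>\<^bsub>U A\<^esub>}" for i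
    using map_zero by (auto simp: GL_map_def matrix_map_def)
  then have "finite {k. GL_map f \<alpha> i k \<noteq> \<zero>\<^bsub>U B\<^esub>}" for i
    using row_finiteD(3)[OF a] finite_subset by blast
  then show ?thesis
    using row_finiteD(1)[OF a] map_closed by (simp add: row_finite_def) (simp add: GL_map_def matrix_map_def)
qed

lemma mat_act_GL_map:
  assumes a: "\<alpha> \<in> row_finite A"
  shows "mat_act B (GL_map f \<alpha>) (uring_map \<circ> x) = uring_map \<circ> mat_act A \<alpha> x"
proof
  fix i
  let ?K = "{k. emb A (\<alpha> i k) \<noteq> 0}"
  have fin: "finite ?K" by (rule row_finiteD(2)[OF a])
  have e: "emb B (GL_map f \<alpha> i k) = uring_map (emb A (\<alpha> i k))" for k
    by (simp add: GL_map_def matrix_map_def uring_map_emb row_finiteD(1)[OF a])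
  have "mat_act B (GL_map f \<alpha>) (uring_map \<circ> x) i = (\<Sum>k\<in>?K. uring_map (emb A (\<alpha> i k)) * uring_map (x k))"
    unfolding mat_act_def e by (subst dot_eq_sum[OF fin]) (auto simp: uring_map_zero)
  also have "\<dots> = uring_map (mat_act A \<alpha> x i)"
    unfolding mat_act_def dot_def by (simp add: uring_map_sum uring_map_mult)
  finally show "mat_act B (GL_map f \<alpha>) (uring_map \<circ> x) i = (uring_map \<circ> mat_act A \<alpha> x) i" by simp
qed

lemma mat_act_GL_map_basis:
  "\<alpha> \<in> row_finite A \<Longrightarrow> mat_act B (GL_map f \<alpha>) (basis j) = uring_map \<circ> mat_act A \<alpha> (basis j)"
  using mat_act_GL_map[of \<alpha> "basis j"] by (simp only: uring_map_basis)

lemma GL_map_mult: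
  assumes a: "\<alpha> \<in> row_finite A" and b: "\<beta> \<in> row_finite A"
  shows "GL_map f (matrix_mult (U A) \<alpha> \<beta>) = matrix_mult (U B) (GL_map f \<alpha>) (GL_map f \<beta>)"
proof (rule mat_act_inj)
  note ab = matrix_mult_closed(1)[OF a b] and fa = GL_map_row_finite[OF a] and fb = GL_map_row_finite[OF b]
  show "GL_map f (matrix_mult (U A) \<alpha> \<beta>) \<in> row_finite B" by (rule GL_map_row_finite[OF ab])
  show "matrix_mult (U B) (GL_map f \<alpha>) (GL_map f \<beta>) \<in> row_finite B" by (rule matrix_mult_closed(1)[OF fa fb])
  show "mat_act B (GL_map f (matrix_mult (U A) \<alpha> \<beta>)) (basis j)
      = mat_act B (matrix_mult (U B) (GL_map f \<alpha>) (GL_map f \<beta>)) (basis j)" for j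
    by (simp only: mat_act_GL_map_basis[OF ab] mat_act_mult[OF a b] mat_act_mult[OF fa fb] o_apply[of "mat_act B _"]
        o_apply[of "mat_act A _"] mat_act_GL_map_basis[OF b] mat_act_GL_map[OF a])
qed

lemma GL_map_id: "GL_map f (id_matrix (U A)) = id_matrix (U B)"
  using map_zero map_one by (simp add: GL_map_def matrix_map_def id_matrix_def fun_eq_iff)

lemma GL_map_closed: assumes a: "\<alpha> \<in> carrier (GL n A)" shows "GL_map f \<alpha> \<in> carrier (GL n B)"
proof -
  obtain \<beta> where a': "\<alpha> \<in> carrier (matrix_monoid n (U A))" and b: "\<beta> \<in> carrier (matrix_monoid n (U A))"
    and ab: "matrix_mult (U A) \<beta> \<alpha> = id_matrix (U A)" "matrix_mult (U A) \<alpha> \<beta> = id_matrix (U A)"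
    and fs: "\<And>i j. fst (\<alpha> i j) = (if i = j then 1 else 0)"
    using a unfolding carrier_GL_iff[OF A] by blast
  have mm: "GL_map f \<gamma> \<in> carrier (matrix_monoid n (U B))" if g: "\<gamma> \<in> carrier (matrix_monoid n (U A))" for \<gamma>
  proof -
    have "GL_map f \<gamma> i j = id_matrix (U B) i j" if "\<not> (i < n \<and> j < n)" for i j
    proof -
      have "\<gamma> i j = id_matrix (U A) i j" using g that unfolding matrix_monoid_def by auto
      then have "GL_map f \<gamma> i j = GL_map f (id_matrix (U A)) i j" by (simp add: GL_map_def matrix_map_def)
      then show ?thesis by (simp only: GL_map_id)
    qed
    then show ?thesis
      using row_finiteD(1)[OF GL_map_row_finite[OF matrix_monoid_row_finite[OF g]]] by (simp add: matrix_monoid_def)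
  qed
  note ra = matrix_monoid_row_finite[OF a'] and rb = matrix_monoid_row_finite[OF b]
  have "matrix_mult (U B) (GL_map f \<beta>) (GL_map f \<alpha>) = id_matrix (U B)"
    "matrix_mult (U B) (GL_map f \<alpha>) (GL_map f \<beta>) = id_matrix (U B)"
    using GL_map_mult[OF rb ra] GL_map_mult[OF ra rb] ab GL_map_id by simp_all
  moreover have "fst (GL_map f \<alpha> i j) = (if i = j then 1 else 0)" for i j
    using fs[of i j] by (simp add: GL_map_def matrix_map_def)
  ultimately show ?thesis
    unfolding carrier_GL_iff[OF B] using mm[OF a'] mm[OF b] by blast
qed

lemma GL_map_hom: "GL_map f \<in> hom (GL n A) (GL n B)"
proof (rule homI)
  fix \<alpha> \<beta> assume ab: "\<alpha> \<in> carrier (GL n A)" "\<beta> \<in> carrier (GL n A)"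
  show "GL_map f \<alpha> \<in> carrier (GL n B)" using ab by (rule_tac GL_map_closed)
  have "\<alpha> \<in> row_finite A" "\<beta> \<in> row_finite A" using ab by (auto simp: carrier_GL[OF A])
  then show "GL_map f (\<alpha> \<otimes>\<^bsub>GL n A\<^esub> \<beta>) = GL_map f \<alpha> \<otimes>\<^bsub>GL n B\<^esub> GL_map f \<beta>"
    using matrix_group_GL[OF A, of n] matrix_group_GL[OF B, of n] GL_map_mult by (simp add: matrix_group_def)
qed

lemma GL_map_hom_stable: "GL_map f \<in> hom (GL_stable A) (GL_stable B)"
proof (rule homI)
  fix \<alpha> \<beta> assume ab: "\<alpha> \<in> carrier (GL_stable A)" "\<beta> \<in> carrier (GL_stable A)"
  then show "GL_map f \<alpha> \<in> carrier (GL_stable B)" using GL_map_closed by (auto simp: GL_stable_def)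
  have "\<alpha> \<in> row_finite A" "\<beta> \<in> row_finite A" using ab by (auto simp: GL_stable_def carrier_GL[OF A])
  then show "GL_map f (\<alpha> \<otimes>\<^bsub>GL_stable A\<^esub> \<beta>) = GL_map f \<alpha> \<otimes>\<^bsub>GL_stable B\<^esub> GL_map f \<beta>"
    using matrix_group_GL_stable[OF A] matrix_group_GL_stable[OF B] GL_map_mult by (simp add: matrix_group_def)
qed

end

text \<open>
  The place of the hypothesis \<open>n \<ge> 3\<close>: \<open>e\<^sub>i\<^sub>j(x y)\<close> is the commutator of \<open>e\<^sub>i\<^sub>k(x)\<close> and \<open>e\<^sub>k\<^sub>j(y)\<close> for a third
  index \<open>k\<close>, and conjugation by \<open>\<sigma>\<close> preserves the congruence subgroup.
\<close>

lemma square_transvection_derived: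
  assumes N: "nonunital_ring B" and n: "3 \<le> n" and s: "\<sigma> \<in> E_int {..<n}"
    and ij: "i < n" "j < n" "i \<noteq> j" and b: "b \<in> ring_square B"
  shows "\<exists>\<gamma>\<in>derived (GL n B) (carrier (GL n B)). mat_act B \<gamma> = conjugate \<sigma> (tv i j (emb B (0, b)))"
proof -
  interpret J: two_sided_ideal "emb_ideal B" by (rule two_sided_ideal_emb)
  interpret NB: nonunital_ring B by (rule N)
  have some: "some_ring B = B" using N by simp
  note gr = matrix_group_group[OF matrix_group_GL[OF N, of n]]
  interpret G: group "GL n B" by (rule gr(1))
  let ?D = "derived (GL n B) (carrier (GL n B))"
  have D: "subgroup ?D (GL n B)" by (rule G.derived_is_subgroup) simp
  have Dc: "?D \<subseteq> carrier (GL n B)" using D by (rule subgroup.subset)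
  note bs = E_int_bij[OF s]
  let ?Q = "\<lambda>b. \<exists>\<gamma>\<in>?D. mat_act B \<gamma> = conjugate \<sigma> (tv i j (emb B (0, b)))"
  have mem: "emb B (0, x) \<in> emb_ideal B" if "x \<in> carrier B" for x
    by (rule emb_mem_ideal) (use that in \<open>simp add: some unitalization_def\<close>)
  have prod: "?Q (x \<otimes>\<^bsub>B\<^esub> y)" if x: "x \<in> carrier B" and y: "y \<in> carrier B" for x y
  proof -
    have "\<exists>k<n. k \<noteq> i \<and> k \<noteq> j"
    proof (rule ccontr)
      assume "\<not> ?thesis"
      then have "{..<n} \<subseteq> {i, j}" by auto
      then have "card {..<n} \<le> card {i, j}" by (rule card_mono[rotated]) simp
      then show False using n by (simp add: card_insert_if split: if_splits)
    qed
    then obtain k where k: "k < n" "k \<noteq> i" "k \<noteq> j" by blast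
    let ?t = "\<lambda>i k x. conjugate \<sigma> (tv i k (emb B (0, x)))"
    have t: "?t i k x \<in> J.GL_rel {..<n}" "?t k j y \<in> J.GL_rel {..<n}"
      using k ij mem[OF x] mem[OF y]
      by (auto intro!: J.GL_rel_conjugate[OF E_int_Aut[OF s]] J.tv_GL_rel)
    obtain \<alpha> where \<alpha>: "\<alpha> \<in> carrier (GL n B)" "mat_act B \<alpha> = ?t i k x" using gr(5)[OF t(1)] by blast
    obtain \<beta> where \<beta>: "\<beta> \<in> carrier (GL n B)" "mat_act B \<beta> = ?t k j y" using gr(5)[OF t(2)] by blast
    let ?\<gamma> = "\<alpha> \<otimes>\<^bsub>GL n B\<^esub> \<beta> \<otimes>\<^bsub>GL n B\<^esub> inv\<^bsub>GL n B\<^esub> \<alpha> \<otimes>\<^bsub>GL n B\<^esub> inv\<^bsub>GL n B\<^esub> \<beta>"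
    have "?\<gamma> \<in> ?D" unfolding derived_def using \<alpha>(1) \<beta>(1) by (intro generate.incl) blast
    moreover have "mat_act B ?\<gamma> = mat_act B \<alpha> \<circ> mat_act B \<beta> \<circ> inv_map (mat_act B \<alpha>) \<circ> inv_map (mat_act B \<beta>)"
      using \<alpha>(1) \<beta>(1) by (simp only: gr(2,4) G.m_closed G.inv_closed)
    moreover have "mat_act B \<alpha> \<circ> mat_act B \<beta> \<circ> inv_map (mat_act B \<alpha>) \<circ> inv_map (mat_act B \<beta>)
        = conjugate \<sigma> (tv i j (emb B (0, x) * emb B (0, y)))"
    proof -
      have "distinct [i, j, k]" using ij k by auto
      from tv_commutator[OF this, of "emb B (0, x)" "emb B (0, y)"] show ?thesis
        unfolding \<alpha>(2) \<beta>(2) using k by (simp add: conjugate_inv[symmetric] conjugate_comp[symmetric] bs bij_tv)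
    qed
    moreover have "emb B (0, x) * emb B (0, y) = emb B (0, x \<otimes>\<^bsub>B\<^esub> y)"
    proof -
      have "(0, x) \<otimes>\<^bsub>U B\<^esub> (0, y) = (0, x \<otimes>\<^bsub>B\<^esub> y)"
        using x y by (simp add: some unitalization_def NB.mult_closed)
      moreover have "(0, x) \<in> carrier (U B)" "(0, y) \<in> carrier (U B)"
        using x y by (simp_all add: some unitalization_def)
      ultimately show ?thesis using emb_mult[of "(0, x)" B "(0, y)"] by simp
    qed
    ultimately show ?thesis by metis
  qed
  have emb_add0: "emb B (0, x \<oplus>\<^bsub>B\<^esub> y) = emb B (0, x) + emb B (0, y)" if "x \<in> carrier B" "y \<in> carrier B" for x y
  proof -
    have "(0, x) \<oplus>\<^bsub>U B\<^esub> (0, y) = (0, x \<oplus>\<^bsub>B\<^esub> y)" by (simp add: some unitalization_def)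
    moreover have "(0, x) \<in> carrier (U B)" "(0, y) \<in> carrier (U B)"
      using that by (simp_all add: some unitalization_def)
    ultimately show ?thesis using emb_add[of "(0, x)" B "(0, y)"] by simp
  qed
  have emb_zero0: "emb B (0, \<zero>\<^bsub>B\<^esub>) = 0" using emb_zero[of B] by (simp add: some unitalization_def)
  have emb_minus0: "emb B (0, \<ominus>\<^bsub>B\<^esub> x) = - emb B (0, x)" if "x \<in> carrier B" for x
    using emb_add0[of x "\<ominus>\<^bsub>B\<^esub> x"] that by (simp add: NB.r_neg emb_zero0 add_eq_0_iff)
  have Sq: "{x \<otimes>\<^bsub>B\<^esub> y |x y. x \<in> carrier B \<and> y \<in> carrier B} \<subseteq> carrier B"
    using NB.mult_closed by auto
  show ?thesis using b unfolding ring_square_def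
  proof (induction b rule: generate.induct)
    case one
    have "\<one>\<^bsub>add_monoid B\<^esub> = \<zero>\<^bsub>B\<^esub>" by simp
    then have "conjugate \<sigma> (tv i j (emb B (0, \<one>\<^bsub>add_monoid B\<^esub>))) = id"
      by (simp only: emb_zero0 tv_zero conjugate_id[OF bs])
    then show ?case using subgroup.one_closed[OF D] gr(3) by metis
  next
    case (incl b)
    then show ?case using prod by blast
  next
    case (inv b)
    then obtain x y where b: "b = x \<otimes>\<^bsub>B\<^esub> y" "x \<in> carrier B" "y \<in> carrier B" by blast
    then have bc: "b \<in> carrier B" by (simp add: NB.mult_closed)
    obtain \<gamma> where \<gamma>: "\<gamma> \<in> ?D" "mat_act B \<gamma> = conjugate \<sigma> (tv i j (emb B (0, b)))"
      using prod[OF b(2,3)] b(1) by blast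
    have "mat_act B (inv\<^bsub>GL n B\<^esub> \<gamma>) = conjugate \<sigma> (tv i j (- emb B (0, b)))"
      using \<gamma> Dc gr(4) ij(3) by (auto simp: conjugate_inv[symmetric] bs bij_tv inv_tv)
    moreover have "inv\<^bsub>add_monoid B\<^esub> b = \<ominus>\<^bsub>B\<^esub> b" by (simp add: a_inv_def)
    ultimately show ?case using subgroup.m_inv_closed[OF D \<gamma>(1)] emb_minus0[OF bc] by metis
  next
    case (eng b c)
    have bc: "b \<in> carrier B" "c \<in> carrier B"
      using NB.add.generate_in_carrier[OF Sq eng(1)] NB.add.generate_in_carrier[OF Sq eng(2)] by simp_all
    obtain \<beta> where \<beta>: "\<beta> \<in> ?D" "mat_act B \<beta> = conjugate \<sigma> (tv i j (emb B (0, b)))"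
      using eng.IH(1) by blast
    obtain \<gamma> where \<gamma>: "\<gamma> \<in> ?D" "mat_act B \<gamma> = conjugate \<sigma> (tv i j (emb B (0, c)))"
      using eng.IH(2) by blast
    have "mat_act B (\<beta> \<otimes>\<^bsub>GL n B\<^esub> \<gamma>) = mat_act B \<beta> \<circ> mat_act B \<gamma>"
      using \<beta>(1) \<gamma>(1) Dc by (intro gr(2)) auto
    also have "\<dots> = conjugate \<sigma> (tv i j (emb B (0, b) + emb B (0, c)))"
      unfolding \<beta>(2) \<gamma>(2) conjugate_comp[OF bs, symmetric] tv_tv[OF ij(3)] ..
    also have "emb B (0, b) + emb B (0, c) = emb B (0, b \<otimes>\<^bsub>add_monoid B\<^esub> c)"
      using emb_add0[OF bc] by simp
    finally show ?case using subgroup.m_closed[OF D \<beta>(1) \<gamma>(1)] by (rule rev_bexI[rotated])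
  qed
qed

locale square_base_change = base_change +
  assumes sq: "\<And>a. a \<in> carrier A \<Longrightarrow> f a \<in> ring_square B"
begin

text \<open>
  A homomorphism with image in the square of \<open>B\<close> makes every relative elementary matrix a product of
  commutators, since it does so with the generators.
\<close>

lemma E_rel_derived:
  assumes n: "3 \<le> n" and e: "e \<in> two_sided_ideal.E_rel (emb_ideal A) {..<n}"
  shows "\<exists>\<gamma>\<in>derived (GL n B) (carrier (GL n B)). \<forall>x. mat_act B \<gamma> (uring_map \<circ> x) = uring_map \<circ> e x"
proof -
  interpret J: two_sided_ideal "emb_ideal A" by (rule two_sided_ideal_emb)
  note gr = matrix_group_group[OF matrix_group_GL[OF B, of n]]
  interpret G: group "GL n B" by (rule gr(1))
  let ?D = "derived (GL n B) (carrier (GL n B))"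
  have D: "subgroup ?D (GL n B)" by (rule G.derived_is_subgroup) simp
  have Dc: "?D \<subseteq> carrier (GL n B)" using D by (rule subgroup.subset)
  show ?thesis using e
  proof (induction e rule: J.E_rel.induct)
    case E_rel_id
    show "\<exists>\<gamma>\<in>?D. \<forall>x. mat_act B \<gamma> (uring_map \<circ> x) = uring_map \<circ> id x"
      using subgroup.one_closed[OF D] by (intro bexI[of _ "\<one>\<^bsub>GL n B\<^esub>"]) (simp_all add: gr(3))
  next
    case (E_rel_step \<sigma> i j a e)
    obtain \<gamma> where \<gamma>: "\<gamma> \<in> ?D" "\<And>x. mat_act B \<gamma> (uring_map \<circ> x) = uring_map \<circ> e x" using E_rel_step by blast
    define a' where "a' = snd (coord A a)"
    have ca: "coord A a = (0, a')" using E_rel_step(5) by (auto simp: a'_def emb_ideal_def prod_eq_iff)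
    then have a': "a' \<in> carrier A" using coord_closed[of A a] by (simp add: some unitalization_def)
    have "uring_map a = emb B (0, f a')" by (simp add: uring_map_def ca)
    then obtain \<delta> where \<delta>: "\<delta> \<in> ?D" "mat_act B \<delta> = conjugate \<sigma> (tv i j (uring_map a))"
      using square_transvection_derived[OF B n E_rel_step(1) _ _ E_rel_step(4) sq[OF a']] E_rel_step(2,3) by auto
    have "mat_act B (\<delta> \<otimes>\<^bsub>GL n B\<^esub> \<gamma>) (uring_map \<circ> x) = uring_map \<circ> (conjugate \<sigma> (tv i j a) \<circ> e) x" for x
    proof -
      have "mat_act B (\<delta> \<otimes>\<^bsub>GL n B\<^esub> \<gamma>) (uring_map \<circ> x) = mat_act B \<delta> (mat_act B \<gamma> (uring_map \<circ> x))"
        using gr(2) \<delta>(1) \<gamma>(1) Dc by (simp add: subset_iff)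
      also have "\<dots> = conjugate \<sigma> (tv i j (uring_map a)) (uring_map \<circ> e x)" by (simp only: \<gamma>(2) \<delta>(2))
      also have "\<dots> = uring_map \<circ> conjugate \<sigma> (tv i j a) (e x)" by (simp only: uring_map_conjugate[OF E_rel_step(1)])
      finally show ?thesis by (simp only: o_apply)
    qed
    then show "\<exists>\<gamma>\<in>?D. \<forall>x. mat_act B \<gamma> (uring_map \<circ> x) = uring_map \<circ> (conjugate \<sigma> (tv i j a) \<circ> e) x"
      using subgroup.m_closed[OF D \<delta>(1) \<gamma>(1)] by blast
  qed
qed

lemma GL_map_derived:
  assumes n: "3 \<le> n" and a: "\<alpha> \<in> carrier (GL n A)"
    and e: "mat_act A \<alpha> \<in> two_sided_ideal.E_rel (emb_ideal A) {..<n}"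
  shows "GL_map f \<alpha> \<in> derived (GL n B) (carrier (GL n B))"
proof -
  note gr = matrix_group_group[OF matrix_group_GL[OF B, of n]]
  interpret G: group "GL n B" by (rule gr(1))
  obtain \<gamma> where \<gamma>: "\<gamma> \<in> derived (GL n B) (carrier (GL n B))" "\<And>x. mat_act B \<gamma> (uring_map \<circ> x) = uring_map \<circ> mat_act A \<alpha> x"
    using E_rel_derived[OF n e] by blast
  have ra: "\<alpha> \<in> row_finite A" using a by (simp add: carrier_GL[OF A])
  have "\<gamma> \<in> carrier (GL n B)" using \<gamma>(1) G.derived_in_carrier[of "carrier (GL n B)"] by blast
  then have rg: "\<gamma> \<in> row_finite B" by (simp add: carrier_GL[OF B])
  have "GL_map f \<alpha> = \<gamma>"
  proof (rule mat_act_inj[OF GL_map_row_finite[OF ra] rg])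
    fix j show "mat_act B (GL_map f \<alpha>) (basis j) = mat_act B \<gamma> (basis j)"
      using \<gamma>(2)[of "basis j"] by (simp only: uring_map_basis mat_act_GL_map_basis[OF ra])
  qed
  then show ?thesis using \<gamma>(1) by simp
qed

lemma GL_map_derived_stable:
  assumes a: "\<alpha> \<in> carrier (GL n A)"
    and e: "mat_act A \<alpha> \<in> two_sided_ideal.E_rel (emb_ideal A) {..<n}"
  shows "GL_map f \<alpha> \<in> derived (GL_stable B) (carrier (GL_stable B))"
proof -
  interpret J: two_sided_ideal "emb_ideal A" by (rule two_sided_ideal_emb)
  let ?n = "max 3 n"
  have sub: "{..<n} \<subseteq> {..<?n}" by auto
  have "\<alpha> \<in> row_finite A" "mat_act A \<alpha> \<in> J.GL_rel {..<n}" using a unfolding carrier_GL[OF A] by blast+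
  then have aG: "\<alpha> \<in> carrier (GL ?n A)" unfolding carrier_GL[OF A] using J.GL_rel_mono[OF _ sub] by blast
  have *: "GL_map f \<alpha> \<in> derived (GL ?n B) (carrier (GL ?n B))"
    by (rule GL_map_derived[OF _ aG J.E_rel_mono[OF e sub]]) simp
  interpret G: group "GL ?n B" by (rule matrix_group_group(1)[OF matrix_group_GL[OF B]])
  interpret H: group "GL_stable B" by (rule matrix_group_group(1)[OF matrix_group_GL_stable[OF B]])
  interpret h: group_hom "GL ?n B" "GL_stable B" "\<lambda>\<alpha>. \<alpha>"
    using GL_inclusion_hom by (simp add: group_hom_def group_hom_axioms_def G.is_group H.is_group)
  have "derived (GL_stable B) (carrier (GL ?n B)) = derived (GL ?n B) (carrier (GL ?n B))"
    using h.derived_img[of "carrier (GL ?n B)"] by simp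
  moreover have "derived (GL_stable B) (carrier (GL ?n B)) \<subseteq> derived (GL_stable B) (carrier (GL_stable B))"
    by (rule H.mono_derived[OF GL_subset_stable])
  ultimately show ?thesis using * by blast
qed

end

section \<open>Stability of the first homology\<close>

lemma GL_group: "nonunital_ring A \<Longrightarrow> group (GL n A)"
  and GL_stable_group: "nonunital_ring A \<Longrightarrow> group (GL_stable A)"
  using matrix_group_group(1) matrix_group_GL matrix_group_GL_stable by blast+

lemma GL_mono: "nonunital_ring A \<Longrightarrow> k \<le> l \<Longrightarrow> \<alpha> \<in> carrier (GL k A) \<Longrightarrow> \<alpha> \<in> carrier (GL l A)"
  using two_sided_ideal.GL_rel_mono[OF two_sided_ideal_emb, of "mat_act A \<alpha>" A "{..<k}" "{..<l}"]
  by (auto simp: carrier_GL)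

text \<open>
  By surjective stability a matrix of size \<open>k + 1\<close> over \<open>A\<close> is one of size \<open>k\<close> up to relative elementary
  factors.  These become trivial in homology over \<open>B\<close>, so one base change suffices for all sizes \<open>k\<close>.
\<close>

lemma (in square_base_change) class_destabilize:
  assumes n: "1 \<le> n" and sr: "\<And>k. n \<le> k \<Longrightarrow> stable_range_condition k A"
    and h: "h \<in> carrier (GL_stable A)"
  shows "\<exists>g\<in>carrier (GL n B). bar_class (GL_stable B) (GL_map f h) = bar_class (GL_stable B) g"
proof -
  interpret J: two_sided_ideal "emb_ideal A" by (rule two_sided_ideal_emb)
  interpret GA: group "GL_stable A" by (rule GL_stable_group[OF A])
  interpret GB: bar_group "GL_stable B" using GL_stable_group[OF B] by (simp add: bar_group_def)
  interpret HB: comm_group GB.H1 by (rule GB.comm_H1)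
  note gr = matrix_group_group[OF matrix_group_GL_stable[OF A]]
  have step: "\<exists>g\<in>carrier (GL n B). bar_class (GL_stable B) (GL_map f h) = bar_class (GL_stable B) g"
    if "h \<in> carrier (GL k A)" "n \<le> k" for h k
    using that(2,1)
  proof (induction k arbitrary: h rule: dec_induct)
    case base
    then show ?case using GL_map_closed by blast
  next
    case (step k)
    let ?I = "{..<Suc k}"
    have I: "?I - {k} = {..<k}" by auto
    have hG: "mat_act A h \<in> J.GL_rel ?I" and hr: "h \<in> row_finite A" using step.prems by (auto simp: carrier_GL[OF A])
    have "J.stable_range_at (card ?I - 1)"
      using stable_range_emb[OF A sr[OF step.hyps(1)]] n step.hyps(1) by simp
    then obtain e b e' where d: "e \<in> J.E_rel ?I" "b \<in> J.GL_rel {..<k}" "e' \<in> J.E_rel ?I" "mat_act A h = e \<circ> b \<circ> e'"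
      using J.GL_rel_decomposition[of ?I k "mat_act A h"] hG n step.hyps(1) unfolding I by auto
    have eG: "e \<in> J.GL_rel ?I" "e' \<in> J.GL_rel ?I" using d(1,3) J.E_rel_GL_rel by auto
    obtain \<epsilon> where \<epsilon>: "\<epsilon> \<in> row_finite A" "mat_act A \<epsilon> = e" using mat_act_surj[OF eG(1)] by blast
    obtain \<epsilon>' where \<epsilon>': "\<epsilon>' \<in> row_finite A" "mat_act A \<epsilon>' = e'" using mat_act_surj[OF eG(2)] by blast
    obtain \<beta> where \<beta>: "\<beta> \<in> row_finite A" "mat_act A \<beta> = b" using mat_act_surj[OF d(2)] by blast
    have \<epsilon>G: "\<epsilon> \<in> carrier (GL (Suc k) A)" "\<epsilon>' \<in> carrier (GL (Suc k) A)" and \<beta>G: "\<beta> \<in> carrier (GL k A)"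
      using \<epsilon> \<epsilon>' \<beta> eG d(2) by (simp_all add: carrier_GL[OF A])
    have S: "\<epsilon> \<in> carrier (GL_stable A)" "\<epsilon>' \<in> carrier (GL_stable A)" "\<beta> \<in> carrier (GL_stable A)"
      "h \<in> carrier (GL_stable A)"
      using \<epsilon>G \<beta>G step.prems GL_subset_stable by blast+
    have "h = \<epsilon> \<otimes>\<^bsub>GL_stable A\<^esub> \<beta> \<otimes>\<^bsub>GL_stable A\<^esub> \<epsilon>'"
    proof (rule mat_act_eqI[OF hr])
      have "\<epsilon> \<otimes>\<^bsub>GL_stable A\<^esub> \<beta> \<otimes>\<^bsub>GL_stable A\<^esub> \<epsilon>' \<in> carrier (GL_stable A)" using S by simp
      then show "\<epsilon> \<otimes>\<^bsub>GL_stable A\<^esub> \<beta> \<otimes>\<^bsub>GL_stable A\<^esub> \<epsilon>' \<in> row_finite A"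
        using matrix_group_GL_stable[OF A] by (simp add: matrix_group_def)
      show "mat_act A h = mat_act A (\<epsilon> \<otimes>\<^bsub>GL_stable A\<^esub> \<beta> \<otimes>\<^bsub>GL_stable A\<^esub> \<epsilon>')"
        using S by (simp only: gr(2) GA.m_closed d(4) \<epsilon>(2) \<epsilon>'(2) \<beta>(2))
    qed
    then have fh: "GL_map f h = GL_map f \<epsilon> \<otimes>\<^bsub>GL_stable B\<^esub> GL_map f \<beta> \<otimes>\<^bsub>GL_stable B\<^esub> GL_map f \<epsilon>'"
      using hom_mult[OF GL_map_hom_stable] S by simp
    have fS: "GL_map f \<epsilon> \<in> carrier (GL_stable B)" "GL_map f \<beta> \<in> carrier (GL_stable B)" "GL_map f \<epsilon>' \<in> carrier (GL_stable B)"
      using hom_in_carrier[OF GL_map_hom_stable] S by blast+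
    have "GL_map f \<epsilon> \<in> derived (GL_stable B) (carrier (GL_stable B))"
      "GL_map f \<epsilon>' \<in> derived (GL_stable B) (carrier (GL_stable B))"
      using GL_map_derived_stable \<epsilon>G d(1,3) \<epsilon>(2) \<epsilon>'(2) by blast+
    then have one: "bar_class (GL_stable B) (GL_map f \<epsilon>) = \<one>\<^bsub>GB.H1\<^esub>" "bar_class (GL_stable B) (GL_map f \<epsilon>') = \<one>\<^bsub>GB.H1\<^esub>"
      using GB.class_eq_one_iff fS by blast+
    have "bar_class (GL_stable B) (GL_map f h) = bar_class (GL_stable B) (GL_map f \<beta>)"
      unfolding fh using fS GB.class_closed[OF fS(2)]
      by (simp only: GB.class_mult GB.m_closed one HB.l_one HB.r_one)
    then show ?case using step.IH[OF \<beta>G] by simp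
  qed
  obtain k where "h \<in> carrier (GL k A)" using h by (auto simp: GL_stable_def)
  then have "h \<in> carrier (GL (max k n) A)" using GL_mono[OF A, of k "max k n"] by simp
  then show ?thesis by (rule step) simp
qed

text \<open>
  A stable product of commutators is relative elementary in some size, and injective stability brings
  the size down to \<open>n\<close>.
\<close>

lemma stably_elementary:
  assumes A: "nonunital_ring A" and n: "3 \<le> n"
    and sr: "\<And>k. n - 1 \<le> k \<Longrightarrow> stable_range_condition k A"
    and g: "g \<in> carrier (GL n A)" and d: "g \<in> derived (GL_stable A) (carrier (GL_stable A))"
  shows "mat_act A g \<in> two_sided_ideal.E_rel (emb_ideal A) {..<n}"
proof -
  interpret J: two_sided_ideal "emb_ideal A" by (rule two_sided_ideal_emb)
  have gA: "mat_act A g \<in> Aut {..<n}" using g J.GL_rel_Aut by (simp add: carrier_GL[OF A])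
  have descend: "mat_act A g \<in> J.E_rel {..<n}" if "n \<le> k" "mat_act A g \<in> J.E_rel {..<k}" for k
    using that
  proof (induction k rule: dec_induct)
    case base
    then show ?case .
  next
    case (step k)
    let ?I = "{..<Suc k}"
    have I: "?I - {k} = {..<k}" by auto
    have "J.stable_range_at (k - 1)"
      using stable_range_emb[OF A sr[of "k - 1"]] n step.hyps(1) by simp
    then have "J.stable_range_at (card ?I - 2)" by (simp add: numeral_2_eq_2)
    moreover have "mat_act A g \<in> Aut (?I - {k})" unfolding I by (rule Aut_mono[OF gA]) (use step.hyps in auto)
    ultimately have "mat_act A g \<in> J.E_rel (?I - {k})"
      using n step by (intro J.E_rel_injective_stability) auto
    then show ?case using step.IH unfolding I by blast
  qed
  obtain k where "mat_act A g \<in> J.E_rel {..<k}" using derived_stable_E_rel[OF A d] by blast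
  then have "mat_act A g \<in> J.E_rel {..<max n k}" by (rule J.E_rel_mono) auto
  then show ?thesis by (rule descend[rotated]) simp
qed

lemma (in square_base_change) class_injective:
  assumes n: "3 \<le> n" and sr: "\<And>k. n - 1 \<le> k \<Longrightarrow> stable_range_condition k A"
    and g: "g \<in> carrier (GL n A)" and d: "g \<in> derived (GL_stable A) (carrier (GL_stable A))"
  shows "GL_map f g \<in> derived (GL n B) (carrier (GL n B))"
  using GL_map_derived[OF n g stably_elementary[OF A n sr g d]] .

lemma pro_zero_quotientI:
  assumes W: "\<And>m. group (W m)" and N: "\<And>m. subgroup (N m) (W m)"
    and into: "\<And>m. \<exists>s\<ge>m. \<forall>y\<in>carrier (W s). u s m y \<in> N m"
  shows "pro_zero (\<lambda>m. W m Mod N m) (\<lambda>s m. quotient_map (W m) (N m) (u s m))"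
  unfolding pro_zero_def
proof
  fix m
  obtain s where s: "s \<ge> m" "\<forall>y\<in>carrier (W s). u s m y \<in> N m" using into by blast
  show "\<exists>s\<ge>m. \<forall>x\<in>carrier (W s Mod N s). quotient_map (W m) (N m) (u s m) x = \<one>\<^bsub>W m Mod N m\<^esub>"
  proof (intro exI conjI ballI, rule s(1))
    fix x assume "x \<in> carrier (W s Mod N s)"
    then obtain y where y: "y \<in> carrier (W s)" "x = N s #>\<^bsub>W s\<^esub> y"
      by (auto simp: FactGroup_def RCOSETS_def)
    interpret Ws: group "W s" by (rule W)
    interpret Wm: group "W m" by (rule W)
    interpret Nm: subgroup "N m" "W m" by (rule N)
    have "x \<subseteq> carrier (W s)" using y subgroup.subset[OF N] by (simp add: Ws.r_coset_subset_G)
    then have xs: "u s m ` x \<subseteq> N m" using s(2) by blast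
    have yx: "y \<in> x" unfolding y(2) by (rule Ws.rcos_self[OF y(1) N])
    have "N m <#>\<^bsub>W m\<^esub> (u s m ` x) = N m"
    proof
      show "N m <#>\<^bsub>W m\<^esub> (u s m ` x) \<subseteq> N m" using xs Nm.m_closed by (auto simp: set_mult_def)
      show "N m \<subseteq> N m <#>\<^bsub>W m\<^esub> (u s m ` x)"
      proof
        fix a assume a: "a \<in> N m"
        have b: "u s m y \<in> N m" using xs yx by blast
        have "a = (a \<otimes>\<^bsub>W m\<^esub> inv\<^bsub>W m\<^esub> (u s m y)) \<otimes>\<^bsub>W m\<^esub> u s m y"
          using Nm.mem_carrier[OF a] Nm.mem_carrier[OF b] by (simp add: Wm.m_assoc)
        moreover have "a \<otimes>\<^bsub>W m\<^esub> inv\<^bsub>W m\<^esub> (u s m y) \<in> N m" using a b by (intro Nm.m_closed Nm.m_inv_closed)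
        ultimately show "a \<in> N m <#>\<^bsub>W m\<^esub> (u s m ` x)"
          unfolding set_mult_def using yx by blast
      qed
    qed
    then show "quotient_map (W m) (N m) (u s m) x = \<one>\<^bsub>W m Mod N m\<^esub>"
      by (simp add: quotient_map_def FactGroup_def)
  qed
qed

lemma ring_square_subgroup:
  assumes "nonunital_ring R" shows "subgroup (ring_square R) (add_monoid R)"
proof -
  interpret nonunital_ring R by (rule assms)
  show ?thesis unfolding ring_square_def
    by (rule add.generate_is_subgroup) (auto simp: mult_closed)
qed

lemma pro_square:
  assumes lev: "\<And>m. nonunital_ring (A m)" and tr: "\<And>m s. m \<le> s \<Longrightarrow> p s m \<in> nonunital_ring_hom (A s) (A m)"
    and z: "pro_zero (\<lambda>m. add_monoid (A m) Mod ring_square (A m))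
                  (\<lambda>s m. quotient_map (add_monoid (A m)) (ring_square (A m)) (p s m))"
  shows "\<exists>s\<ge>m. square_base_change (A s) (A m) (p s m)"
proof -
  obtain s where s: "s \<ge> m" "\<forall>x\<in>carrier (add_monoid (A s) Mod ring_square (A s)).
      quotient_map (add_monoid (A m)) (ring_square (A m)) (p s m) x = \<one>\<^bsub>add_monoid (A m) Mod ring_square (A m)\<^esub>"
    using z unfolding pro_zero_def by blast
  interpret S: nonunital_ring "A s" by (rule lev)
  interpret M: nonunital_ring "A m" by (rule lev)
  note subg = ring_square_subgroup
  have "p s m a \<in> ring_square (A m)" if a: "a \<in> carrier (A s)" for a
  proof -
    let ?x = "ring_square (A s) #>\<^bsub>add_monoid (A s)\<^esub> a"
    have "?x \<in> carrier (add_monoid (A s) Mod ring_square (A s))"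
      using a by (auto simp: FactGroup_def RCOSETS_def)
    then have eq: "ring_square (A m) <#>\<^bsub>add_monoid (A m)\<^esub> (p s m ` ?x) = ring_square (A m)"
      using s(2) by (auto simp: quotient_map_def FactGroup_def)
    have "a \<in> ?x" using S.add.rcos_self[OF _ subg[OF lev], of a] a by simp
    moreover have "\<zero>\<^bsub>A m\<^esub> \<in> ring_square (A m)" using subgroup.one_closed[OF subg[OF lev[of m]]] by simp
    ultimately have "\<zero>\<^bsub>A m\<^esub> \<oplus>\<^bsub>A m\<^esub> p s m a \<in> ring_square (A m) <#>\<^bsub>add_monoid (A m)\<^esub> (p s m ` ?x)"
      unfolding set_mult_def by auto
    moreover have "p s m a \<in> carrier (A m)"
      using tr[OF s(1)] a by (auto simp: nonunital_ring_hom_def hom_def)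
    ultimately show ?thesis unfolding eq by simp
  qed
  then have "square_base_change (A s) (A m) (p s m)"
    using lev tr[OF s(1)] by (simp add: square_base_change_def base_change_def square_base_change_axioms_def)
  then show ?thesis using s(1) by blast
qed

lemma stable_range_le:
  assumes "stable_range A \<le> enat n"
  shows "1 \<le> n \<and> (\<forall>k\<ge>n. stable_range_condition k A)"
proof -
  let ?S = "{enat r | r. 1 \<le> r \<and> (\<forall>n\<ge>r. stable_range_condition n A)}"
  have "?S \<noteq> {}"
  proof
    assume "?S = {}"
    then have "stable_range A = \<infinity>" unfolding stable_range_def by (simp only: Inf_enat_def simp_thms if_True)
    then show False using assms by simp
  qed
  then have "Inf ?S \<in> ?S" unfolding Inf_enat_def by (auto intro: LeastI)
  then obtain r where "stable_range A = enat r" "1 \<le> r" "\<forall>n\<ge>r. stable_range_condition n A"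
    unfolding stable_range_def by blast
  then show ?thesis using assms by auto
qed

theorem theorem2p5:
  fixes R :: "'j::order \<Rightarrow> 'r ring" and q :: "'j \<Rightarrow> 'j \<Rightarrow> 'r \<Rightarrow> 'r"
    and A :: "'j \<Rightarrow> 'a ring" and p :: "'j \<Rightarrow> 'j \<Rightarrow> 'a \<Rightarrow> 'a"
    and \<iota> :: "'j \<Rightarrow> 'a \<Rightarrow> 'r" and n :: nat
  assumes "unital_pro_ring R q"
    and "pro_ideal A p R q \<iota>"
    and "pro_zero (\<lambda>m. add_monoid (A m) Mod ring_square (A m))
                  (\<lambda>s m. quotient_map (add_monoid (A m)) (ring_square (A m)) (p s m))"
  shows "(pro_stable_range A \<le> enat n \<longrightarrow>
           pro_epimorphism
             (\<lambda>m. group_homology 1 (GL n (A m)))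
             (\<lambda>s m. group_homology_map 1 (GL n (A m)) (GL_map (p s m)))
             (\<lambda>m. group_homology 1 (GL_stable (A m)))
             (\<lambda>s m. group_homology_map 1 (GL_stable (A m)) (GL_map (p s m)))
             (\<lambda>m. group_homology_map 1 (GL_stable (A m)) (\<lambda>\<alpha>. \<alpha>)))
       \<and> (max 3 (pro_stable_range A + 1) \<le> enat n \<longrightarrow>
           pro_isomorphism
             (\<lambda>m. group_homology 1 (GL n (A m)))
             (\<lambda>s m. group_homology_map 1 (GL n (A m)) (GL_map (p s m)))
             (\<lambda>m. group_homology 1 (GL_stable (A m)))
             (\<lambda>s m. group_homology_map 1 (GL_stable (A m)) (GL_map (p s m)))
             (\<lambda>m. group_homology_map 1 (GL_stable (A m)) (\<lambda>\<alpha>. \<alpha>)))"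
proof -
  interpret A: pro_ring A p using assms(2) by (simp add: pro_ideal_def)
  note lev = A.level
  have sq: "\<exists>s\<ge>m. square_base_change (A s) (A m) (p s m)" for m
    using pro_square[where A = A and p = p, OF lev A.transition assms(3)] .
  have bg: "bar_group (GL k (A m))" and bs: "bar_group (GL_stable (A m))" for k m
    using GL_group[OF lev] GL_stable_group[OF lev] by (simp_all add: bar_group_def)
  have W: "group (group_homology 1 (GL_stable (A m)))" and V: "group (group_homology 1 (GL n (A m)))" for m
    using bar_group.comm_H1[OF bs] bar_group.comm_H1[OF bg] comm_group.axioms(2)
    unfolding bar_group.H1_eq[OF bs] bar_group.H1_eq[OF bg] by blast+
  have sr_level: "stable_range (A m) \<le> pro_stable_range A" for m
    unfolding pro_stable_range_def by (rule SUP_upper) simp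
  let ?f = "\<lambda>m. group_homology_map 1 (GL_stable (A m)) (\<lambda>\<alpha>. \<alpha>)"
  let ?t = "\<lambda>s m. group_homology_map 1 (GL n (A m)) (GL_map (p s m))"
  let ?u = "\<lambda>s m. group_homology_map 1 (GL_stable (A m)) (GL_map (p s m))"
  have fc: "?f m (bar_class (GL n (A m)) g) = bar_class (GL_stable (A m)) g" if "g \<in> carrier (GL n (A m))" for g m
    by (rule bar_class_map[OF GL_group[OF lev] GL_stable_group[OF lev] GL_inclusion_hom that])
  have VW: "C \<in> carrier (group_homology 1 G) \<longleftrightarrow> (\<exists>g\<in>carrier G. C = bar_class G g)" if "bar_group G" for C and G :: "(nat \<Rightarrow> nat \<Rightarrow> int \<times> 'a) monoid"
    unfolding bar_group.H1_eq[OF that] using bar_group.class_surj[OF that] bar_group.class_closed[OF that] by blast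
  let ?N = "\<lambda>m. ?f m ` carrier (group_homology 1 (GL n (A m)))"
  have N_eq: "?N m = bar_class (GL_stable (A m)) ` carrier (GL n (A m))" for m
  proof -
    have "carrier (group_homology 1 (GL n (A m))) = bar_class (GL n (A m)) ` carrier (GL n (A m))"
      using VW[OF bg] by blast
    then show ?thesis unfolding image_image by (simp only: image_image fc cong: image_cong)
  qed
  have epi: "pro_epimorphism (\<lambda>m. group_homology 1 (GL n (A m))) ?t (\<lambda>m. group_homology 1 (GL_stable (A m))) ?u ?f"
    if sr: "pro_stable_range A \<le> enat n"
    unfolding pro_epimorphism_def
  proof (rule pro_zero_quotientI[OF W])
    fix m
    show "subgroup (?N m) (group_homology 1 (GL_stable (A m)))"
    proof -
      have "group_hom (GL n (A m)) (group_homology 1 (GL_stable (A m))) (bar_class (GL_stable (A m)))"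
      proof -
        have "bar_class (GL_stable (A m)) \<circ> (\<lambda>\<alpha>. \<alpha>) \<in> hom (GL n (A m)) (group_homology 1 (GL_stable (A m)))"
          unfolding bar_group.H1_eq[OF bs] by (rule hom_compose[OF GL_inclusion_hom bar_group.class_hom[OF bs]])
        then show ?thesis using GL_group[OF lev] W by (simp add: group_hom_def group_hom_axioms_def o_def)
      qed
      then show ?thesis unfolding N_eq by (rule group_hom.img_is_subgroup)
    qed
    obtain s where s: "s \<ge> m" "square_base_change (A s) (A m) (p s m)" using sq by blast
    interpret square_base_change "A s" "A m" "p s m" by (rule s(2))
    have "?u s m y \<in> ?N m" if y: "y \<in> carrier (group_homology 1 (GL_stable (A s)))" for y
    proof -
      obtain h where h: "h \<in> carrier (GL_stable (A s))" "y = bar_class (GL_stable (A s)) h"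
        using y VW[OF bs] by blast
      have "?u s m y = bar_class (GL_stable (A m)) (GL_map (p s m) h)"
        unfolding h(2) by (rule bar_class_map[OF GL_stable_group[OF lev] GL_stable_group[OF lev] GL_map_hom_stable h(1)])
      moreover have "1 \<le> n" "\<And>k. n \<le> k \<Longrightarrow> stable_range_condition k (A s)"
        using stable_range_le order_trans[OF sr_level sr] by blast+
      then obtain g where "g \<in> carrier (GL n (A m))"
        "bar_class (GL_stable (A m)) (GL_map (p s m) h) = bar_class (GL_stable (A m)) g"
        using class_destabilize[OF _ _ h(1), of n] by blast
      ultimately show ?thesis unfolding N_eq by (simp only: imageI)
    qed
    then show "\<exists>s\<ge>m. \<forall>y\<in>carrier (group_homology 1 (GL_stable (A s))). ?u s m y \<in> ?N m"
      using s(1) by blast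
  qed
  moreover have "pro_isomorphism (\<lambda>m. group_homology 1 (GL n (A m))) ?t (\<lambda>m. group_homology 1 (GL_stable (A m))) ?u ?f"
    if sr: "max 3 (pro_stable_range A + 1) \<le> enat n"
    unfolding pro_isomorphism_def
  proof
    have n: "3 \<le> n" using sr by (simp add: numeral_eq_enat)
    have sr1: "pro_stable_range A \<le> enat (n - 1)"
    proof -
      have "pro_stable_range A + 1 \<le> enat n" using sr by simp
      then show ?thesis using n by (cases "pro_stable_range A") (auto simp: one_enat_def)
    qed
    have "enat (n - 1) \<le> enat n" by simp
    then show "pro_epimorphism (\<lambda>m. group_homology 1 (GL n (A m))) ?t (\<lambda>m. group_homology 1 (GL_stable (A m))) ?u ?f"
      by (rule epi[OF order_trans[OF sr1]])
    show "pro_zero (\<lambda>m. (group_homology 1 (GL n (A m)))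
        \<lparr>carrier := kernel (group_homology 1 (GL n (A m))) (group_homology 1 (GL_stable (A m))) (?f m)\<rparr>) ?t"
      unfolding pro_zero_def
    proof
      fix m
      obtain s where s: "s \<ge> m" "square_base_change (A s) (A m) (p s m)" using sq by blast
      interpret square_base_change "A s" "A m" "p s m" by (rule s(2))
      have sk: "\<And>k. n - 1 \<le> k \<Longrightarrow> stable_range_condition k (A s)"
        using stable_range_le order_trans[OF sr_level sr1] by blast
      have "?t s m x = \<one>\<^bsub>group_homology 1 (GL n (A m))\<^esub>"
        if x: "x \<in> kernel (group_homology 1 (GL n (A s))) (group_homology 1 (GL_stable (A s))) (?f s)" for x
      proof -
        obtain g where g: "g \<in> carrier (GL n (A s))" "x = bar_class (GL n (A s)) g"
          using x VW[OF bg] unfolding kernel_def by blast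
        have "bar_class (GL_stable (A s)) g = \<one>\<^bsub>group_homology 1 (GL_stable (A s))\<^esub>"
          using x fc[OF g(1)] g(2) by (simp add: kernel_def)
        then have "g \<in> derived (GL_stable (A s)) (carrier (GL_stable (A s)))"
          using bar_group.class_eq_one_iff[OF bs] g(1) GL_subset_stable unfolding bar_group.H1_eq[OF bs] by blast
        then have "GL_map (p s m) g \<in> derived (GL n (A m)) (carrier (GL n (A m)))"
          using class_injective[OF n _ g(1)] sk by blast
        moreover have "?t s m x = bar_class (GL n (A m)) (GL_map (p s m) g)"
          unfolding g(2) by (rule bar_class_map[OF GL_group[OF lev] GL_group[OF lev] GL_map_hom g(1)])
        ultimately show ?thesis
          using bar_group.class_eq_one_iff[OF bg] GL_map_closed[OF g(1)] unfolding bar_group.H1_eq[OF bg] by blast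
      qed
      then show "\<exists>s\<ge>m. \<forall>x\<in>carrier ((group_homology 1 (GL n (A s)))
          \<lparr>carrier := kernel (group_homology 1 (GL n (A s))) (group_homology 1 (GL_stable (A s))) (?f s)\<rparr>).
          ?t s m x = \<one>\<^bsub>(group_homology 1 (GL n (A m)))
          \<lparr>carrier := kernel (group_homology 1 (GL n (A m))) (group_homology 1 (GL_stable (A m))) (?f m)\<rparr>\<^esub>"
        using s(1) by (intro exI[of _ s]) simp
    qed
  qed
  ultimately show ?thesis by blast
qed

end
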